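(* If $N>N^*$, there exists $\varepsilon^1_N>0$ such that for any $s\in(1-\varepsilon^1_N,1)$, $E_{N,s}$ admits no local positive minimizer in $A_{t_s}$; that is, there is no positive function $u\in S(N)$ with $\int_{\mathbb{R}^2}|(-\Delta)^{\frac s2}u|^2\,dx<t_s$ and $E_{N,s}(u)=\inf_{w\in A_{t_s}}E_{N,s}(w)$.
   Context: Functions are real-valued on $\mathbb{R}^2$. For $0<s<1$, $(-\Delta)^{s}u=\mathcal{F}^{-1}(|\xi|^{2s}\mathcal{F}u)$, with $\mathcal F$ the Fourier transform, and $\mathcal{H}_s=\{u\in H^s(\mathbb{R}^2):\int_{\mathbb{R}^2}|x|^2|u|^2\,dx<\infty\}$. For $N>0$, $S(N)=\{u\in\mathcal{H}_s:\int_{\mathbb{R}^2}|u|^2\,dx=N\}$, and $$E_{N,s}(u)=\frac12\int_{\mathbb{R}^2}\big(|(-\Delta)^{\frac s2}u|^2+|x|^2|u|^2\big)\,dx-\frac14\int_{\mathbb{R}^2}|u|^4\,dx .$$ $Q$ is the unique (up to translation) positive solution in $H^1(\mathbb{R}^2)$ of $-\Delta u+u=|u|^2u$ and $N^*=\|Q\|_{L^2(\mathbb{R}^2)}^2$. For $\frac12<s<1$, $Q_s\in H^s(\mathbb{R}^2)$ is the unique (up to translation) positive ground state solution of $(-\Delta)^su+u=|u|^2u$ in $\mathbb{R}^2$, $N_s^*=\|Q_s\|_{L^2(\mathbb{R}^2)}^2$, and $$t_s=\frac{N}{2s-1}\Big(\frac{N_s^*}{N}\Big)^{\frac{s}{1-s}},\qquad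 A_{t_s}=\Big\{u\in S(N):\int_{\mathbb{R}^2}|(-\Delta)^{\frac s2}u|^2\,dx\le t_s\Big\}.$$ *)

theory Defs
  imports "HOL-Analysis.Analysis" "HOL-Library.Extended_Real"
begin

section \<open>The Fourier transform on $L^2(R^2)$ and the fractional Laplacian\<close>

definition L2 :: "(real^2 \<Rightarrow> complex) \<Rightarrow> bool" where
  "L2 f \<longleftrightarrow> f \<in> borel_measurable lborel \<and> integrable lborel (\<lambda>x. (cmod (f x))\<^sup>2)"

text \<open>The unitary normalisation with frequency variable \<open>\<xi>\<close> (no \<open>2\<pi>\<close> in the exponent), so that
  \<open>-\<Delta>\<close> has symbol \<open>\<bar>\<xi>\<bar>\<^sup>2\<close>. The sign \<open>\<sigma> = -1\<close> gives the Fourier transform and \<open>\<sigma> = 1\<close> its inverse.\<close>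

definition truncated_fourier :: "real \<Rightarrow> real \<Rightarrow> (real^2 \<Rightarrow> complex) \<Rightarrow> real^2 \<Rightarrow> complex" where
  "truncated_fourier \<sigma> R f \<xi> =
     (LINT x:cball 0 R|lborel. exp (\<i> * complex_of_real (\<sigma> * (x \<bullet> \<xi>))) * f x)
       / complex_of_real (2 * pi)"

text \<open>The integral over the plane need not converge absolutely for a square integrable \<open>f\<close>;
  the transform is the limit in \<open>L\<^sup>2\<close> of the integrals over balls. It is
  determined up to a null set, and one representative is chosen. The distance is measured with the
  nonnegative integral because the Bochner integral of a non-integrable function is 0.\<close>

definition is_L2_fourier :: "real \<Rightarrow> (real^2 \<Rightarrow> complex) \<Rightarrow> (real^2 \<Rightarrow> complex) \<Rightarrow> bool" where
  "is_L2_fourier \<sigma> f g \<longleftrightarrow> L2 f \<and> L2 g \<and>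
     ((\<lambda>R. \<integral>\<^sup>+ \<xi>. ennreal ((cmod (truncated_fourier \<sigma> R f \<xi> - g \<xi>))\<^sup>2) \<partial>lborel) \<longlongrightarrow> 0) at_top"

definition fourier :: "(real^2 \<Rightarrow> complex) \<Rightarrow> real^2 \<Rightarrow> complex" where
  "fourier f = (SOME g. is_L2_fourier (-1) f g)"

definition inv_fourier :: "(real^2 \<Rightarrow> complex) \<Rightarrow> real^2 \<Rightarrow> complex" where
  "inv_fourier f = (SOME g. is_L2_fourier 1 f g)"

abbreviation cplx :: "(real^2 \<Rightarrow> real) \<Rightarrow> real^2 \<Rightarrow> complex" where
  "cplx u \<equiv> \<lambda>x. complex_of_real (u x)"

text \<open>For real-valued \<open>u\<close> the result is real almost everywhere, but is typed as a complex function.\<close>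

definition frac_laplacian :: "real \<Rightarrow> (real^2 \<Rightarrow> real) \<Rightarrow> real^2 \<Rightarrow> complex" where
  "frac_laplacian s u =
     inv_fourier (\<lambda>\<xi>. complex_of_real (norm \<xi> powr (2 * s)) * fourier (cplx u) \<xi>)"

definition sobolev :: "real \<Rightarrow> (real^2 \<Rightarrow> real) set" where
  "sobolev s = {u. L2 (cplx u) \<and>
     integrable lborel (\<lambda>\<xi>. (1 + (norm \<xi>)\<^sup>2) powr s * (cmod (fourier (cplx u) \<xi>))\<^sup>2)}"

section \<open>The equation $(-\Delta)^s u + u = |u|^2 u$\<close>

definition mass :: "(real^2 \<Rightarrow> real) \<Rightarrow> real" where
  "mass u = (LINT x|lborel. \<bar>u x\<bar>\<^sup>2)"

definition kinetic :: "real \<Rightarrow> (real^2 \<Rightarrow> real) \<Rightarrow> real" where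
  "kinetic s u = (LINT x|lborel. (cmod (frac_laplacian (s/2) u x))\<^sup>2)"

definition quartic :: "(real^2 \<Rightarrow> real) \<Rightarrow> real" where
  "quartic u = (LINT x|lborel. \<bar>u x\<bar>^4)"

definition ae_positive :: "(real^2 \<Rightarrow> real) \<Rightarrow> bool" where
  "ae_positive u \<longleftrightarrow> (AE x in lborel. u x > 0)"

text \<open>Solutions in \<open>H\<^sup>s\<close> are weak solutions, tested against all of \<open>H\<^sup>s\<close>
  (\<open>\<bar>u\<bar>\<^sup>2u\<phi>\<close> is integrable for \<open>s \<ge> 1/2\<close>, since then \<open>H\<^sup>s\<close> embeds into \<open>L\<^sup>4\<close>).
  For \<open>s = 1\<close> the operator has symbol \<open>\<bar>\<xi>\<bar>\<^sup>2\<close>, and this is the \<open>H\<^sup>1\<close> weak form of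
  \<open>-\<Delta>u + u = \<bar>u\<bar>\<^sup>2u\<close>.\<close>

definition solution :: "real \<Rightarrow> (real^2 \<Rightarrow> real) \<Rightarrow> bool" where
  "solution s u \<longleftrightarrow> u \<in> sobolev s \<and>
     (\<forall>\<phi>\<in>sobolev s.
        (LINT x|lborel. frac_laplacian (s/2) u x * cnj (frac_laplacian (s/2) \<phi> x))
          + complex_of_real (LINT x|lborel. u x * \<phi> x)
        = complex_of_real (LINT x|lborel. \<bar>u x\<bar>\<^sup>2 * u x * \<phi> x))"

text \<open>The Weinstein (Gagliardo--Nirenberg) functional; it is invariant under \<open>u \<mapsto> a u(\<lambda> x)\<close>.
  A ground state, in the sense of Weinstein, is a solution at which this functional
  attains its infimum over the nonzero elements of \<open>H\<^sup>s\<close>, that is, a solution that is an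
  optimiser of the sharp Gagliardo--Nirenberg inequality.\<close>

definition weinstein :: "real \<Rightarrow> (real^2 \<Rightarrow> real) \<Rightarrow> real" where
  "weinstein s u = kinetic s u powr (1/s) * mass u powr (2 - 1/s) / quartic u"

definition positive_ground_state :: "real \<Rightarrow> (real^2 \<Rightarrow> real) \<Rightarrow> bool" where
  "positive_ground_state s u \<longleftrightarrow> solution s u \<and> ae_positive u \<and>
     (\<forall>v\<in>sobolev s. \<not> (AE x in lborel. v x = 0) \<longrightarrow> weinstein s u \<le> weinstein s v)"

section \<open>The constrained variational problem\<close>

definition H_space :: "real \<Rightarrow> (real^2 \<Rightarrow> real) set" where
  "H_space s = {u \<in> sobolev s. integrable lborel (\<lambda>x. (norm x)\<^sup>2 * \<bar>u x\<bar>\<^sup>2)}"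

definition S_set :: "real \<Rightarrow> real \<Rightarrow> (real^2 \<Rightarrow> real) set" where
  "S_set s N = {u \<in> H_space s. mass u = N}"

definition energy :: "real \<Rightarrow> (real^2 \<Rightarrow> real) \<Rightarrow> real" where
  "energy s u =
     1/2 * (LINT x|lborel. (cmod (frac_laplacian (s/2) u x))\<^sup>2 + (norm x)\<^sup>2 * \<bar>u x\<bar>\<^sup>2)
     - 1/4 * (LINT x|lborel. \<bar>u x\<bar>^4)"

text \<open>Here \<open>M\<close> stands for the critical mass \<open>N\<^sub>s\<^sup>*\<close>.\<close>

definition t_bound :: "real \<Rightarrow> real \<Rightarrow> real \<Rightarrow> real" where
  "t_bound s N M = N / (2 * s - 1) * (M / N) powr (s / (1 - s))"

definition A_set :: "real \<Rightarrow> real \<Rightarrow> real \<Rightarrow> (real^2 \<Rightarrow> real) set" where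
  "A_set s N t = {u \<in> S_set s N. kinetic s u \<le> t}"

text \<open>The infimum is taken in the extended reals, where it is meaningful without any
  boundedness assumption.\<close>

definition local_positive_minimizer :: "real \<Rightarrow> real \<Rightarrow> real \<Rightarrow> (real^2 \<Rightarrow> real) \<Rightarrow> bool" where
  "local_positive_minimizer s N t u \<longleftrightarrow>
     u \<in> S_set s N \<and> ae_positive u \<and> kinetic s u < t \<and>
     ereal (energy s u) = (INF w\<in>A_set s N t. ereal (energy s w))"

end

theory Submission
  imports Defs "HOL-Probability.Characteristic_Functions" "HOL-Real_Asymp.Real_Asymp"
begin

text \<open>
  Dilating a local minimizer \<open>u\<close> with \<open>kinetic s u < t\<close> to \<open>l u(l x)\<close> keeps the mass and, for \<open>l\<close> near 1,
  the constraint. Differentiating the energy at \<open>l = 1\<close> bounds the potential energy of \<open>u\<close> by its kinetic energy,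
  and then the uncertainty principle forces \<open>N \<le> 6 kinetic s u\<close>. So it suffices that
  \<open>t_bound s N (mass (Qs s))\<close> tends to 0 as \<open>s\<close> tends to 1, and this follows from
  \<open>mass (Qs s) \<le> mass Q < N\<close>. To compare the masses, evaluate the Weinstein functional at \<open>Qs s\<close> and
  at the competitor \<open>Q\<close>; with the identities of Nehari and Pohozaev its value is at least \<open>mass (Qs s) / 2\<close> and at
  most \<open>mass Q / 2\<close>, respectively.

  Pohozaev's identity is proved for arbitrary weak solutions, without regularity theory: the equation is
  tested with the dilation \<open>u(l x)\<close>, and the error is controlled by \<open>w = u - u(l \<cdot>)\<close>. The superlinear
  term in \<open>w\<close> is absorbed by a Gagliardo--Nirenberg inequality (available because a ground state minimizes the Weinstein
  functional), up to the \<open>L\<^sup>2\<close> norm of \<open>w\<close> on a ball, which is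
  \<open>O(\<bar>l - 1\<bar>\<^sup>s)\<close>. As \<open>2 s > 1\<close>, the first order term in \<open>l - 1\<close> must vanish.
\<close>

section \<open>Affine changes of variables, translations and Gaussians\<close>

text \<open>The classical proof of Pohozaev's identity tests with x . grad u, which need not lie in
  H^s. The dilation u(l x) does, at the price of a remainder quadratic in w. The H^s energy X of w
  is not known to be small compared with |l - 1|, so it has to cancel: the equation contributes -2 X
  with the good sign, and this pays for the absorption. The rest is the square of an L^2 norm on a
  ball, of order |l - 1|^(2 s), hence o(|l - 1|). Only an upper bound arises; as l may lie on either
  side of 1, it suffices.

  The embedding of H^s into L^4 comes from the minimality of a single ground state, at s = 3/4. It
  then serves all s in [3/4, 1], in particular s = 1, where \<open>Q\<close> is given only as a
  positive solution.

  As \<open>fourier\<close> and \<open>inv_fourier\<close> are arbitrary representatives,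
  Plancherel's identity is proved for the relation \<open>is_L2_fourier\<close>, and identities
  between transforms hold almost everywhere.

  The mass comparison gives mass (Qs s) / N \<le> q < 1 with q independent of s; in
  \<open>t_bound\<close> the exponent s / (1 - s) then does the rest.\<close>

lemma nn_integral_affine:
  fixes t :: "'a::euclidean_space"
  assumes [measurable]: "f \<in> borel_measurable borel" and c: "c \<noteq> 0"
  shows "(\<integral>\<^sup>+x. f x \<partial>lborel) = ennreal (\<bar>c\<bar> ^ DIM('a)) * (\<integral>\<^sup>+x. f (t + c *\<^sub>R x) \<partial>lborel)"
  by (subst lborel_affine[OF c, of t])
     (simp add: nn_integral_density nn_integral_distr nn_integral_cmult)

lemma integrable_affine:
  fixes t :: "'a::euclidean_space" and f :: "'a \<Rightarrow> 'b :: {banach, second_countable_topology}"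
  assumes f: "integrable lborel f" and c: "c \<noteq> 0"
  shows "integrable lborel (\<lambda>x. f (t + c *\<^sub>R x))"
proof -
  have [measurable]: "f \<in> borel_measurable borel" using f by auto
  have "(\<integral>\<^sup>+x. ennreal (norm (f x)) \<partial>lborel) < \<infinity>" using f by (simp add: integrable_iff_bounded)
  then have "(\<integral>\<^sup>+x. ennreal (norm (f (t + c *\<^sub>R x))) \<partial>lborel) < \<infinity>"
    using c by (subst (asm) nn_integral_affine[where c=c and t=t]) (auto simp: ennreal_mult_less_top)
  then show ?thesis by (simp add: integrable_iff_bounded)
qed

lemma integrable_affine_iff:
  fixes t :: "'a::euclidean_space" and f :: "'a \<Rightarrow> 'b :: {banach, second_countable_topology}"
  assumes c: "c \<noteq> 0"
  shows "integrable lborel (\<lambda>x. f (t + c *\<^sub>R x)) \<longleftrightarrow> integrable lborel f"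
proof
  assume "integrable lborel (\<lambda>x. f (t + c *\<^sub>R x))"
  from integrable_affine[OF this, of "1/c" "- (1/c) *\<^sub>R t"] show "integrable lborel f"
    using c by (simp add: algebra_simps)
qed (use integrable_affine c in blast)

lemma integral_affine:
  fixes t :: "'a::euclidean_space" and f :: "'a \<Rightarrow> 'b :: {banach, second_countable_topology}"
  assumes c: "c \<noteq> 0"
  shows "(\<integral>x. f x \<partial>lborel) = (\<bar>c\<bar> ^ DIM('a)) *\<^sub>R (\<integral>x. f (t + c *\<^sub>R x) \<partial>lborel)"
proof cases
  assume f: "integrable lborel f"
  have [measurable]: "f \<in> borel_measurable borel" using f by auto
  show ?thesis
    by (subst lborel_affine[OF c, of t]) (simp add: integral_density integral_distr)
next
  assume "\<not> integrable lborel f" with c show ?thesis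
    by (simp add: integrable_affine_iff not_integrable_integral_eq)
qed

section \<open>Translations and their continuity in L^1\<close>

lemma nn_integral_translate:
  fixes t :: "'a::euclidean_space"
  assumes [measurable]: "f \<in> borel_measurable borel"
  shows "(\<integral>\<^sup>+x. f (t + x) \<partial>lborel) = (\<integral>\<^sup>+x. f x \<partial>lborel)"
  using nn_integral_affine[OF assms, of 1 t] by simp

lemma integral_translate:
  fixes t :: "'a::euclidean_space" and f :: "'a \<Rightarrow> 'b :: {banach, second_countable_topology}"
  shows "(\<integral>x. f (t + x) \<partial>lborel) = (\<integral>x. f x \<partial>lborel)"
  using integral_affine[of 1 f t] by simp

lemma integrable_translate:
  fixes t :: "'a::euclidean_space" and f :: "'a \<Rightarrow> 'b :: {banach, second_countable_topology}"
  shows "integrable lborel f \<Longrightarrow> integrable lborel (\<lambda>x. f (t + x))"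
  using integrable_affine[of f 1 t] by simp

text \<open>If x lies in U, so does h n + x eventually, because U is open; dominated convergence
  then handles the points that leave U. The points that enter U are, after a translation, those that
  leave it under - h n.\<close>

lemma translation_indicator_open:
  fixes h :: "nat \<Rightarrow> 'a::euclidean_space"
  assumes U: "open U" "emeasure lborel U < \<infinity>" and h: "h \<longlonglongrightarrow> 0"
  shows "(\<lambda>n. \<integral>x. \<bar>indicator U (h n + x) - indicator U x :: real\<bar> \<partial>lborel) \<longlonglongrightarrow> 0"
proof -
  have [measurable]: "U \<in> sets borel" using U by simp
  have iU: "integrable lborel (indicator U :: 'a \<Rightarrow> real)"
    using U by (simp add: integrable_indicator_iff)
  have iUh: "integrable lborel (\<lambda>x. indicator U (t + x) :: real)" for t
    using integrable_translate[OF iU, of t] .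
  have D: "(\<lambda>n. \<integral>x. indicator U x * (1 - indicator U (k n + x) :: real) \<partial>lborel) \<longlonglongrightarrow> 0"
    if k: "k \<longlonglongrightarrow> 0" for k :: "nat \<Rightarrow> 'a"
  proof -
    have "(\<lambda>n. \<integral>x. indicator U x * (1 - indicator U (k n + x) :: real) \<partial>lborel) \<longlonglongrightarrow> integral\<^sup>L lborel (\<lambda>x::'a. 0::real)"
    proof (rule integral_dominated_convergence[where w="indicator U"])
      show "AE x in lborel. (\<lambda>n. indicator U x * (1 - indicator U (k n + x) :: real)) \<longlonglongrightarrow> 0"
      proof (rule AE_I2)
        fix x :: 'a
        show "(\<lambda>n. indicator U x * (1 - indicator U (k n + x) :: real)) \<longlonglongrightarrow> 0"
        proof (cases "x \<in> U")
          case True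
          have "(\<lambda>n. k n + x) \<longlonglongrightarrow> x" using tendsto_add[OF k tendsto_const[of x]] by simp
          then have "eventually (\<lambda>n. k n + x \<in> U) sequentially"
            using topological_tendstoD U True by blast
          then show ?thesis by (intro tendsto_eventually) (auto elim: eventually_mono simp: True)
        qed simp
      qed
    qed (auto simp: iU indicator_def)
    then show ?thesis by simp
  qed
  have eq: "(\<integral>x. \<bar>indicator U (t + x) - indicator U x :: real\<bar> \<partial>lborel) =
    (\<integral>x. indicator U x * (1 - indicator U (- t + x) :: real) \<partial>lborel)
    + (\<integral>x. indicator U x * (1 - indicator U (t + x) :: real) \<partial>lborel)" for t :: 'a
  proof -
    have i1: "integrable lborel (\<lambda>x. indicator U x * (1 - indicator U (s + x) :: real))" for s :: 'a
      by (rule Bochner_Integration.integrable_bound[OF iU]) (auto simp: indicator_def)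
    have i2: "integrable lborel (\<lambda>x. indicator U (t + x) * (1 - indicator U x :: real))"
      by (rule Bochner_Integration.integrable_bound[OF iUh[of t]]) (auto simp: indicator_def)
    have "(\<integral>x. indicator U x * (1 - indicator U (- t + x) :: real) \<partial>lborel)
       = (\<integral>x. indicator U (t + x) * (1 - indicator U x :: real) \<partial>lborel)"
      by (subst integral_translate[of _ t, symmetric]) simp
    moreover have "(\<integral>x. \<bar>indicator U (t + x) - indicator U x :: real\<bar> \<partial>lborel) =
       (\<integral>x. indicator U (t + x) * (1 - indicator U x :: real) + indicator U x * (1 - indicator U (t + x) :: real) \<partial>lborel)"
      by (intro Bochner_Integration.integral_cong) (auto simp: indicator_def)
    ultimately show ?thesis using i1 i2 by simp
  qed
  have "(\<lambda>n. (\<integral>x. indicator U x * (1 - indicator U (- h n + x) :: real) \<partial>lborel)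
    + (\<integral>x. indicator U x * (1 - indicator U (h n + x) :: real) \<partial>lborel)) \<longlonglongrightarrow> 0 + 0"
    using h tendsto_minus[OF h] by (intro tendsto_add D) auto
  then show ?thesis unfolding eq by simp
qed

text \<open>Translations are isometries of L^1, so the functions with a continuous translation orbit
  form a closed set. This serves twice below: to pass from open to measurable sets, and from simple
  to integrable functions.\<close>

lemma translation_L1_approx:
  fixes f :: "'a::euclidean_space \<Rightarrow> 'b :: {banach, second_countable_topology}"
  assumes f: "integrable lborel f"
    and appr: "\<And>e. e > 0 \<Longrightarrow> \<exists>g. integrable lborel g \<and> (\<integral>x. norm (f x - g x) \<partial>lborel) \<le> e \<and>
         (\<lambda>n. \<integral>x. norm (g (h n + x) - g x) \<partial>lborel) \<longlonglongrightarrow> 0"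
  shows "(\<lambda>n. \<integral>x. norm (f (h n + x) - f x) \<partial>lborel) \<longlonglongrightarrow> 0"
proof (rule LIMSEQ_I)
  fix e :: real assume e: "e > 0"
  obtain g where g: "integrable lborel g" "(\<integral>x. norm (f x - g x) \<partial>lborel) \<le> e/3"
    "(\<lambda>n. \<integral>x. norm (g (h n + x) - g x) \<partial>lborel) \<longlonglongrightarrow> 0"
    using appr[of "e/3"] e by auto
  have bd: "(\<integral>x. norm (f (t + x) - f x) \<partial>lborel) \<le> 2 * (e/3) + (\<integral>x. norm (g (t + x) - g x) \<partial>lborel)" for t
  proof -
    note [simp] = f g(1) integrable_translate[OF f] integrable_translate[OF g(1)]
    have "(\<integral>x. norm (f (t + x) - f x) \<partial>lborel) \<le>
       (\<integral>x. norm (f (t + x) - g (t + x)) + norm (f x - g x) + norm (g (t + x) - g x) \<partial>lborel)"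
    proof (rule integral_mono)
      fix x
      have "f (t + x) - f x = (f (t + x) - g (t + x)) - (f x - g x) + (g (t + x) - g x)" by simp
      then show "norm (f (t + x) - f x) \<le> norm (f (t + x) - g (t + x)) + norm (f x - g x) + norm (g (t + x) - g x)"
        using norm_triangle_ineq[of "(f (t + x) - g (t + x)) - (f x - g x)" "g (t + x) - g x"]
          norm_triangle_ineq4[of "f (t + x) - g (t + x)" "f x - g x"] by simp
    qed (intro Bochner_Integration.integrable_add integrable_norm Bochner_Integration.integrable_diff; simp)+
    also have "\<dots> = (\<integral>x. norm (f (t + x) - g (t + x)) \<partial>lborel) + (\<integral>x. norm (f x - g x) \<partial>lborel) + (\<integral>x. norm (g (t + x) - g x) \<partial>lborel)"
      by (simp add: Bochner_Integration.integral_add)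
    also have "(\<integral>x. norm (f (t + x) - g (t + x)) \<partial>lborel) = (\<integral>x. norm (f x - g x) \<partial>lborel)"
      using integral_translate[of "\<lambda>x. norm (f x - g x)" t] by simp
    finally show ?thesis using g(2) by simp
  qed
  obtain N where N: "\<And>n. n \<ge> N \<Longrightarrow> norm (\<integral>x. norm (g (h n + x) - g x) \<partial>lborel) < e/3"
    using LIMSEQ_D[OF g(3), of "e/3"] e by auto
  show "\<exists>N. \<forall>n\<ge>N. norm ((\<integral>x. norm (f (h n + x) - f x) \<partial>lborel) - 0) < e"
  proof (intro exI allI impI)
    fix n assume "n \<ge> N"
    then have "(\<integral>x. norm (g (h n + x) - g x) \<partial>lborel) < e/3" using N[of n] by simp
    with bd[of "h n"] show "norm ((\<integral>x. norm (f (h n + x) - f x) \<partial>lborel) - 0) < e"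
      by simp
  qed
qed

lemma translation_continuous_L1:
  fixes f :: "'a::euclidean_space \<Rightarrow> 'b :: {banach, second_countable_topology}"
  assumes f: "integrable lborel f" and h: "h \<longlonglongrightarrow> 0"
  shows "(\<lambda>n. \<integral>x. norm (f (h n + x) - f x) \<partial>lborel) \<longlonglongrightarrow> 0"
  using f
proof (induction rule: integrable_induct)
  case (base A c)
  note [measurable] = base(1)
  have iA: "integrable lborel (indicator A :: 'a \<Rightarrow> real)"
    using base by (simp add: integrable_indicator_iff)
  have "(\<lambda>n. \<integral>x. norm (indicator A (h n + x) - indicator A x :: real) \<partial>lborel) \<longlonglongrightarrow> 0"
  proof (rule translation_L1_approx[OF iA])
    fix e :: real assume e: "e > 0"
    \<comment> \<open>Outer regularity reduces a measurable set to an open one, where pointwise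
      convergence of the translated indicators is available.\<close>
    obtain U where U: "open U" "A \<subseteq> U" "emeasure lborel (U - A) < e"
      using outer_regular_lborel[of A e] base e by auto
    note [measurable] = borel_open[OF U(1)]
    have "emeasure lborel U \<le> emeasure lborel A + emeasure lborel (U - A)"
      using emeasure_subadditive[of A lborel "U - A"] U base by (simp add: Un_absorb1)
    also have "\<dots> < \<infinity>" using U(3) base(2) by (metis ennreal_add_eq_top infinity_ennreal_def less_top top.extremum_strict)
    finally have fU: "emeasure lborel U < \<infinity>" .
    have iU: "integrable lborel (indicator U :: 'a \<Rightarrow> real)"
      using fU by (simp add: integrable_indicator_iff)
    have "(\<integral>x. norm (indicator A x - indicator U x :: real) \<partial>lborel) = (\<integral>x. indicator (U - A) x \<partial>lborel)"
      using U(2) by (intro Bochner_Integration.integral_cong) (auto simp: indicator_def)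
    also have "\<dots> = measure lborel (U - A)" by simp
    also have "\<dots> \<le> e" using U(3) e by (simp add: measure_def enn2real_leI less_imp_le)
    finally show "\<exists>g. integrable lborel g \<and> (\<integral>x. norm (indicator A x - g x :: real) \<partial>lborel) \<le> e \<and>
         (\<lambda>n. \<integral>x. norm (g (h n + x) - g x) \<partial>lborel) \<longlonglongrightarrow> 0"
      using iU translation_indicator_open[OF U(1) fU h] by (intro exI[of _ "indicator U"]) auto
  qed
  then have "(\<lambda>n. (\<integral>x. norm (indicator A (h n + x) - indicator A x :: real) \<partial>lborel) * norm c) \<longlonglongrightarrow> 0"
    by (rule tendsto_mult_left_zero)
  also have "(\<lambda>n. (\<integral>x. norm (indicator A (h n + x) - indicator A x :: real) \<partial>lborel) * norm c) =
     (\<lambda>n. \<integral>x. norm (indicator A (h n + x) *\<^sub>R c - indicator A x *\<^sub>R c) \<partial>lborel)"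
    by (simp flip: scaleR_left_diff_distrib)
  finally show ?case .
next
  case (add f g)
  note [simp] = add.hyps integrable_translate[OF add.hyps(1)] integrable_translate[OF add.hyps(2)]
  show ?case
  proof (rule tendsto_sandwich[OF _ _ tendsto_const])
    show "(\<lambda>n. (\<integral>x. norm (f (h n + x) - f x) \<partial>lborel) + (\<integral>x. norm (g (h n + x) - g x) \<partial>lborel)) \<longlonglongrightarrow> 0"
      using tendsto_add[OF add.IH] by simp
    show "\<forall>\<^sub>F n in sequentially. (\<integral>x. norm (f (h n + x) + g (h n + x) - (f x + g x)) \<partial>lborel) \<le>
       (\<integral>x. norm (f (h n + x) - f x) \<partial>lborel) + (\<integral>x. norm (g (h n + x) - g x) \<partial>lborel)"
    proof (rule always_eventually, rule allI)
      fix n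
      have "(\<integral>x. norm (f (h n + x) + g (h n + x) - (f x + g x)) \<partial>lborel) \<le>
       (\<integral>x. norm (f (h n + x) - f x) + norm (g (h n + x) - g x) \<partial>lborel)"
        by (rule integral_mono) (auto simp: add_diff_add norm_triangle_ineq)
      then show "(\<integral>x. norm (f (h n + x) + g (h n + x) - (f x + g x)) \<partial>lborel) \<le>
       (\<integral>x. norm (f (h n + x) - f x) \<partial>lborel) + (\<integral>x. norm (g (h n + x) - g x) \<partial>lborel)"
        by simp
    qed
  qed auto
next
  case (lim f s)
  have "(\<lambda>i. \<integral>x. norm (f x - s i x) \<partial>lborel) \<longlonglongrightarrow> integral\<^sup>L lborel (\<lambda>x::'a. 0::real)"
  \<comment> \<open>The induction rule supplies norm (s i x) \<le> 2 * norm (f x), whence the factor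
    3.\<close>
  proof (rule integral_dominated_convergence[where w="\<lambda>x. 3 * norm (f x)"])
    show "AE x in lborel. (\<lambda>i. norm (f x - s i x)) \<longlonglongrightarrow> 0"
    proof (rule AE_I2)
      fix x
      have "(\<lambda>i. norm (f x - s i x)) \<longlonglongrightarrow> norm (f x - f x)"
        using lim.hyps(2)[of x] by (intro tendsto_intros) auto
      then show "(\<lambda>i. norm (f x - s i x)) \<longlonglongrightarrow> 0" by simp
    qed
    show "AE x in lborel. norm (norm (f x - s i x)) \<le> 3 * norm (f x)" for i
    proof (rule AE_I2)
      fix x show "norm (norm (f x - s i x)) \<le> 3 * norm (f x)"
        using lim.hyps(3)[of x i] norm_triangle_ineq4[of "f x" "s i x"] by simp
    qed
    show "(\<lambda>x. norm (f x - s i x)) \<in> borel_measurable lborel" for i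
      using lim.hyps(1)[of i] lim.hyps(4) by auto
  qed (use lim.hyps in auto)
  then have L: "(\<lambda>i. \<integral>x. norm (f x - s i x) \<partial>lborel) \<longlonglongrightarrow> 0" by simp
  show ?case
  proof (rule translation_L1_approx[OF lim.hyps(4)])
    fix e :: real assume "e > 0"
    then obtain i where "(\<integral>x. norm (f x - s i x) \<partial>lborel) < e"
      using order_tendstoD(2)[OF L, of e] by (auto simp: eventually_sequentially)
    then show "\<exists>g. integrable lborel g \<and> (\<integral>x. norm (f x - g x) \<partial>lborel) \<le> e \<and>
         (\<lambda>n. \<integral>x. norm (g (h n + x) - g x) \<partial>lborel) \<longlonglongrightarrow> 0"
      using lim.hyps(1) lim.IH by (intro exI[of _ "s i"]) auto
  qed
qed

section \<open>The Fourier transform of the Gaussian\<close>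

lemma gaussian_fourier_real:
  "integrable lborel (\<lambda>x::real. exp (\<i> * complex_of_real (t * x)) * complex_of_real (exp (- x\<^sup>2 / 2)))"
  "(\<integral>x. exp (\<i> * complex_of_real (t * x)) * complex_of_real (exp (- x\<^sup>2 / 2)) \<partial>lborel)
     = complex_of_real (sqrt (2 * pi) * exp (- t\<^sup>2 / 2))"
proof -
  have i0: "integrable lborel (\<lambda>x::real. exp (- x\<^sup>2 / 2))"
  proof -
    have "integrable lborel (\<lambda>x. sqrt (2*pi) * std_normal_density x)"
      by (intro integrable_mult_right integrable_normal_density) auto
    also have "(\<lambda>x. sqrt (2*pi) * std_normal_density x) = (\<lambda>x. exp (- x\<^sup>2 / 2))"
      by (rule ext) (simp add: std_normal_density_def)
    finally show ?thesis .
  qed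
  show "integrable lborel (\<lambda>x::real. exp (\<i> * complex_of_real (t * x)) * complex_of_real (exp (- x\<^sup>2 / 2)))"
    by (rule Bochner_Integration.integrable_bound[OF i0]) (auto simp: norm_mult)
  have "complex_of_real (exp (- (t^2) / 2)) = (\<integral>x. std_normal_density x *\<^sub>R exp (\<i> * complex_of_real (t * x)) \<partial>lborel)"
    using fun_cong[OF char_std_normal_distribution, of t] unfolding char_def
    by (subst (asm) integral_density) (auto simp: normal_density_nonneg mult.assoc)
  also have "\<dots> = (\<integral>x. (1 / sqrt (2 * pi)) *\<^sub>R (exp (\<i> * complex_of_real (t * x)) * complex_of_real (exp (- x\<^sup>2 / 2))) \<partial>lborel)"
    by (intro Bochner_Integration.integral_cong) (auto simp: std_normal_density_def scaleR_conv_of_real)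
  also have "\<dots> = (1 / sqrt (2 * pi)) *\<^sub>R (\<integral>x. exp (\<i> * complex_of_real (t * x)) * complex_of_real (exp (- x\<^sup>2 / 2)) \<partial>lborel)"
    by simp
  finally show "(\<integral>x. exp (\<i> * complex_of_real (t * x)) * complex_of_real (exp (- x\<^sup>2 / 2)) \<partial>lborel)
     = complex_of_real (sqrt (2 * pi) * exp (- t\<^sup>2 / 2))"
    by (simp add: scaleR_conv_of_real field_simps)
qed

text \<open>Both the phase and the Gaussian factorise over the coordinates, so the integral is a
  product of one-dimensional ones, and these are values of the characteristic function of the
  standard normal distribution.\<close>

lemma gaussian_fourier:
  fixes z :: "'a::euclidean_space"
  shows "integrable lborel (\<lambda>x::'a. exp (- (norm x)\<^sup>2 / 2))"
  "(\<integral>x. exp (\<i> * complex_of_real (z \<bullet> x)) * complex_of_real (exp (- (norm x)\<^sup>2 / 2)) \<partial>lborel)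
     = complex_of_real (sqrt (2 * pi) ^ DIM('a) * exp (- (norm z)\<^sup>2 / 2))"
proof -
  interpret product_sigma_finite "\<lambda>b::'a. lborel :: real measure" ..
  define F where "F z b x = exp (\<i> * complex_of_real ((z \<bullet> b) * x)) * complex_of_real (exp (- x\<^sup>2 / 2))" for z b :: 'a and x
  have nrm: "(norm x)\<^sup>2 = (\<Sum>b\<in>Basis. (x \<bullet> b)\<^sup>2)" for x :: 'a
    by (simp add: norm_eq_sqrt_inner euclidean_inner[of x x] power2_eq_square sum_nonneg)
  have F: "(\<Prod>b\<in>Basis. F z b (x \<bullet> b)) = exp (\<i> * complex_of_real (z \<bullet> x)) * complex_of_real (exp (- (norm x)\<^sup>2 / 2))" for x z :: 'a
  proof -
    have "(\<Prod>b\<in>Basis. F z b (x \<bullet> b)) = exp (\<Sum>b\<in>Basis. \<i> * complex_of_real ((z \<bullet> b) * (x \<bullet> b))) * 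
        complex_of_real (exp (\<Sum>b\<in>Basis. - (x \<bullet> b)\<^sup>2 / 2))"
      by (simp add: F_def prod.distrib exp_sum of_real_prod)
    also have "(\<Sum>b\<in>Basis. \<i> * complex_of_real ((z \<bullet> b) * (x \<bullet> b))) = \<i> * complex_of_real (z \<bullet> x)"
      by (subst euclidean_inner[of z x]) (simp add: sum_distrib_left)
    also have "(\<Sum>b\<in>Basis. - (x \<bullet> b)\<^sup>2 / 2) = - (norm x)\<^sup>2 / 2"
      by (simp add: nrm sum_negf sum_divide_distrib)
    finally show ?thesis .
  qed
  have iF: "integrable lborel (F z b)" for z b
    unfolding F_def by (rule gaussian_fourier_real)
  have [measurable]: "F z b \<in> borel_measurable borel" for z b using iF[of z b] by auto
  \<comment> \<open>\<open>T\<close> assembles a vector from its coordinates; \<open>lborel\<close>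
    is the image under \<open>T\<close> of the product \<open>PM\<close> of one-dimensional
    measures.\<close>
  define T where "T f = (\<Sum>b\<in>Basis. f b *\<^sub>R b)" for f :: "'a \<Rightarrow> real"
  define PM where "PM = (\<Pi>\<^sub>M b\<in>(Basis::'a set). (lborel :: real measure))"
  define G where "G z x = (\<Prod>b\<in>Basis. F z b (x \<bullet> b))" for z x :: 'a
  have comp: "T f \<bullet> b = f b" if "b \<in> Basis" for f :: "'a \<Rightarrow> real" and b
    unfolding T_def using that by (simp add: inner_sum_left inner_Basis if_distrib cong: if_cong)
  have GT: "(\<lambda>f. G z (T f)) = (\<lambda>f. \<Prod>b\<in>Basis. F z b (f b))" for z
    unfolding G_def by (intro ext prod.cong refl) (simp add: comp)
  have [measurable]: "G z \<in> borel_measurable borel" for z unfolding G_def by measurable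
  have [measurable]: "T \<in> PM \<rightarrow>\<^sub>M borel"
    unfolding T_def PM_def by measurable
  have lb: "lborel = distr PM borel T" unfolding PM_def T_def by (rule lborel_eq)
  have i: "integrable lborel (G z)" for z
  proof -
    have "integrable PM (\<lambda>f. G z (T f))" unfolding GT PM_def
      by (rule product_integrable_prod) (auto intro: iF)
    then show ?thesis unfolding lb by (simp add: integrable_distr_eq)
  qed
  have "(\<integral>x. G z x \<partial>lborel) = (\<integral>f. G z (T f) \<partial>PM)"
    unfolding lb by (rule integral_distr) measurable
  also have "\<dots> = (\<Prod>b\<in>Basis. \<integral>x. F z b x \<partial>lborel)" unfolding GT PM_def
    by (rule product_integral_prod) (auto intro: iF)
  also have "\<dots> = (\<Prod>b\<in>Basis. complex_of_real (sqrt (2 * pi) * exp (- (z \<bullet> b)\<^sup>2 / 2)))"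
    unfolding F_def by (subst gaussian_fourier_real(2)) (rule refl)
  also have "\<dots> = complex_of_real (sqrt (2 * pi) ^ DIM('a) * (\<Prod>b\<in>Basis. exp (- (z \<bullet> b)\<^sup>2 / 2)))"
    by (simp only: of_real_prod[symmetric] prod.distrib prod_constant)
  also have "(\<Prod>b\<in>Basis. exp (- (z \<bullet> b)\<^sup>2 / 2)) = exp (\<Sum>b\<in>Basis. - (z \<bullet> b)\<^sup>2 / 2)"
    by (rule exp_sum[symmetric]) simp
  also have "(\<Sum>b\<in>Basis. - (z \<bullet> b)\<^sup>2 / 2) = - (norm z)\<^sup>2 / 2"
    unfolding nrm by (simp add: sum_negf sum_divide_distrib)
  finally show "(\<integral>x. exp (\<i> * complex_of_real (z \<bullet> x)) * complex_of_real (exp (- (norm x)\<^sup>2 / 2)) \<partial>lborel)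
     = complex_of_real (sqrt (2 * pi) ^ DIM('a) * exp (- (norm z)\<^sup>2 / 2))" unfolding G_def F .
  show "integrable lborel (\<lambda>x::'a. exp (- (norm x)\<^sup>2 / 2))"
    using integrable_norm[OF i[of 0]] unfolding G_def F by (simp add: norm_mult)
qed

section \<open>Plancherel's identity\<close>

lemma measurable_cnj[measurable]: "cnj \<in> borel_measurable borel"
  by (intro borel_measurable_continuous_onI continuous_intros)

lemma integrable_pair_mult:
  fixes f :: "'a::euclidean_space \<Rightarrow> complex" and g :: "'b::euclidean_space \<Rightarrow> complex"
  assumes f: "integrable lborel f" and g: "integrable lborel g"
  shows "integrable (lborel \<Otimes>\<^sub>M lborel) (\<lambda>(x, y). f x * g y)"
proof (rule lborel_pair.Fubini_integrable)
  have [measurable]: "f \<in> borel_measurable borel" "g \<in> borel_measurable borel" using f g by auto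
  show "(\<lambda>(x, y). f x * g y) \<in> borel_measurable (lborel \<Otimes>\<^sub>M lborel)" by measurable
qed (use f g in \<open>auto simp: norm_mult\<close>)

lemma integrable_pair_translate:
  fixes f g :: "'a::euclidean_space \<Rightarrow> complex"
  assumes f: "integrable lborel f" and g: "integrable lborel g"
  shows "integrable (lborel \<Otimes>\<^sub>M lborel) (\<lambda>(y, z). f (y + z) * g y)"
proof (rule lborel_pair.Fubini_integrable)
  have [measurable]: "f \<in> borel_measurable borel" "g \<in> borel_measurable borel" using f g by auto
  show "(\<lambda>(y, z). f (y + z) * g y) \<in> borel_measurable (lborel \<Otimes>\<^sub>M lborel)" by measurable
  have "(\<integral>z. norm (f (y + z)) \<partial>lborel) = (\<integral>z. norm (f z) \<partial>lborel)" for y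
    by (rule integral_translate)
  then show "integrable lborel (\<lambda>x. \<integral>y. norm (case (x, y) of (y, z) \<Rightarrow> f (y + z) * g y) \<partial>lborel)"
    using g by (simp add: norm_mult)
  show "AE x in lborel. integrable lborel (\<lambda>y. case (x, y) of (y, z) \<Rightarrow> f (y + z) * g y)"
    using f by (simp add: integrable_translate)
qed

text \<open>The absolutely convergent transform, with values defined at every frequency. The
  truncated transform of f is \<open>fourier_L1\<close> of f cut off to a ball, so results proved
  for it pass to \<open>is_L2_fourier\<close> in the limit.\<close>

definition fourier_L1 :: "real \<Rightarrow> (real^2 \<Rightarrow> complex) \<Rightarrow> real^2 \<Rightarrow> complex" where
  "fourier_L1 \<sigma> f \<xi> = (LINT x|lborel. exp (\<i> * complex_of_real (\<sigma> * (x \<bullet> \<xi>))) * f x) / complex_of_real (2 * pi)"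

lemma norm_cexp[simp]: "cmod (exp (\<i> * (complex_of_real s * complex_of_real t))) = 1"
  by (metis norm_exp_i_times of_real_mult)

lemma fourier_L1_measurable[measurable]:
  assumes [measurable]: "f \<in> borel_measurable borel"
  shows "fourier_L1 \<sigma> f \<in> borel_measurable borel"
  unfolding fourier_L1_def by measurable

lemma fourier_L1_integrand:
  assumes "integrable lborel f"
  shows "integrable lborel (\<lambda>x. exp (\<i> * complex_of_real (\<sigma> * (x \<bullet> \<xi>))) * f x)"
  by (rule Bochner_Integration.integrable_bound[OF assms]) (use assms in \<open>auto simp: norm_mult\<close>)

lemma fourier_L1_bound:
  assumes "integrable lborel f"
  shows "cmod (fourier_L1 \<sigma> f \<xi>) \<le> (LINT x|lborel. cmod (f x)) / (2 * pi)"
proof -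
  have "cmod (LINT x|lborel. exp (\<i> * complex_of_real (\<sigma> * (x \<bullet> \<xi>))) * f x) \<le> (LINT x|lborel. cmod (f x))"
    using integral_norm_bound[of lborel "\<lambda>x. exp (\<i> * complex_of_real (\<sigma> * (x \<bullet> \<xi>))) * f x"]
    by (simp add: norm_mult)
  then show ?thesis unfolding fourier_L1_def by (simp add: norm_divide divide_right_mono)
qed

text \<open>The squared modulus of a transform is the transform of the autocorrelation
  \<open>A\<close>. Since \<open>A 0\<close> is the integral of the squared modulus of f,
  Plancherel's identity becomes Fourier inversion for \<open>A\<close> at the single point
  0.\<close>

lemma fourier_L1_autocorrelation:
  assumes f: "integrable lborel f"
  defines "A \<equiv> \<lambda>z. (LINT y|lborel. f (y + z) * cnj (f y))"
  shows "integrable lborel A"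
    and "complex_of_real ((2 * pi)\<^sup>2 * (cmod (fourier_L1 \<sigma> f \<xi>))\<^sup>2)
      = (LINT z|lborel. exp (\<i> * complex_of_real (\<sigma> * (z \<bullet> \<xi>))) * A z)"
proof -
  have [measurable]: "f \<in> borel_measurable borel" using f by auto
  let ?E = "\<lambda>z. exp (\<i> * complex_of_real (\<sigma> * (z \<bullet> \<xi>)))"
  have fc: "integrable lborel (\<lambda>y. cnj (f y))" using f by simp
  have p0: "integrable (lborel \<Otimes>\<^sub>M lborel) (\<lambda>(y, z). f (y + z) * cnj (f y))"
    by (rule integrable_pair_translate[OF f fc])
  show "integrable lborel A" unfolding A_def
    by (rule lborel_pair.integrable_snd) (use p0 in simp)
  have p1: "integrable (lborel \<Otimes>\<^sub>M lborel) (\<lambda>(y, z). ?E z * (f (y + z) * cnj (f y)))"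
  proof (rule Bochner_Integration.integrable_bound[OF p0])
    show "(\<lambda>(y, z). ?E z * (f (y + z) * cnj (f y))) \<in> borel_measurable (lborel \<Otimes>\<^sub>M lborel)"
      by measurable
  qed (auto simp: norm_mult)
  define I where "I = (LINT x|lborel. ?E x * f x)"
  have "complex_of_real ((2 * pi)\<^sup>2 * (cmod (fourier_L1 \<sigma> f \<xi>))\<^sup>2) = complex_of_real ((cmod I)\<^sup>2)"
    unfolding fourier_L1_def I_def by (simp add: norm_divide power_divide power_mult_distrib)
  also have "\<dots> = I * cnj I" by (rule complex_norm_square)
  also have "\<dots> = (LINT y|lborel. I * cnj (?E y * f y))"
    unfolding I_def by (simp add: integral_cnj[symmetric] del: complex_cnj_mult)
  also have "\<dots> = (LINT y|lborel. LINT z|lborel. ?E z * (f (y + z) * cnj (f y)))"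
  proof (rule Bochner_Integration.integral_cong[OF refl])
    fix y
    have c: "exp (\<i> * complex_of_real (\<sigma> * ((y + z) \<bullet> \<xi>))) * cnj (?E y) = ?E z" for z
      by (simp add: exp_cnj exp_minus inner_add_left algebra_simps exp_add)
    have "I * cnj (?E y * f y) = (LINT z|lborel. (?E (y + z) * f (y + z)) * cnj (?E y * f y))"
      unfolding I_def by (subst integral_translate[of _ y, symmetric]) simp
    also have "\<dots> = (LINT z|lborel. ?E z * (f (y + z) * cnj (f y)))"
    proof (intro Bochner_Integration.integral_cong refl)
      fix z
      have "?E (y + z) * f (y + z) * cnj (?E y * f y) = (?E (y + z) * cnj (?E y)) * (f (y + z) * cnj (f y))"
        by (simp only: complex_cnj_mult mult_ac)
      then show "?E (y + z) * f (y + z) * cnj (?E y * f y) = ?E z * (f (y + z) * cnj (f y))"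
        by (simp only: c)
    qed
    finally show "I * cnj (?E y * f y) = (LINT z|lborel. ?E z * (f (y + z) * cnj (f y)))" .
  qed
  also have "\<dots> = (LINT z|lborel. LINT y|lborel. ?E z * (f (y + z) * cnj (f y)))"
    by (rule lborel_pair.Fubini_integral[symmetric]) (use p1 in simp)
  also have "\<dots> = (LINT z|lborel. ?E z * A z)" unfolding A_def by simp
  finally show "complex_of_real ((2 * pi)\<^sup>2 * (cmod (fourier_L1 \<sigma> f \<xi>))\<^sup>2) = (LINT z|lborel. ?E z * A z)" .
qed

lemma gaussian_fourier_scaled:
  fixes z :: "real^2"
  assumes m: "m > 0" and \<sigma>: "\<sigma>\<^sup>2 = 1"
  shows "(LINT \<xi>|lborel. complex_of_real (exp (- (norm ((1/m) *\<^sub>R \<xi>))\<^sup>2 / 2)) * exp (\<i> * complex_of_real (\<sigma> * (z \<bullet> \<xi>))))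
     = complex_of_real (m\<^sup>2 * (2 * pi) * exp (- (norm (m *\<^sub>R z))\<^sup>2 / 2))"
proof -
  have s: "(norm ((\<sigma> * m) *\<^sub>R z))\<^sup>2 = (norm (m *\<^sub>R z))\<^sup>2"
    using \<sigma> by (simp add: power_mult_distrib)
  have "(LINT \<xi>|lborel. complex_of_real (exp (- (norm ((1/m) *\<^sub>R \<xi>))\<^sup>2 / 2)) * exp (\<i> * complex_of_real (\<sigma> * (z \<bullet> \<xi>))))
    = (m\<^sup>2) *\<^sub>R (LINT x|lborel. complex_of_real (exp (- (norm ((1/m) *\<^sub>R (0 + m *\<^sub>R x)))\<^sup>2 / 2)) * exp (\<i> * complex_of_real (\<sigma> * (z \<bullet> (0 + m *\<^sub>R x)))))"
    using m by (subst integral_affine[of m _ 0]) auto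
  also have "\<dots> = (m\<^sup>2) *\<^sub>R (LINT x|lborel. exp (\<i> * complex_of_real (((\<sigma> * m) *\<^sub>R z) \<bullet> x)) * complex_of_real (exp (- (norm x)\<^sup>2 / 2)))"
    using m by (simp add: mult_ac)
  also have "\<dots> = (m\<^sup>2) *\<^sub>R complex_of_real (sqrt (2 * pi) ^ DIM(real^2) * exp (- (norm ((\<sigma> * m) *\<^sub>R z))\<^sup>2 / 2))"
    by (subst gaussian_fourier(2)) (rule refl)
  finally show ?thesis unfolding s by (simp add: scaleR_conv_of_real mult_ac)
qed

text \<open>A Gaussian weight in frequency makes the double integral absolutely convergent, so
  Fubini applies. The transformed weight is a Gaussian of width 1/m, and the right-hand side
  averages \<open>A\<close> over that scale around 0. The condition on \<sigma> covers the transform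
  and its inverse together.\<close>

lemma fourier_L1_gaussian_mean:
  assumes f: "integrable lborel f" and m: "m > 0" and \<sigma>: "\<sigma>\<^sup>2 = 1"
  defines "A \<equiv> \<lambda>z. (LINT y|lborel. f (y + z) * cnj (f y))"
  shows "integrable lborel (\<lambda>\<xi>. exp (- (norm ((1/m) *\<^sub>R \<xi>))\<^sup>2 / 2) * (cmod (fourier_L1 \<sigma> f \<xi>))\<^sup>2)" (is ?i)
    and "complex_of_real ((2 * pi) * (LINT \<xi>|lborel. exp (- (norm ((1/m) *\<^sub>R \<xi>))\<^sup>2 / 2) * (cmod (fourier_L1 \<sigma> f \<xi>))\<^sup>2))
      = (LINT y|lborel. A ((1/m) *\<^sub>R y) * complex_of_real (exp (- (norm y)\<^sup>2 / 2)))"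
proof -
  have [measurable]: "f \<in> borel_measurable borel" using f by auto
  have iA: "integrable lborel A" unfolding A_def by (rule fourier_L1_autocorrelation[OF f])
  then have [measurable]: "A \<in> borel_measurable borel" by auto
  let ?w = "\<lambda>\<xi>::real^2. exp (- (norm ((1/m) *\<^sub>R \<xi>))\<^sup>2 / 2)"
  let ?E = "\<lambda>z \<xi>. exp (\<i> * complex_of_real (\<sigma> * (z \<bullet> \<xi>)))"
  have iw: "integrable lborel ?w"
    using integrable_affine[OF gaussian_fourier(1), of "1/m" 0] m by simp
  then have iwc: "integrable lborel (\<lambda>\<xi>. complex_of_real (?w \<xi>))" by (rule integrable_of_real)
  have C0: "0 \<le> (LINT x|lborel. cmod (f x)) / (2 * pi)" by simp
  show ?i
  proof (rule Bochner_Integration.integrable_bound)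
    show "integrable lborel (\<lambda>\<xi>. ?w \<xi> * ((LINT x|lborel. cmod (f x)) / (2 * pi))\<^sup>2)"
      using iw by (rule integrable_mult_left)
    show "AE x in lborel. norm (?w x * (cmod (fourier_L1 \<sigma> f x))\<^sup>2) \<le> norm (?w x * ((LINT x|lborel. cmod (f x)) / (2 * pi))\<^sup>2)"
      using power_mono[OF fourier_L1_bound[OF f], where n=2]
      by (intro AE_I2) (auto simp: abs_mult intro!: mult_left_mono)
  qed measurable
  have p: "integrable (lborel \<Otimes>\<^sub>M lborel) (\<lambda>(\<xi>, z). complex_of_real (?w \<xi>) * A z)"
    by (rule integrable_pair_mult[OF iwc iA])
  have p1: "integrable (lborel \<Otimes>\<^sub>M lborel) (\<lambda>(\<xi>, z). complex_of_real (?w \<xi>) * (?E z \<xi> * A z))"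
    by (rule Bochner_Integration.integrable_bound[OF p]) (auto simp: norm_mult)
  have "complex_of_real ((2 * pi)\<^sup>2 * (LINT \<xi>|lborel. ?w \<xi> * (cmod (fourier_L1 \<sigma> f \<xi>))\<^sup>2))
     = (LINT \<xi>|lborel. complex_of_real (?w \<xi>) * complex_of_real ((2 * pi)\<^sup>2 * (cmod (fourier_L1 \<sigma> f \<xi>))\<^sup>2))"
    by (subst integral_mult_right_zero[symmetric], subst integral_complex_of_real[symmetric])
       (simp add: mult_ac)
  also have "\<dots> = (LINT \<xi>|lborel. LINT z|lborel. complex_of_real (?w \<xi>) * (?E z \<xi> * A z))"
    unfolding fourier_L1_autocorrelation(2)[OF f] A_def by simp
  also have "\<dots> = (LINT z|lborel. LINT \<xi>|lborel. complex_of_real (?w \<xi>) * (?E z \<xi> * A z))"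
    by (rule lborel_pair.Fubini_integral[symmetric]) (use p1 in simp)
  also have "\<dots> = (LINT z|lborel. (LINT \<xi>|lborel. complex_of_real (?w \<xi>) * ?E z \<xi>) * A z)"
    by (simp add: mult.assoc flip: integral_mult_left_zero)
  also have "\<dots> = (LINT z|lborel. complex_of_real (m\<^sup>2 * (2 * pi) * exp (- (norm (m *\<^sub>R z))\<^sup>2 / 2)) * A z)"
    by (subst gaussian_fourier_scaled[OF m \<sigma>]) (rule refl)
  also have "\<dots> = ((1/m)\<^sup>2) *\<^sub>R (LINT y|lborel. complex_of_real (m\<^sup>2 * (2 * pi) * exp (- (norm (m *\<^sub>R (0 + (1/m) *\<^sub>R y)))\<^sup>2 / 2)) * A (0 + (1/m) *\<^sub>R y))"
    using m by (subst integral_affine[of "1/m" _ 0]) auto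
  also have "\<dots> = complex_of_real (2 * pi) * (LINT y|lborel. A ((1/m) *\<^sub>R y) * complex_of_real (exp (- (norm y)\<^sup>2 / 2)))"
  proof -
    have "(LINT y|lborel. complex_of_real (m\<^sup>2 * (2 * pi) * exp (- (norm (m *\<^sub>R (0 + (1/m) *\<^sub>R y)))\<^sup>2 / 2)) * A (0 + (1/m) *\<^sub>R y))
       = (LINT y|lborel. complex_of_real (m\<^sup>2 * (2 * pi)) * (A ((1/m) *\<^sub>R y) * complex_of_real (exp (- (norm y)\<^sup>2 / 2))))"
      using m by (intro Bochner_Integration.integral_cong refl) simp
    then show ?thesis
      using m by (simp add: scaleR_conv_of_real power_divide)
  qed
  finally have "complex_of_real (2 * pi) * complex_of_real ((2 * pi) * (LINT \<xi>|lborel. ?w \<xi> * (cmod (fourier_L1 \<sigma> f \<xi>))\<^sup>2)) =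
     complex_of_real (2 * pi) * (LINT y|lborel. A ((1/m) *\<^sub>R y) * complex_of_real (exp (- (norm y)\<^sup>2 / 2)))"
    by (simp add: power2_eq_square mult_ac)
  then show "complex_of_real ((2 * pi) * (LINT \<xi>|lborel. ?w \<xi> * (cmod (fourier_L1 \<sigma> f \<xi>))\<^sup>2))
      = (LINT y|lborel. A ((1/m) *\<^sub>R y) * complex_of_real (exp (- (norm y)\<^sup>2 / 2)))"
    by (subst (asm) mult_left_cancel) simp_all
qed

text \<open>Let m tend to infinity in the Gaussian means. Boundedness of f makes \<open>A\<close>
  bounded and, by continuity of translations in L^1, continuous at 0, so the averages tend to a
  multiple of \<open>A 0\<close>. The weights increase to 1, so monotone convergence gives
  integrability and value on the frequency side.\<close>

lemma plancherel_bounded: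
  assumes f: "integrable lborel f" and B: "\<And>x. cmod (f x) \<le> B" and \<sigma>: "\<sigma>\<^sup>2 = 1"
  shows "integrable lborel (\<lambda>\<xi>. (cmod (fourier_L1 \<sigma> f \<xi>))\<^sup>2)"
    and "(LINT \<xi>|lborel. (cmod (fourier_L1 \<sigma> f \<xi>))\<^sup>2) = (LINT x|lborel. (cmod (f x))\<^sup>2)"
proof -
  have [measurable]: "f \<in> borel_measurable borel" using f by auto
  define A where "A = (\<lambda>z. (LINT y|lborel. f (y + z) * cnj (f y)))"
  have iA: "integrable lborel A" unfolding A_def by (rule fourier_L1_autocorrelation[OF f])
  then have [measurable]: "A \<in> borel_measurable borel" by auto
  define F where "F n \<xi> = exp (- (norm ((1/real (Suc n)) *\<^sub>R \<xi>))\<^sup>2 / 2) * (cmod (fourier_L1 \<sigma> f \<xi>))\<^sup>2" for n \<xi>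
  have iF: "integrable lborel (F n)" for n
    unfolding F_def by (rule fourier_L1_gaussian_mean[OF f _ \<sigma>]) simp
  have IF: "complex_of_real (2 * pi * integral\<^sup>L lborel (F n)) =
      (LINT y|lborel. A ((1/real (Suc n)) *\<^sub>R y) * complex_of_real (exp (- (norm y)\<^sup>2 / 2)))" for n
    unfolding F_def A_def by (rule fourier_L1_gaussian_mean[OF f _ \<sigma>]) simp
  have B0: "0 \<le> B" using B[of 0] norm_ge_zero order_trans by blast
  have Ai: "integrable lborel (\<lambda>y. f (y + z) * cnj (f y))" for z
  proof (rule Bochner_Integration.integrable_bound)
    show "integrable lborel (\<lambda>y. B * cmod (f y))" using f by simp
    show "AE x in lborel. norm (f (x + z) * cnj (f x)) \<le> norm (B * cmod (f x))"
      using B B0 by (auto simp: norm_mult intro!: mult_right_mono)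
  qed measurable
  have Ab: "cmod (A z) \<le> B * (LINT y|lborel. cmod (f y))" for z
  proof -
    have "cmod (A z) \<le> (LINT y|lborel. cmod (f (y + z) * cnj (f y)))"
      unfolding A_def by (rule integral_norm_bound)
    also have "\<dots> \<le> (LINT y|lborel. B * cmod (f y))"
      using integrable_norm[OF Ai[of z]] f B B0 by (intro integral_mono) (auto simp: norm_mult intro!: mult_right_mono)
    finally show ?thesis by simp
  qed
  have Ac: "(\<lambda>n. A (h n)) \<longlonglongrightarrow> A 0" if h: "h \<longlonglongrightarrow> 0" for h
  proof (rule Lim_null_comparison[THEN Lim_null[THEN iffD2]])
    show "\<forall>\<^sub>F n in sequentially. norm (A (h n) - A 0) \<le> B * (LINT y|lborel. cmod (f (h n + y) - f y))"
    proof (rule always_eventually, rule allI)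
      fix n
      have i: "integrable lborel (\<lambda>y. cmod (f (h n + y) - f y))"
        using f integrable_translate[OF f] by auto
      have "A (h n) - A 0 = (LINT y|lborel. f (y + h n) * cnj (f y) - f y * cnj (f y))"
        unfolding A_def using Ai[of "h n"] Ai[of 0] by simp
      also have "cmod \<dots> \<le> (LINT y|lborel. cmod (f (y + h n) * cnj (f y) - f y * cnj (f y)))"
        by (rule integral_norm_bound)
      also have "\<dots> \<le> (LINT y|lborel. B * cmod (f (h n + y) - f y))"
      proof (rule integral_mono)
        show "integrable lborel (\<lambda>y. cmod (f (y + h n) * cnj (f y) - f y * cnj (f y)))"
          using Ai[of "h n"] Ai[of 0] by auto
        fix y
        have "f (y + h n) * cnj (f y) - f y * cnj (f y) = cnj (f y) * (f (h n + y) - f y)"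
          by (simp add: algebra_simps)
        then show "cmod (f (y + h n) * cnj (f y) - f y * cnj (f y)) \<le> B * cmod (f (h n + y) - f y)"
          using B[of y] by (simp add: norm_mult mult_right_mono)
      qed (use i in simp)
      finally show "norm (A (h n) - A 0) \<le> B * (LINT y|lborel. cmod (f (h n + y) - f y))" by simp
    qed
    show "(\<lambda>n. B * (LINT y|lborel. cmod (f (h n + y) - f y))) \<longlonglongrightarrow> 0"
      using tendsto_mult_right_zero[OF translation_continuous_L1[OF f h]] .
  qed
  have "(\<lambda>n. LINT y|lborel. A ((1/real (Suc n)) *\<^sub>R y) * complex_of_real (exp (- (norm y)\<^sup>2 / 2)))
     \<longlonglongrightarrow> (LINT y::real^2|lborel. A 0 * complex_of_real (exp (- (norm y)\<^sup>2 / 2)))"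
  proof (rule integral_dominated_convergence)
    show "AE x in lborel. (\<lambda>n. A ((1/real (Suc n)) *\<^sub>R x) * complex_of_real (exp (- (norm x)\<^sup>2 / 2)))
       \<longlonglongrightarrow> A 0 * complex_of_real (exp (- (norm x)\<^sup>2 / 2))"
    proof (intro AE_I2 tendsto_mult tendsto_const Ac)
      fix x :: "real^2"
      have "(\<lambda>n. (1 / real (Suc n)) *\<^sub>R x) \<longlonglongrightarrow> 0 *\<^sub>R x"
        by (intro tendsto_scaleR tendsto_const LIMSEQ_Suc[OF lim_1_over_n])
      then show "(\<lambda>n. (1 / real (Suc n)) *\<^sub>R x) \<longlonglongrightarrow> 0" by simp
    qed
    show "integrable lborel (\<lambda>y::real^2. (B * (LINT y|lborel. cmod (f y))) * exp (- (norm y)\<^sup>2 / 2))"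
      using gaussian_fourier(1) by (rule integrable_mult_right)
    show "AE x in lborel. norm (A ((1/real (Suc n)) *\<^sub>R x) * complex_of_real (exp (- (norm x)\<^sup>2 / 2)))
       \<le> (B * (LINT y|lborel. cmod (f y))) * exp (- (norm x)\<^sup>2 / 2)" for n
      using Ab by (auto simp: norm_mult intro!: mult_right_mono)
  qed measurable
  also have "(LINT y::real^2|lborel. A 0 * complex_of_real (exp (- (norm y)\<^sup>2 / 2))) = A 0 * complex_of_real (2 * pi)"
    using gaussian_fourier(2)[of "0::real^2"] by simp
  also have "A 0 = complex_of_real (LINT x|lborel. (cmod (f x))\<^sup>2)"
    unfolding A_def by (simp add: complex_norm_square[symmetric] del: of_real_power flip: integral_complex_of_real)
  finally have "(\<lambda>n. complex_of_real (2 * pi * integral\<^sup>L lborel (F n))) \<longlonglongrightarrow> complex_of_real ((LINT x|lborel. (cmod (f x))\<^sup>2) * (2 * pi))"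
    unfolding IF by simp
  then have "(\<lambda>n. 2 * pi * integral\<^sup>L lborel (F n)) \<longlonglongrightarrow> (LINT x|lborel. (cmod (f x))\<^sup>2) * (2 * pi)"
    by (simp only: tendsto_of_real_iff)
  from tendsto_divide[OF this tendsto_const[of "2*pi"]]
  have lim: "(\<lambda>n. integral\<^sup>L lborel (F n)) \<longlonglongrightarrow> (LINT x|lborel. (cmod (f x))\<^sup>2)" by simp
  have mono: "AE x in lborel. mono (\<lambda>n. F n x)"
  proof (intro AE_I2 monoI)
    fix x :: "real^2" and m n :: nat assume "m \<le> n"
    then have "norm ((1/real (Suc n)) *\<^sub>R x) \<le> norm ((1/real (Suc m)) *\<^sub>R x)"
      by (auto intro!: mult_right_mono simp: field_simps)
    then have "(norm ((1/real (Suc n)) *\<^sub>R x))\<^sup>2 \<le> (norm ((1/real (Suc m)) *\<^sub>R x))\<^sup>2"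
      by (intro power_mono) auto
    then show "F m x \<le> F n x" unfolding F_def by (intro mult_right_mono) auto
  qed
  have pt: "AE x in lborel. (\<lambda>n. F n x) \<longlonglongrightarrow> (cmod (fourier_L1 \<sigma> f x))\<^sup>2"
  proof (rule AE_I2)
    fix x :: "real^2"
    have "(\<lambda>n. exp (- (norm ((1/real (Suc n)) *\<^sub>R x))\<^sup>2 / 2) * (cmod (fourier_L1 \<sigma> f x))\<^sup>2)
       \<longlonglongrightarrow> exp (- (norm (0 *\<^sub>R x))\<^sup>2 / 2) * (cmod (fourier_L1 \<sigma> f x))\<^sup>2"
      by (intro tendsto_intros LIMSEQ_Suc[OF lim_1_over_n]) auto
    then show "(\<lambda>n. F n x) \<longlonglongrightarrow> (cmod (fourier_L1 \<sigma> f x))\<^sup>2" unfolding F_def by simp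
  qed
  show "integrable lborel (\<lambda>\<xi>. (cmod (fourier_L1 \<sigma> f \<xi>))\<^sup>2)"
    by (rule integrable_monotone_convergence[OF iF mono pt lim]) measurable
  show "(LINT \<xi>|lborel. (cmod (fourier_L1 \<sigma> f \<xi>))\<^sup>2) = (LINT x|lborel. (cmod (f x))\<^sup>2)"
    by (rule integral_monotone_convergence[OF iF mono pt lim]) measurable
qed

section \<open>The Fourier transform of square integrable functions\<close>

text \<open>Valued in the extended nonnegative reals, so that estimates and limits can be written
  before square integrability is known.\<close>

definition sqnorm :: "(real^2 \<Rightarrow> complex) \<Rightarrow> ennreal" where
  "sqnorm f = (\<integral>\<^sup>+x. ennreal ((cmod (f x))\<^sup>2) \<partial>lborel)"

lemma L2_iff: "L2 f \<longleftrightarrow> f \<in> borel_measurable borel \<and> sqnorm f < \<infinity>"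
  unfolding L2_def sqnorm_def integrable_iff_bounded by auto

lemma L2_measurable: "L2 f \<Longrightarrow> f \<in> borel_measurable borel" by (simp add: L2_def)

lemma integral_eq_enn2real_sqnorm:
  assumes [measurable]: "f \<in> borel_measurable borel"
  shows "(LINT x|lborel. (cmod (f x))\<^sup>2) = enn2real (sqnorm f)"
  unfolding sqnorm_def by (rule integral_eq_nn_integral) auto

lemma sqnorm_mono: "(\<And>x. cmod (f x) \<le> cmod (g x)) \<Longrightarrow> sqnorm f \<le> sqnorm g"
  unfolding sqnorm_def by (intro nn_integral_mono ennreal_leI power_mono) auto

lemma sqnorm_cong: "(\<And>x. cmod (f x) = cmod (g x)) \<Longrightarrow> sqnorm f = sqnorm g"
  unfolding sqnorm_def by simp

lemma sqnorm_cong_AE: "AE x in lborel. f x = g x \<Longrightarrow> sqnorm f = sqnorm g"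
  unfolding sqnorm_def by (intro nn_integral_cong_AE) auto

lemma sqnorm_commute: "sqnorm (\<lambda>x. f x - g x) = sqnorm (\<lambda>x. g x - f x)"
  by (rule sqnorm_cong) (rule norm_minus_commute)

lemma sqnorm_cmult:
  assumes [measurable]: "f \<in> borel_measurable borel"
  shows "sqnorm (\<lambda>x. c * f x) = ennreal ((cmod c)\<^sup>2) * sqnorm f"
  unfolding sqnorm_def by (simp add: norm_mult power_mult_distrib ennreal_mult nn_integral_cmult)

lemma sqnorm_eq_0:
  assumes [measurable]: "f \<in> borel_measurable borel"
  shows "sqnorm f = 0 \<longleftrightarrow> (AE x in lborel. f x = 0)"
  unfolding sqnorm_def by (subst nn_integral_0_iff_AE) (auto simp: ennreal_eq_0_iff)

text \<open>Young's inequality applied to the cross term. The free parameter e lets the first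
  coefficient approach 1, which replaces the triangle inequality for the norm itself.\<close>

lemma sqnorm_add_le:
  assumes [measurable]: "f \<in> borel_measurable borel" "g \<in> borel_measurable borel" and e: "e > 0"
  shows "sqnorm (\<lambda>x. f x + g x) \<le> ennreal (1 + e) * sqnorm f + ennreal (1 + 1/e) * sqnorm g"
proof -
  have "(cmod (f x + g x))\<^sup>2 \<le> (1 + e) * (cmod (f x))\<^sup>2 + (1 + 1/e) * (cmod (g x))\<^sup>2" for x
  proof -
    have "(cmod (f x + g x))\<^sup>2 \<le> (cmod (f x) + cmod (g x))\<^sup>2"
      by (intro power_mono norm_triangle_ineq) simp
    also have "\<dots> = (1 + e) * (cmod (f x))\<^sup>2 + (1 + 1/e) * (cmod (g x))\<^sup>2 - (e * cmod (f x) - cmod (g x))\<^sup>2 / e"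
      using e by (simp add: field_simps power2_eq_square)
    also have "\<dots> \<le> (1 + e) * (cmod (f x))\<^sup>2 + (1 + 1/e) * (cmod (g x))\<^sup>2" using e by simp
    finally show ?thesis .
  qed
  then have "sqnorm (\<lambda>x. f x + g x) \<le> (\<integral>\<^sup>+x. ennreal (1 + e) * ennreal ((cmod (f x))\<^sup>2) + ennreal (1 + 1/e) * ennreal ((cmod (g x))\<^sup>2) \<partial>lborel)"
    unfolding sqnorm_def using e
    by (intro nn_integral_mono) (simp flip: ennreal_mult ennreal_plus add: ennreal_leI)
  also have "\<dots> = ennreal (1 + e) * sqnorm f + ennreal (1 + 1/e) * sqnorm g"
    unfolding sqnorm_def by (simp add: nn_integral_add nn_integral_cmult)
  finally show ?thesis .
qed

lemma sqnorm_add_le2: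
  assumes "f \<in> borel_measurable borel" "g \<in> borel_measurable borel"
  shows "sqnorm (\<lambda>x. f x + g x) \<le> 2 * sqnorm f + 2 * sqnorm g"
  using sqnorm_add_le[OF assms, of 1] by simp

lemma sqnorm_diff_le2:
  assumes [measurable]: "f \<in> borel_measurable borel" "g \<in> borel_measurable borel"
  shows "sqnorm (\<lambda>x. f x - g x) \<le> 2 * sqnorm f + 2 * sqnorm g"
proof -
  have "sqnorm (\<lambda>x. - g x) = sqnorm g" by (rule sqnorm_cong) simp
  then show ?thesis using sqnorm_add_le2[of f "\<lambda>x. - g x"] by simp
qed

lemma L2_lincomb:
  assumes "L2 f" "L2 g"
  shows "L2 (\<lambda>x. a * f x + b * g x)"
proof -
  have [measurable]: "f \<in> borel_measurable borel" "g \<in> borel_measurable borel"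
    using assms by (auto simp: L2_measurable)
  have "sqnorm (\<lambda>x. a * f x + b * g x) \<le> 2 * (ennreal ((cmod a)\<^sup>2) * sqnorm f) + 2 * (ennreal ((cmod b)\<^sup>2) * sqnorm g)"
    by (subst (1 2) sqnorm_cmult[symmetric]) (auto intro: sqnorm_add_le2)
  also have "\<dots> < \<infinity>" using assms by (auto simp: L2_iff ennreal_mult_less_top)
  finally show ?thesis by (simp add: L2_iff)
qed

lemma L2_diff: "L2 f \<Longrightarrow> L2 g \<Longrightarrow> L2 (\<lambda>x. f x - g x)"
  using L2_lincomb[of f g 1 "-1"] by simp

text \<open>Each of g and h r is the other one plus a small error; the weighted inequality bounds
  each squared norm by (1 + e) times the other in the limit, and e is arbitrary.\<close>

lemma sqnorm_limit:
  assumes F: "F \<noteq> bot" and [measurable]: "\<And>r. h r \<in> borel_measurable borel" "g \<in> borel_measurable borel"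
    and d: "((\<lambda>r. sqnorm (\<lambda>x. h r x - g x)) \<longlongrightarrow> 0) F"
    and L: "((\<lambda>r. sqnorm (h r)) \<longlongrightarrow> L) F"
  shows "sqnorm g = L"
proof -
  \<comment> \<open>Letting e tend to 0 is legitimate for infinite b as well, since the factor tends
    to 1 and not to 0.\<close>
  have le: "a \<le> b" if "\<And>e. e > 0 \<Longrightarrow> a \<le> ennreal (1 + e) * b" for a b :: ennreal
  proof (rule tendsto_lowerbound[where F="at_right 0" and f="\<lambda>e. ennreal (1 + e) * b"])
    have "((\<lambda>e. ennreal (1 + e) * b) \<longlongrightarrow> ennreal (1 + 0) * b) (at_right 0)"
      by (intro tendsto_mult_ennreal tendsto_ennrealI tendsto_intros) auto
    then show "((\<lambda>e. ennreal (1 + e) * b) \<longlongrightarrow> b) (at_right 0)" by simp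
    show "\<forall>\<^sub>F e in at_right 0. a \<le> ennreal (1 + e) * b"
      using that by (auto simp: eventually_at_filter)
  qed auto
  have lim0: "((\<lambda>r. ennreal c * sqnorm (\<lambda>x. h r x - g x)) \<longlongrightarrow> 0) F" for c
    using ennreal_tendsto_cmult[OF _ d, of "ennreal c"] by simp
  have "sqnorm g \<le> L"
  proof (rule le)
    fix e :: real assume e: "e > 0"
    have "((\<lambda>r. ennreal (1 + e) * sqnorm (h r) + ennreal (1 + 1/e) * sqnorm (\<lambda>x. h r x - g x)) \<longlongrightarrow> ennreal (1 + e) * L + 0) F"
      by (intro tendsto_add lim0 ennreal_tendsto_cmult[OF _ L]) auto
    moreover have "sqnorm g \<le> ennreal (1 + e) * sqnorm (h r) + ennreal (1 + 1/e) * sqnorm (\<lambda>x. h r x - g x)" for r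
      using sqnorm_add_le[of "h r" "\<lambda>x. g x - h r x", OF _ _ e] by (simp add: sqnorm_commute[of g])
    ultimately show "sqnorm g \<le> ennreal (1 + e) * L"
      using tendsto_lowerbound[OF _ always_eventually F] by (metis (no_types, lifting) add.right_neutral)
  qed
  moreover have "L \<le> sqnorm g"
  proof (rule le)
    fix e :: real assume e: "e > 0"
    have R: "((\<lambda>r. ennreal (1 + e) * sqnorm g + ennreal (1 + 1/e) * sqnorm (\<lambda>x. h r x - g x)) \<longlongrightarrow> ennreal (1 + e) * sqnorm g + 0) F"
      by (intro tendsto_add lim0 tendsto_const)
    have "sqnorm (h r) \<le> ennreal (1 + e) * sqnorm g + ennreal (1 + 1/e) * sqnorm (\<lambda>x. h r x - g x)" for r
      using sqnorm_add_le[of g "\<lambda>x. h r x - g x", OF _ _ e] by simp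
    from tendsto_le[OF F R L always_eventually] this
    show "L \<le> ennreal (1 + e) * sqnorm g" by simp
  qed
  ultimately show ?thesis by simp
qed

text \<open>Turns Cauchy estimates between members of a sequence into an estimate for its pointwise
  limit; the term \<open>a n\<close> absorbs an error that vanishes along the sequence.\<close>

lemma sqnorm_Fatou:
  assumes [measurable]: "\<And>n. h n \<in> borel_measurable borel" "g \<in> borel_measurable borel" "k \<in> borel_measurable borel"
    and lim: "AE x in lborel. (\<lambda>n. h n x) \<longlonglongrightarrow> g x"
    and le: "\<And>n. n \<ge> N \<Longrightarrow> sqnorm (\<lambda>x. h n x - k x) \<le> a n + c" and a: "a \<longlonglongrightarrow> 0"
  shows "sqnorm (\<lambda>x. g x - k x) \<le> c"
proof -
  have "sqnorm (\<lambda>x. g x - k x) = (\<integral>\<^sup>+x. liminf (\<lambda>n. ennreal ((cmod (h n x - k x))\<^sup>2)) \<partial>lborel)"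
    unfolding sqnorm_def
  proof (rule nn_integral_cong_AE)
    show "AE x in lborel. ennreal ((cmod (g x - k x))\<^sup>2) = liminf (\<lambda>n. ennreal ((cmod (h n x - k x))\<^sup>2))"
      using lim
    proof eventually_elim
      case (elim x)
      have "(\<lambda>n. ennreal ((cmod (h n x - k x))\<^sup>2)) \<longlonglongrightarrow> ennreal ((cmod (g x - k x))\<^sup>2)"
        by (intro tendsto_ennrealI tendsto_intros elim)
      then show ?case by (rule lim_imp_Liminf[OF sequentially_bot, symmetric])
    qed
  qed
  also have "\<dots> \<le> liminf (\<lambda>n. sqnorm (\<lambda>x. h n x - k x))"
    unfolding sqnorm_def by (rule nn_integral_liminf) measurable
  also have "\<dots> \<le> liminf (\<lambda>n. a n + c)"
    by (rule Liminf_mono) (use le in \<open>auto simp: eventually_sequentially\<close>)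
  also have "\<dots> = c"
  proof (rule lim_imp_Liminf)
    show "(\<lambda>n. a n + c) \<longlonglongrightarrow> c" using tendsto_add[OF a tendsto_const[of c]] by simp
  qed simp
  finally show ?thesis .
qed

lemma sqnorm_complete:
  assumes [measurable]: "\<And>n. h n \<in> borel_measurable borel"
    and le: "\<And>n. sqnorm (\<lambda>x. h (Suc n) x - h n x) \<le> ennreal (C * (1/4)^n)"
  obtains g where "g \<in> borel_measurable borel" "AE x in lborel. (\<lambda>n. h n x) \<longlonglongrightarrow> g x"
proof -
  define C' where "C' = max C 0"
  have le': "sqnorm (\<lambda>x. h (Suc n) x - h n x) \<le> ennreal (C' * (1/4)^n)" for n
    using order_trans[OF le[of n] ennreal_leI[of "C * (1/4)^n" "C' * (1/4)^n"]]
    by (simp add: C'_def mult_right_mono)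
  \<comment> \<open>The weight 2^n grows slower than the decay 4^(-n) of the squared norms, so the
    weighted series is finite almost everywhere. Boundedness of its terms then makes the increments
    decay like 2^(-n/2), which is summable.\<close>
  define d where "d n x = (2::real)^n * (cmod (h (Suc n) x - h n x))\<^sup>2" for n x
  have d0: "d n x \<ge> 0" for n x by (simp add: d_def)
  have [measurable]: "d n \<in> borel_measurable borel" for n unfolding d_def by measurable
  have "(\<integral>\<^sup>+x. (\<Sum>n. ennreal (d n x)) \<partial>lborel) = (\<Sum>n. \<integral>\<^sup>+x. ennreal (d n x) \<partial>lborel)"
    by (rule nn_integral_suminf) measurable
  also have "\<dots> \<le> (\<Sum>n. ennreal (C' * (1/2)^n))"
  proof (rule suminf_le)
    fix n
    have "(\<integral>\<^sup>+x. ennreal (d n x) \<partial>lborel) = ennreal (2^n) * sqnorm (\<lambda>x. h (Suc n) x - h n x)"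
      unfolding d_def sqnorm_def by (simp add: ennreal_mult nn_integral_cmult)
    also have "\<dots> \<le> ennreal (2^n) * ennreal (C' * (1/4)^n)"
      by (intro mult_left_mono le') simp
    also have "\<dots> = ennreal (C' * (2^n * (1/4)^n))"
      by (subst ennreal_mult[symmetric]) (auto simp: C'_def mult_ac)
    also have "(2::real)^n * (1/4)^n = (1/2)^n" by (simp add: power_mult_distrib[symmetric])
    finally show "(\<integral>\<^sup>+x. ennreal (d n x) \<partial>lborel) \<le> ennreal (C' * (1/2)^n)" .
  qed auto
  also have "\<dots> < \<infinity>"
  proof -
    have "summable (\<lambda>n. C' * (1/2::real)^n)" by (intro summable_mult summable_geometric) auto
    then show ?thesis by (subst suminf_ennreal2) (auto simp: C'_def)
  qed
  finally have "AE x in lborel. (\<Sum>n. ennreal (d n x)) \<noteq> \<infinity>"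
    by (intro nn_integral_PInf_AE) auto
  then have conv: "AE x in lborel. convergent (\<lambda>n. h n x)"
  proof eventually_elim
    case (elim x)
    have "summable (\<lambda>n. d n x)"
      by (rule summable_suminf_not_top) (use d0 elim in auto)
    then have "bounded (range (\<lambda>n. d n x))"
      using convergent_imp_bounded summable_LIMSEQ_zero by blast
    then obtain K where K: "\<And>n. \<bar>d n x\<bar> \<le> K" by (auto simp: bounded_iff)
    have K0: "K \<ge> 0" using K[of 0] by linarith
    have bd: "norm (h (Suc n) x - h n x) \<le> sqrt K * (sqrt (1/2))^n" for n
    proof (rule power2_le_imp_le)
      have "(2::real)^n * (cmod (h (Suc n) x - h n x))\<^sup>2 \<le> K"
        using K[of n] by (simp add: d_def)
      then have "(cmod (h (Suc n) x - h n x))\<^sup>2 \<le> K * (1/2)^n"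
        by (simp add: field_simps)
      also have "\<dots> = (sqrt K * (sqrt (1/2))^n)\<^sup>2"
        using K0 by (simp add: power_mult_distrib power_even_eq[symmetric] power_mult[symmetric] mult.commute[of _ 2] power_mult real_sqrt_pow2)
      finally show "(norm (h (Suc n) x - h n x))\<^sup>2 \<le> (sqrt K * (sqrt (1/2))^n)\<^sup>2" .
    qed (use K0 in simp)
    have "summable (\<lambda>n. h (Suc n) x - h n x)"
      by (rule summable_comparison_test'[OF summable_mult[OF summable_geometric[of "sqrt (1/2)"]]])
         (use bd in \<open>auto simp: real_sqrt_divide\<close>)
    then have "convergent (\<lambda>n. \<Sum>i<n. h (Suc i) x - h i x)" by (simp add: summable_iff_convergent)
    then have "convergent (\<lambda>n. h n x - h 0 x)" using sum_lessThan_telescope[of "\<lambda>i. h i x"] by simp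
    from convergent_add[OF this convergent_const[of "h 0 x"]] show ?case by simp
  qed
  show thesis
  proof
    show "(\<lambda>x. lim (\<lambda>n. h n x)) \<in> borel_measurable borel" by measurable
    show "AE x in lborel. (\<lambda>n. h n x) \<longlonglongrightarrow> lim (\<lambda>n. h n x)"
      using conv by eventually_elim (simp add: convergent_LIMSEQ_iff)
  qed
qed

section \<open>Truncation to balls and extension of the transform to L^2\<close>

lemma measurable_cball[measurable]: "cball (a::real^2) R \<in> sets borel"
  by simp

abbreviation cut :: "real \<Rightarrow> (real^2 \<Rightarrow> complex) \<Rightarrow> real^2 \<Rightarrow> complex" where
  "cut R f \<equiv> \<lambda>x. indicator (cball 0 R) x * f x"

lemma L2_mult_indicator:
  assumes "L2 f" and [measurable]: "A \<in> sets borel"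
  shows "L2 (\<lambda>x. indicator A x * f x)"
proof -
  have [measurable]: "f \<in> borel_measurable borel" using assms by (simp add: L2_measurable)
  have "sqnorm (\<lambda>x. indicator A x * f x) \<le> sqnorm f"
    by (rule sqnorm_mono) (simp add: indicator_def)
  then show ?thesis using assms(1) by (auto simp: L2_iff)
qed

lemma L2_cut: "L2 f \<Longrightarrow> L2 (cut R f)"
  by (rule L2_mult_indicator) auto

lemma integrable_indicator_cball: "integrable lborel (indicator (cball (a::real^2) R) :: real^2 \<Rightarrow> real)"
  using emeasure_lborel_cball_finite[of a R] by (simp add: integrable_indicator_iff less_top)

lemma integrable_cut:
  assumes f: "L2 f" shows "integrable lborel (cut R f)"
proof (rule Bochner_Integration.integrable_bound)
  have [measurable]: "f \<in> borel_measurable borel" using f by (simp add: L2_measurable)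
  show "cut R f \<in> borel_measurable lborel" by measurable
  show "integrable lborel (\<lambda>x. indicator (cball 0 R) x + (cmod (f x))\<^sup>2)"
    using f integrable_indicator_cball by (auto simp: L2_def)
  have "cmod (f x) \<le> 1 + (cmod (f x))\<^sup>2" for x
    using sum_power2_ge_zero[of "cmod (f x) - 1" "cmod (f x)"] by (simp add: power2_eq_square algebra_simps)
  then show "AE x in lborel. norm (cut R f x) \<le> norm (indicator (cball 0 R) x + (cmod (f x))\<^sup>2)"
    by (intro AE_I2) (auto simp: indicator_def)
qed

lemma truncated_fourier_eq: "truncated_fourier \<sigma> R f = fourier_L1 \<sigma> (cut R f)"
  unfolding truncated_fourier_def fourier_L1_def set_lebesgue_integral_def
  by (intro ext arg_cong2[of _ _ _ _ "(/)"] refl Bochner_Integration.integral_cong) (auto simp: indicator_def)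

lemma fourier_L1_lincomb:
  assumes "integrable lborel f" "integrable lborel g"
  shows "fourier_L1 \<sigma> (\<lambda>x. a * f x + b * g x) \<xi> = a * fourier_L1 \<sigma> f \<xi> + b * fourier_L1 \<sigma> g \<xi>"
proof -
  let ?E = "\<lambda>x. exp (\<i> * complex_of_real (\<sigma> * (x \<bullet> \<xi>)))"
  have "(LINT x|lborel. ?E x * (a * f x + b * g x)) = (LINT x|lborel. a * (?E x * f x) + b * (?E x * g x))"
    by (simp add: algebra_simps)
  also have "\<dots> = a * (LINT x|lborel. ?E x * f x) + b * (LINT x|lborel. ?E x * g x)"
    using fourier_L1_integrand[OF assms(1)] fourier_L1_integrand[OF assms(2)] by simp
  finally show ?thesis unfolding fourier_L1_def by (simp add: add_divide_distrib)
qed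

lemma fourier_L1_diff:
  assumes "integrable lborel f" "integrable lborel g"
  shows "fourier_L1 \<sigma> (\<lambda>x. f x - g x) \<xi> = fourier_L1 \<sigma> f \<xi> - fourier_L1 \<sigma> g \<xi>"
  using fourier_L1_lincomb[OF assms, of \<sigma> 1 "-1"] by simp

lemma sqnorm_tendsto_0:
  assumes f: "L2 f" and [measurable]: "\<And>n. A n \<in> sets borel"
    and A: "\<And>x. eventually (\<lambda>n. x \<in> A n) sequentially"
  shows "(\<lambda>n. sqnorm (\<lambda>x. indicator (A n) x * f x - f x)) \<longlonglongrightarrow> 0"
proof -
  have [measurable]: "f \<in> borel_measurable borel" using f by (simp add: L2_measurable)
  have "(\<lambda>n. \<integral>\<^sup>+x. ennreal ((cmod (indicator (A n) x * f x - f x))\<^sup>2) \<partial>lborel) \<longlonglongrightarrow> integral\<^sup>N lborel (\<lambda>x::real^2. 0)"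
  proof (rule nn_integral_dominated_convergence[where w="\<lambda>x. ennreal ((cmod (f x))\<^sup>2)"])
    show "AE x in lborel. (\<lambda>n. ennreal ((cmod (indicator (A n) x * f x - f x))\<^sup>2)) \<longlonglongrightarrow> 0"
    proof (rule AE_I2)
      fix x show "(\<lambda>n. ennreal ((cmod (indicator (A n) x * f x - f x))\<^sup>2)) \<longlonglongrightarrow> 0"
        by (rule tendsto_eventually) (rule eventually_mono[OF A[of x]], simp)
    qed
    show "(\<integral>\<^sup>+x. ennreal ((cmod (f x))\<^sup>2) \<partial>lborel) < \<infinity>" using f by (simp add: L2_iff sqnorm_def)
    show "AE x in lborel. ennreal ((cmod (indicator (A n) x * f x - f x))\<^sup>2) \<le> ennreal ((cmod (f x))\<^sup>2)" for n
      by (intro AE_I2 ennreal_leI) (auto simp: indicator_def)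
  qed measurable
  then show ?thesis by (simp add: sqnorm_def)
qed

text \<open>Cut f off by height to reach the bounded case. The transforms converge pointwise by
  dominated convergence in L^1; applied to differences of truncations, the bounded case and Fatou's
  lemma upgrade this to convergence in L^2.\<close>

lemma plancherel_L1_L2:
  assumes f: "integrable lborel f" "L2 f" and \<sigma>: "\<sigma>\<^sup>2 = 1"
  shows "sqnorm (fourier_L1 \<sigma> f) = sqnorm f"
proof -
  have [measurable]: "f \<in> borel_measurable borel" using f by auto
  define A where "A n = {x. cmod (f x) \<le> real n}" for n
  have [measurable]: "A n \<in> sets borel" for n unfolding A_def by measurable
  define k where "k n = (\<lambda>x. indicator (A n) x * f x)" for n
  have [measurable]: "k n \<in> borel_measurable borel" for n unfolding k_def by measurable
  have ik: "integrable lborel (k n)" for n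
    by (rule Bochner_Integration.integrable_bound[OF f(1)]) (auto simp: k_def indicator_def)
  have bk: "cmod (k n x) \<le> real n" for n x by (auto simp: k_def A_def indicator_def)
  have evA: "eventually (\<lambda>n. x \<in> A n) sequentially" for x
  proof -
    obtain n0 where "cmod (f x) \<le> real n0" using real_arch_simple by blast
    then show ?thesis by (auto simp: A_def eventually_sequentially intro!: exI[of _ n0])
  qed
  have P: "sqnorm (fourier_L1 \<sigma> g) = sqnorm g" if g: "integrable lborel g" "\<And>x. cmod (g x) \<le> B" for g B
  proof -
    have [measurable]: "g \<in> borel_measurable borel" using g by auto
    have B0: "0 \<le> B" using g(2)[of 0] norm_ge_zero order_trans by blast
    have "integrable lborel (\<lambda>x. (cmod (g x))\<^sup>2)"
    proof (rule Bochner_Integration.integrable_bound)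
      show "integrable lborel (\<lambda>x. B * cmod (g x))" using g by simp
      show "AE x in lborel. norm ((cmod (g x))\<^sup>2) \<le> norm (B * cmod (g x))"
        using g(2) B0 by (auto simp: power2_eq_square intro!: mult_right_mono)
    qed measurable
    then show ?thesis
      using plancherel_bounded[OF g \<sigma>] by (simp add: sqnorm_def nn_integral_eq_integral)
  qed
  have d: "(\<lambda>n. sqnorm (\<lambda>x. k n x - f x)) \<longlonglongrightarrow> 0"
    unfolding k_def by (rule sqnorm_tendsto_0[OF f(2) _ evA]) measurable
  have pt: "(\<lambda>n. fourier_L1 \<sigma> (k n) \<xi>) \<longlonglongrightarrow> fourier_L1 \<sigma> f \<xi>" for \<xi>
    unfolding fourier_L1_def
  proof (intro tendsto_divide tendsto_const integral_dominated_convergence[where w="\<lambda>x. cmod (f x)"])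
    show "AE x in lborel. (\<lambda>n. exp (\<i> * complex_of_real (\<sigma> * (x \<bullet> \<xi>))) * k n x)
       \<longlonglongrightarrow> exp (\<i> * complex_of_real (\<sigma> * (x \<bullet> \<xi>))) * f x"
    proof (intro AE_I2 tendsto_mult tendsto_const)
      fix x show "(\<lambda>n. k n x) \<longlonglongrightarrow> f x"
        by (rule tendsto_eventually) (rule eventually_mono[OF evA[of x]], simp add: k_def)
    qed
    show "AE x in lborel. norm (exp (\<i> * complex_of_real (\<sigma> * (x \<bullet> \<xi>))) * k n x) \<le> cmod (f x)" for n
      by (auto simp: norm_mult k_def indicator_def)
  qed (use f in auto)
  have D: "sqnorm (\<lambda>x. fourier_L1 \<sigma> f x - fourier_L1 \<sigma> (k n) x) \<le> sqnorm (\<lambda>x. k n x - f x)" for n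
  proof (rule sqnorm_Fatou[where h="\<lambda>m. fourier_L1 \<sigma> (k m)" and a="\<lambda>_. 0" and N=n])
    fix m assume "m \<ge> n"
    have "sqnorm (\<lambda>x. fourier_L1 \<sigma> (k m) x - fourier_L1 \<sigma> (k n) x) = sqnorm (fourier_L1 \<sigma> (\<lambda>x. k m x - k n x))"
      by (rule sqnorm_cong) (simp add: fourier_L1_diff[OF ik ik])
    also have "\<dots> = sqnorm (\<lambda>x. k m x - k n x)"
    proof (rule P)
      show "cmod (k m x - k n x) \<le> real m + real n" for x
        using norm_triangle_ineq4[of "k m x" "k n x"] bk[of m x] bk[of n x] by simp
    qed (use ik in simp)
    also have "\<dots> \<le> sqnorm (\<lambda>x. k n x - f x)"
      \<comment> \<open>The difference of two truncations is f restricted to n < |f| \<le> m, which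
        is part of what the n-th truncation omits.\<close>
      using \<open>m \<ge> n\<close> by (intro sqnorm_mono) (auto simp: k_def A_def indicator_def)
    finally show "sqnorm (\<lambda>x. fourier_L1 \<sigma> (k m) x - fourier_L1 \<sigma> (k n) x) \<le> 0 + sqnorm (\<lambda>x. k n x - f x)"
      by simp
  qed (use pt in auto)
  have dF: "(\<lambda>n. sqnorm (\<lambda>x. fourier_L1 \<sigma> (k n) x - fourier_L1 \<sigma> f x)) \<longlonglongrightarrow> 0"
    by (rule tendsto_sandwich[OF _ _ tendsto_const d]) (use D in \<open>auto simp: sqnorm_commute[of "fourier_L1 \<sigma> f"]\<close>)
  have e: "sqnorm (fourier_L1 \<sigma> (k n)) = sqnorm (k n)" for n
    by (rule P[OF ik bk])
  have "(\<lambda>n. sqnorm (k n)) \<longlonglongrightarrow> sqnorm f"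
    unfolding sqnorm_def
  proof (rule nn_integral_dominated_convergence[where w="\<lambda>x. ennreal ((cmod (f x))\<^sup>2)"])
    show "AE x in lborel. (\<lambda>n. ennreal ((cmod (k n x))\<^sup>2)) \<longlonglongrightarrow> ennreal ((cmod (f x))\<^sup>2)"
    proof (rule AE_I2)
      fix x show "(\<lambda>n. ennreal ((cmod (k n x))\<^sup>2)) \<longlonglongrightarrow> ennreal ((cmod (f x))\<^sup>2)"
        by (rule tendsto_eventually) (rule eventually_mono[OF evA[of x]], simp add: k_def)
    qed
    show "(\<integral>\<^sup>+x. ennreal ((cmod (f x))\<^sup>2) \<partial>lborel) < \<infinity>" using f by (simp add: L2_iff sqnorm_def)
    show "AE x in lborel. ennreal ((cmod (k n x))\<^sup>2) \<le> ennreal ((cmod (f x))\<^sup>2)" for n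
      by (intro AE_I2 ennreal_leI) (auto simp: k_def indicator_def)
  qed measurable
  then show ?thesis
    using sqnorm_limit[OF sequentially_bot _ _ dF, of "sqnorm f"] by (simp add: e)
qed

text \<open>The tail decreases as the ball grows, so a continuous radius can be compared with an
  integer one, for which dominated convergence along a sequence is available.\<close>

lemma sqnorm_cut_tendsto_0:
  assumes f: "L2 f"
  shows "((\<lambda>R. sqnorm (\<lambda>x. cut R f x - f x)) \<longlongrightarrow> 0) at_top"
proof (rule order_tendstoI)
  fix e :: ennreal assume e: "0 < e"
  have "(\<lambda>n. sqnorm (\<lambda>x. cut (real n) f x - f x)) \<longlonglongrightarrow> 0"
  proof (rule sqnorm_tendsto_0[OF f])
    fix x :: "real^2"
    obtain n0 where "norm x \<le> real n0" using real_arch_simple by blast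
    then show "\<forall>\<^sub>F n in sequentially. x \<in> cball 0 (real n)"
      by (auto simp: eventually_sequentially intro!: exI[of _ n0])
  qed auto
  then have "eventually (\<lambda>n. sqnorm (\<lambda>x. cut (real n) f x - f x) < e) sequentially"
    using e by (rule order_tendstoD)
  then obtain n where n: "sqnorm (\<lambda>x. cut (real n) f x - f x) < e" by (auto simp: eventually_sequentially)
  have "sqnorm (\<lambda>x. cut R f x - f x) < e" if "R \<ge> real n" for R
  proof -
    have "sqnorm (\<lambda>x. cut R f x - f x) \<le> sqnorm (\<lambda>x. cut (real n) f x - f x)"
      using that by (intro sqnorm_mono) (auto simp: indicator_def)
    then show ?thesis using n by simp
  qed
  then show "\<forall>\<^sub>F R in at_top. sqnorm (\<lambda>x. cut R f x - f x) < e"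
    unfolding eventually_at_top_linorder by blast
qed simp

lemma is_L2_fourier_iff:
  "is_L2_fourier \<sigma> f g \<longleftrightarrow> L2 f \<and> L2 g \<and>
     ((\<lambda>R. sqnorm (\<lambda>\<xi>. fourier_L1 \<sigma> (cut R f) \<xi> - g \<xi>)) \<longlongrightarrow> 0) at_top"
  unfolding is_L2_fourier_def sqnorm_def truncated_fourier_eq ..

lemma sqnorm_cut_lim:
  fixes f :: "real^2 \<Rightarrow> complex"
  assumes f: "L2 f"
  shows "((\<lambda>R. sqnorm (cut R f)) \<longlongrightarrow> sqnorm f) at_top"
proof (rule order_tendstoI)
  fix a assume "a < sqnorm f"
  have [measurable]: "f \<in> borel_measurable borel" using f by (simp add: L2_measurable)
  have "(\<lambda>n. sqnorm (cut (real n) f)) \<longlonglongrightarrow> sqnorm f"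
    unfolding sqnorm_def
  proof (rule nn_integral_dominated_convergence[where w="\<lambda>x. ennreal ((cmod (f x))\<^sup>2)"])
    show "AE x in lborel. (\<lambda>n. ennreal ((cmod (cut (real n) f x))\<^sup>2)) \<longlonglongrightarrow> ennreal ((cmod (f x))\<^sup>2)"
    proof (rule AE_I2)
      fix x :: "real^2"
      obtain n0 where "norm x \<le> real n0" using real_arch_simple by blast
      then show "(\<lambda>n. ennreal ((cmod (cut (real n) f x))\<^sup>2)) \<longlonglongrightarrow> ennreal ((cmod (f x))\<^sup>2)"
        by (intro tendsto_eventually) (auto simp: eventually_sequentially intro!: exI[of _ n0])
    qed
    show "(\<integral>\<^sup>+x. ennreal ((cmod (f x))\<^sup>2) \<partial>lborel) < \<infinity>" using f by (simp add: L2_iff sqnorm_def)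
    show "AE x in lborel. ennreal ((cmod (cut (real n) f x))\<^sup>2) \<le> ennreal ((cmod (f x))\<^sup>2)" for n
      by (intro AE_I2 ennreal_leI) (auto simp: indicator_def)
  qed measurable
  then have "eventually (\<lambda>n. a < sqnorm (cut (real n) f)) sequentially"
    using \<open>a < sqnorm f\<close> by (rule order_tendstoD)
  then obtain n where n: "a < sqnorm (cut (real n) f)" by (auto simp: eventually_sequentially)
  have "a < sqnorm (cut R f)" if "R \<ge> real n" for R
  proof -
    have "sqnorm (cut (real n) f) \<le> sqnorm (cut R f)"
      using that by (intro sqnorm_mono) (auto simp: indicator_def)
    then show ?thesis using n by simp
  qed
  then show "\<forall>\<^sub>F R in at_top. a < sqnorm (cut R f)"
    unfolding eventually_at_top_linorder by blast
next
  fix a assume "sqnorm f < a"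
  moreover have "sqnorm (cut R f) \<le> sqnorm f" for R by (intro sqnorm_mono) (auto simp: indicator_def)
  ultimately show "\<forall>\<^sub>F R in at_top. sqnorm (cut R f) < a"
    by (intro always_eventually allI) (use order_le_less_trans in blast)
qed

lemma fourier_L1_cut_L2:
  assumes "L2 f" "\<sigma>\<^sup>2 = 1"
  shows "sqnorm (fourier_L1 \<sigma> (cut R f)) = sqnorm (cut R f)"
  using assms integrable_cut L2_cut plancherel_L1_L2 by blast

lemma plancherel:
  assumes "is_L2_fourier \<sigma> f g" and \<sigma>: "\<sigma>\<^sup>2 = 1"
  shows "sqnorm g = sqnorm f"
proof -
  have f: "L2 f" and g: "L2 g" and l: "((\<lambda>R. sqnorm (\<lambda>\<xi>. fourier_L1 \<sigma> (cut R f) \<xi> - g \<xi>)) \<longlongrightarrow> 0) at_top"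
    using assms unfolding is_L2_fourier_iff by auto
  have [measurable]: "f \<in> borel_measurable borel" "g \<in> borel_measurable borel"
    using f g by (simp_all add: L2_measurable)
  show ?thesis
    by (rule sqnorm_limit[OF _ _ _ l])
       (simp_all add: fourier_L1_cut_L2[OF f \<sigma>] sqnorm_cut_lim[OF f])
qed

text \<open>By Plancherel on the cut-off functions, the truncated transforms form a Cauchy family
  controlled by the tails of f. Radii with tails below 4^(-n) give a sequence with a pointwise
  limit, and Fatou extends the estimate to all radii.\<close>

lemma is_L2_fourier_exists:
  assumes f: "L2 f" and \<sigma>: "\<sigma>\<^sup>2 = 1"
  shows "\<exists>g. is_L2_fourier \<sigma> f g"
proof -
  have [measurable]: "f \<in> borel_measurable borel" using f by (simp add: L2_measurable)
  define tail where "tail R = sqnorm (\<lambda>x. cut R f x - f x)" for R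
  have "\<exists>R. tail R < ennreal ((1/4)^n)" for n :: nat
  proof -
    have "\<forall>\<^sub>F R in at_top. tail R < ennreal ((1/4)^n)"
      using sqnorm_cut_tendsto_0[OF f] unfolding tail_def by (rule order_tendstoD) simp
    then show ?thesis using eventually_happens'[OF trivial_limit_at_top_linorder] by blast
  qed
  then obtain r where r: "\<And>n. tail (r n) < ennreal ((1/4)^n)" by metis
  have dd: "sqnorm (\<lambda>\<xi>. fourier_L1 \<sigma> (cut R f) \<xi> - fourier_L1 \<sigma> (cut R' f) \<xi>) \<le> tail R + tail R'" for R R'
  proof -
    have "sqnorm (\<lambda>\<xi>. fourier_L1 \<sigma> (cut R f) \<xi> - fourier_L1 \<sigma> (cut R' f) \<xi>) = sqnorm (fourier_L1 \<sigma> (\<lambda>x. cut R f x - cut R' f x))"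
      by (rule sqnorm_cong) (simp add: fourier_L1_diff integrable_cut[OF f])
    also have "\<dots> = sqnorm (\<lambda>x. cut R f x - cut R' f x)"
      using integrable_cut[OF f] L2_cut[OF f] by (intro plancherel_L1_L2 \<sigma> L2_diff) auto
    \<comment> \<open>No factor 2 is lost: the cut-offs differ only between the two balls, where
      exactly one of the tails is active.\<close>
    also have "\<dots> \<le> (\<integral>\<^sup>+x. ennreal ((cmod (cut R f x - f x))\<^sup>2) + ennreal ((cmod (cut R' f x - f x))\<^sup>2) \<partial>lborel)"
      unfolding sqnorm_def by (intro nn_integral_mono) (auto simp: indicator_def)
    also have "\<dots> = tail R + tail R'"
      unfolding tail_def sqnorm_def by (intro nn_integral_add) measurable
    finally show ?thesis .
  qed
  obtain g where [measurable]: "g \<in> borel_measurable borel" and g: "AE x in lborel. (\<lambda>n. fourier_L1 \<sigma> (cut (r n) f) x) \<longlonglongrightarrow> g x"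
  proof (rule sqnorm_complete[where h="\<lambda>n. fourier_L1 \<sigma> (cut (r n) f)" and C=2])
    fix n
    have "sqnorm (\<lambda>x. fourier_L1 \<sigma> (cut (r (Suc n)) f) x - fourier_L1 \<sigma> (cut (r n) f) x) \<le> tail (r (Suc n)) + tail (r n)"
      by (rule dd)
    also have "\<dots> \<le> ennreal ((1/4)^Suc n) + ennreal ((1/4)^n)"
      using r[of "Suc n"] r[of n] by (intro add_mono) auto
    also have "\<dots> \<le> ennreal (2 * (1/4)^n)"
      by (subst ennreal_plus[symmetric]) (auto intro!: ennreal_leI)
    finally show "sqnorm (\<lambda>x. fourier_L1 \<sigma> (cut (r (Suc n)) f) x - fourier_L1 \<sigma> (cut (r n) f) x) \<le> ennreal (2 * (1/4)^n)" .
  qed measurable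
  have a0: "(\<lambda>n. ennreal ((1/4::real)^n)) \<longlonglongrightarrow> 0"
  proof -
    have "(\<lambda>n. (1/4::real)^n) \<longlonglongrightarrow> 0" by (rule LIMSEQ_realpow_zero) auto
    from tendsto_ennrealI[OF this] show ?thesis by simp
  qed
  have b: "sqnorm (\<lambda>x. g x - fourier_L1 \<sigma> (cut R f) x) \<le> tail R" for R
  proof (rule sqnorm_Fatou[OF _ _ _ g _ a0])
    fix n :: nat
    show "sqnorm (\<lambda>x. fourier_L1 \<sigma> (cut (r n) f) x - fourier_L1 \<sigma> (cut R f) x) \<le> ennreal ((1/4)^n) + tail R"
      by (rule order_trans[OF dd]) (use r[of n] in \<open>intro add_right_mono, simp\<close>)
  qed measurable
  have "((\<lambda>R. sqnorm (\<lambda>\<xi>. fourier_L1 \<sigma> (cut R f) \<xi> - g \<xi>)) \<longlongrightarrow> 0) at_top"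
  proof (rule tendsto_sandwich[OF _ _ tendsto_const])
    show "(tail \<longlongrightarrow> 0) at_top" unfolding tail_def by (rule sqnorm_cut_tendsto_0[OF f])
    show "\<forall>\<^sub>F R in at_top. sqnorm (\<lambda>\<xi>. fourier_L1 \<sigma> (cut R f) \<xi> - g \<xi>) \<le> tail R"
      using b by (simp add: sqnorm_commute[of g])
  qed auto
  moreover from this have "sqnorm g = sqnorm f"
    by (intro sqnorm_limit[where F=at_top and h="\<lambda>R. fourier_L1 \<sigma> (cut R f)"])
       (simp_all add: fourier_L1_cut_L2[OF f \<sigma>] sqnorm_cut_lim[OF f])
  then have "L2 g" using f by (simp add: L2_iff)
  ultimately show ?thesis using f unfolding is_L2_fourier_iff by blast
qed

lemma is_L2_fourierD: "is_L2_fourier \<sigma> f g \<Longrightarrow> L2 f" "is_L2_fourier \<sigma> f g \<Longrightarrow> L2 g"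
  by (auto simp: is_L2_fourier_iff)

lemma is_L2_fourier_lincomb:
  assumes 1: "is_L2_fourier \<sigma> f g" and 2: "is_L2_fourier \<sigma> f' g'"
  shows "is_L2_fourier \<sigma> (\<lambda>x. a * f x + b * f' x) (\<lambda>x. a * g x + b * g' x)"
proof -
  note L = is_L2_fourierD[OF 1] is_L2_fourierD[OF 2]
  have [measurable]: "f \<in> borel_measurable borel" "g \<in> borel_measurable borel"
    "f' \<in> borel_measurable borel" "g' \<in> borel_measurable borel"
    using L by (simp_all add: L2_measurable)
  define F where "F R = (\<lambda>\<xi>. fourier_L1 \<sigma> (cut R f) \<xi> - g \<xi>)" for R
  define F' where "F' R = (\<lambda>\<xi>. fourier_L1 \<sigma> (cut R f') \<xi> - g' \<xi>)" for R
  have [measurable]: "F R \<in> borel_measurable borel" "F' R \<in> borel_measurable borel" for R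
    unfolding F_def F'_def by measurable
  have eq: "fourier_L1 \<sigma> (cut R (\<lambda>x. a * f x + b * f' x)) \<xi> - (a * g \<xi> + b * g' \<xi>) = a * F R \<xi> + b * F' R \<xi>" for R \<xi>
  proof -
    have "cut R (\<lambda>x. a * f x + b * f' x) = (\<lambda>x. a * cut R f x + b * cut R f' x)"
      by (auto simp: algebra_simps)
    then show ?thesis
      using fourier_L1_lincomb[OF integrable_cut[OF L(1), of R] integrable_cut[OF L(3), of R], where \<sigma>=\<sigma> and a=a and b=b and \<xi>=\<xi>]
      by (simp add: F_def F'_def algebra_simps)
  qed
  have "((\<lambda>R. sqnorm (\<lambda>\<xi>. a * F R \<xi> + b * F' R \<xi>)) \<longlongrightarrow> 0) at_top"
  proof (rule tendsto_sandwich[OF _ _ tendsto_const])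
    have "((\<lambda>R. 2 * (ennreal ((cmod a)\<^sup>2) * sqnorm (F R)) + 2 * (ennreal ((cmod b)\<^sup>2) * sqnorm (F' R))) \<longlongrightarrow>
       2 * (ennreal ((cmod a)\<^sup>2) * 0) + 2 * (ennreal ((cmod b)\<^sup>2) * 0)) at_top"
      using 1 2 unfolding F_def F'_def is_L2_fourier_iff
      by (intro tendsto_add ennreal_tendsto_cmult) auto
    then show "((\<lambda>R. 2 * (ennreal ((cmod a)\<^sup>2) * sqnorm (F R)) + 2 * (ennreal ((cmod b)\<^sup>2) * sqnorm (F' R))) \<longlongrightarrow> 0) at_top"
      by simp
    show "\<forall>\<^sub>F R in at_top. sqnorm (\<lambda>\<xi>. a * F R \<xi> + b * F' R \<xi>) \<le> 2 * (ennreal ((cmod a)\<^sup>2) * sqnorm (F R)) + 2 * (ennreal ((cmod b)\<^sup>2) * sqnorm (F' R))"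
      by (intro always_eventually allI, subst (1 2) sqnorm_cmult[symmetric]) (auto intro: sqnorm_add_le2)
  qed auto
  then show ?thesis using L by (simp add: is_L2_fourier_iff L2_lincomb eq)
qed

lemma is_L2_fourier_diff:
  "is_L2_fourier \<sigma> f g \<Longrightarrow> is_L2_fourier \<sigma> f' g' \<Longrightarrow> is_L2_fourier \<sigma> (\<lambda>x. f x - f' x) (\<lambda>x. g x - g' x)"
  using is_L2_fourier_lincomb[of \<sigma> f g f' g' 1 "-1"] by simp

lemma is_L2_fourier_cmult:
  "is_L2_fourier \<sigma> f g \<Longrightarrow> is_L2_fourier \<sigma> (\<lambda>x. a * f x) (\<lambda>x. a * g x)"
  using is_L2_fourier_lincomb[of \<sigma> f g f g a 0] by simp

text \<open>Plancherel for the difference. This makes the arbitrary choice in \<open>fourier\<close>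
  and \<open>inv_fourier\<close> harmless: any computed transform agrees with the chosen one off a
  null set.\<close>

lemma is_L2_fourier_unique_AE:
  assumes 1: "is_L2_fourier \<sigma> f g" and 2: "is_L2_fourier \<sigma> f' g'" and \<sigma>: "\<sigma>\<^sup>2 = 1"
    and eq: "AE x in lborel. f x = f' x"
  shows "AE x in lborel. g x = g' x"
proof -
  have [measurable]: "f \<in> borel_measurable borel" "g \<in> borel_measurable borel"
    "f' \<in> borel_measurable borel" "g' \<in> borel_measurable borel"
    using is_L2_fourierD[OF 1] is_L2_fourierD[OF 2] by (simp_all add: L2_measurable)
  have "sqnorm (\<lambda>x. g x - g' x) = sqnorm (\<lambda>x. f x - f' x)"
    by (rule plancherel[OF is_L2_fourier_diff[OF 1 2] \<sigma>])
  also have "\<dots> = 0" using eq by (subst sqnorm_eq_0) auto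
  finally show ?thesis by (subst (asm) sqnorm_eq_0) auto
qed

lemma is_L2_fourier_cong_AE:
  assumes 1: "is_L2_fourier \<sigma> f g" and [measurable]: "g' \<in> borel_measurable borel"
    and eq: "AE x in lborel. g x = g' x"
  shows "is_L2_fourier \<sigma> f g'"
proof -
  have "sqnorm g' = sqnorm g" using eq by (intro sqnorm_cong_AE) (auto elim: eventually_mono)
  moreover have "sqnorm (\<lambda>\<xi>. fourier_L1 \<sigma> (cut R f) \<xi> - g' \<xi>) = sqnorm (\<lambda>\<xi>. fourier_L1 \<sigma> (cut R f) \<xi> - g \<xi>)" for R
    using eq by (intro sqnorm_cong_AE) (auto elim: eventually_mono)
  ultimately show ?thesis using 1 by (simp add: is_L2_fourier_iff L2_iff)
qed

lemma is_L2_fourier_L1: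
  assumes f: "integrable lborel f" "L2 f" and \<sigma>: "\<sigma>\<^sup>2 = 1"
  shows "is_L2_fourier \<sigma> f (fourier_L1 \<sigma> f)"
proof -
  have [measurable]: "f \<in> borel_measurable borel" using f by auto
  have "L2 (fourier_L1 \<sigma> f)"
    using f plancherel_L1_L2[OF f \<sigma>] by (simp add: L2_iff)
  moreover have "sqnorm (\<lambda>\<xi>. fourier_L1 \<sigma> (cut R f) \<xi> - fourier_L1 \<sigma> f \<xi>) = sqnorm (\<lambda>x. cut R f x - f x)" for R
  proof -
    have "sqnorm (\<lambda>\<xi>. fourier_L1 \<sigma> (cut R f) \<xi> - fourier_L1 \<sigma> f \<xi>) = sqnorm (fourier_L1 \<sigma> (\<lambda>x. cut R f x - f x))"
      by (rule sqnorm_cong) (simp add: fourier_L1_diff integrable_cut f)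
    also have "\<dots> = sqnorm (\<lambda>x. cut R f x - f x)"
      using integrable_cut[OF f(2), of R] L2_cut[OF f(2), of R] f
      by (intro plancherel_L1_L2 \<sigma> L2_diff) auto
    finally show ?thesis .
  qed
  ultimately show ?thesis using f sqnorm_cut_tendsto_0[OF f(2)] by (simp add: is_L2_fourier_iff)
qed

section \<open>Dilations and translations of the transform\<close>

lemma sqnorm_scale:
  assumes [measurable]: "f \<in> borel_measurable borel" and l: "l > 0"
  shows "sqnorm (\<lambda>x. f (l *\<^sub>R x)) = ennreal (1 / l\<^sup>2) * sqnorm f"
proof -
  have "sqnorm f = ennreal (l\<^sup>2) * sqnorm (\<lambda>x. f (l *\<^sub>R x))"
    unfolding sqnorm_def using l by (subst nn_integral_affine[of _ l 0]) auto
  then show ?thesis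
    using l by (simp add: mult.assoc[symmetric] ennreal_mult[symmetric])
qed

lemma L2_scale: "L2 f \<Longrightarrow> l > 0 \<Longrightarrow> L2 (\<lambda>x. f (l *\<^sub>R x))"
  by (auto simp: L2_iff sqnorm_scale ennreal_mult_less_top)

lemma sqnorm_translate:
  assumes [measurable]: "f \<in> borel_measurable borel"
  shows "sqnorm (\<lambda>x. f (h + x)) = sqnorm f"
  unfolding sqnorm_def by (rule nn_integral_translate[where f="\<lambda>x. ennreal ((cmod (f x))\<^sup>2)"]) measurable

lemma L2_translate: "L2 f \<Longrightarrow> L2 (\<lambda>x. f (h + x))"
  by (auto simp: L2_iff sqnorm_translate)

text \<open>A dilation maps centred balls to centred balls, so the formula already holds exactly for
  truncated transforms, with radius \<open>l * R\<close> in place of \<open>R\<close>.\<close>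

lemma is_L2_fourier_scale:
  assumes 1: "is_L2_fourier \<sigma> f g" and l: "l > 0"
  shows "is_L2_fourier \<sigma> (\<lambda>x. f (l *\<^sub>R x)) (\<lambda>\<xi>. complex_of_real (1 / l\<^sup>2) * g ((1 / l) *\<^sub>R \<xi>))"
proof -
  note L = is_L2_fourierD[OF 1]
  have [measurable]: "f \<in> borel_measurable borel" "g \<in> borel_measurable borel"
    using L by (simp_all add: L2_measurable)
  have T: "fourier_L1 \<sigma> (cut R (\<lambda>x. f (l *\<^sub>R x))) \<xi> = complex_of_real (1 / l\<^sup>2) * fourier_L1 \<sigma> (cut (l * R) f) ((1 / l) *\<^sub>R \<xi>)" for R \<xi>
  proof -
    have i: "indicator (cball 0 (l * R)) (l *\<^sub>R x) = (indicator (cball 0 R) x :: complex)" for x :: "real^2"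
      using l by (auto simp: indicator_def)
    have "(LINT x|lborel. exp (\<i> * complex_of_real (\<sigma> * (x \<bullet> (1/l) *\<^sub>R \<xi>))) * cut (l * R) f x)
      = (l\<^sup>2) *\<^sub>R (LINT x|lborel. exp (\<i> * complex_of_real (\<sigma> * (x \<bullet> \<xi>))) * cut R (\<lambda>x. f (l *\<^sub>R x)) x)"
      using l by (subst integral_affine[of l _ 0]) (auto simp: i)
    then show ?thesis using l unfolding fourier_L1_def by (simp add: scaleR_conv_of_real)
  qed
  have e: "sqnorm (\<lambda>\<xi>. fourier_L1 \<sigma> (cut R (\<lambda>x. f (l *\<^sub>R x))) \<xi> - complex_of_real (1 / l\<^sup>2) * g ((1 / l) *\<^sub>R \<xi>))
     = ennreal ((1/l\<^sup>2)\<^sup>2 * l\<^sup>2) * sqnorm (\<lambda>\<xi>. fourier_L1 \<sigma> (cut (l * R) f) \<xi> - g \<xi>)" for R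
  proof -
    have "sqnorm (\<lambda>\<xi>. fourier_L1 \<sigma> (cut R (\<lambda>x. f (l *\<^sub>R x))) \<xi> - complex_of_real (1 / l\<^sup>2) * g ((1 / l) *\<^sub>R \<xi>))
      = sqnorm (\<lambda>\<xi>. complex_of_real (1 / l\<^sup>2) * (fourier_L1 \<sigma> (cut (l * R) f) ((1/l) *\<^sub>R \<xi>) - g ((1/l) *\<^sub>R \<xi>)))"
      unfolding T by (simp add: right_diff_distrib)
    also have "\<dots> = ennreal ((1 / l\<^sup>2)\<^sup>2) * sqnorm (\<lambda>\<xi>. fourier_L1 \<sigma> (cut (l * R) f) ((1/l) *\<^sub>R \<xi>) - g ((1/l) *\<^sub>R \<xi>))"
      by (subst sqnorm_cmult) (auto simp: norm_divide norm_power)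
    also have "sqnorm (\<lambda>\<xi>. fourier_L1 \<sigma> (cut (l * R) f) ((1/l) *\<^sub>R \<xi>) - g ((1/l) *\<^sub>R \<xi>))
       = ennreal (1 / (1/l)\<^sup>2) * sqnorm (\<lambda>\<xi>. fourier_L1 \<sigma> (cut (l * R) f) \<xi> - g \<xi>)"
      using l by (intro sqnorm_scale[of "\<lambda>\<xi>. fourier_L1 \<sigma> (cut (l * R) f) \<xi> - g \<xi>" "1/l"]) auto
    finally show ?thesis using l by (simp add: mult.assoc[symmetric] ennreal_mult[symmetric] power_divide)
  qed
  have "filterlim (\<lambda>R. l * R) at_top at_top"
    using l by (intro filterlim_tendsto_pos_mult_at_top[OF tendsto_const] filterlim_ident)
  then have "((\<lambda>R. sqnorm (\<lambda>\<xi>. fourier_L1 \<sigma> (cut (l * R) f) \<xi> - g \<xi>)) \<longlongrightarrow> 0) at_top"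
    using 1 unfolding is_L2_fourier_iff by (auto intro: filterlim_compose[where g="\<lambda>R. sqnorm (\<lambda>\<xi>. fourier_L1 \<sigma> (cut R f) \<xi> - g \<xi>)"])
  from ennreal_tendsto_cmult[OF _ this, of "ennreal ((1/l\<^sup>2)\<^sup>2 * l\<^sup>2)"]
  have "((\<lambda>R. ennreal ((1/l\<^sup>2)\<^sup>2 * l\<^sup>2) * sqnorm (\<lambda>\<xi>. fourier_L1 \<sigma> (cut (l * R) f) \<xi> - g \<xi>)) \<longlongrightarrow> 0) at_top" by simp
  moreover have "L2 (\<lambda>\<xi>. complex_of_real (1 / l\<^sup>2) * g ((1 / l) *\<^sub>R \<xi>))"
    using L2_lincomb[OF L2_scale[OF L(2), of "1/l"] L2_scale[OF L(2), of "1/l"], of "complex_of_real (1 / l\<^sup>2)" 0] l by simp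
  ultimately show ?thesis unfolding is_L2_fourier_iff e using L2_scale[OF L(1) l] by blast
qed

text \<open>A translated ball is no longer centred, so the truncated transforms do not match.
  Instead some transform g' of the translate is taken, and its distance to the expected function is
  bounded by quantities that vanish as the radius grows.\<close>

lemma is_L2_fourier_translate:
  assumes 1: "is_L2_fourier \<sigma> f g" and \<sigma>: "\<sigma>\<^sup>2 = 1"
  shows "is_L2_fourier \<sigma> (\<lambda>x. f (h + x)) (\<lambda>\<xi>. exp (- (\<i> * complex_of_real (\<sigma> * (h \<bullet> \<xi>)))) * g \<xi>)"
proof -
  note L = is_L2_fourierD[OF 1]
  have [measurable]: "f \<in> borel_measurable borel" "g \<in> borel_measurable borel"
    using L by (simp_all add: L2_measurable)
  let ?e = "\<lambda>\<xi>. exp (- (\<i> * complex_of_real (\<sigma> * (h \<bullet> \<xi>))))"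
  have ne: "cmod (?e \<xi>) = 1" for \<xi> by (simp add: exp_minus norm_inverse)
  obtain g' where g': "is_L2_fourier \<sigma> (\<lambda>x. f (h + x)) g'"
    using is_L2_fourier_exists[OF L2_translate[OF L(1)] \<sigma>] by blast
  have [measurable]: "g' \<in> borel_measurable borel"
    using is_L2_fourierD[OF g'] by (simp add: L2_measurable)
  have T: "fourier_L1 \<sigma> (\<lambda>x. cut R f (h + x)) \<xi> = ?e \<xi> * fourier_L1 \<sigma> (cut R f) \<xi>" for R \<xi>
  proof -
    have "(LINT x|lborel. exp (\<i> * complex_of_real (\<sigma> * (x \<bullet> \<xi>))) * cut R f (h + x))
      = (LINT x|lborel. ?e \<xi> * (exp (\<i> * complex_of_real (\<sigma> * ((h + x) \<bullet> \<xi>))) * cut R f (h + x)))"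
      by (intro Bochner_Integration.integral_cong refl)
         (simp add: inner_add_left distrib_left exp_add exp_minus field_simps)
    also have "\<dots> = (LINT x|lborel. ?e \<xi> * (exp (\<i> * complex_of_real (\<sigma> * (x \<bullet> \<xi>))) * cut R f x))"
      by (rule integral_translate[where f="\<lambda>x. ?e \<xi> * (exp (\<i> * complex_of_real (\<sigma> * (x \<bullet> \<xi>))) * cut R f x)"])
    finally show ?thesis unfolding fourier_L1_def by simp
  qed
  have d1: "sqnorm (\<lambda>\<xi>. ?e \<xi> * fourier_L1 \<sigma> (cut R f) \<xi> - g' \<xi>) = sqnorm (\<lambda>x. cut R f x - f x)" for R
  proof -
    have "is_L2_fourier \<sigma> (\<lambda>x. cut R f (h + x)) (fourier_L1 \<sigma> (\<lambda>x. cut R f (h + x)))"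
      by (intro is_L2_fourier_L1 \<sigma> L2_translate[OF L2_cut[OF L(1)]] integrable_translate[OF integrable_cut[OF L(1)]])
    from plancherel[OF is_L2_fourier_diff[OF this g'] \<sigma>]
    show ?thesis unfolding T using sqnorm_translate[of "\<lambda>x. cut R f x - f x" h] by simp
  qed
  have d2: "sqnorm (\<lambda>\<xi>. ?e \<xi> * fourier_L1 \<sigma> (cut R f) \<xi> - ?e \<xi> * g \<xi>) = sqnorm (\<lambda>\<xi>. fourier_L1 \<sigma> (cut R f) \<xi> - g \<xi>)" for R
    by (rule sqnorm_cong) (simp add: right_diff_distrib[symmetric] norm_mult ne del: right_diff_distrib)
  have "sqnorm (\<lambda>\<xi>. g' \<xi> - ?e \<xi> * g \<xi>) \<le> 2 * sqnorm (\<lambda>x. cut R f x - f x) + 2 * sqnorm (\<lambda>\<xi>. fourier_L1 \<sigma> (cut R f) \<xi> - g \<xi>)" for R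
  proof -
    have "sqnorm (\<lambda>\<xi>. g' \<xi> - ?e \<xi> * g \<xi>) =
      sqnorm (\<lambda>\<xi>. (?e \<xi> * fourier_L1 \<sigma> (cut R f) \<xi> - ?e \<xi> * g \<xi>) - (?e \<xi> * fourier_L1 \<sigma> (cut R f) \<xi> - g' \<xi>))"
      by simp
    also have "\<dots> \<le> 2 * sqnorm (\<lambda>\<xi>. fourier_L1 \<sigma> (cut R f) \<xi> - g \<xi>) + 2 * sqnorm (\<lambda>x. cut R f x - f x)"
      unfolding d1[symmetric] d2[symmetric] by (rule sqnorm_diff_le2) measurable
    finally show ?thesis by (simp add: add.commute)
  qed
  moreover have "((\<lambda>R. 2 * sqnorm (\<lambda>x. cut R f x - f x) + 2 * sqnorm (\<lambda>\<xi>. fourier_L1 \<sigma> (cut R f) \<xi> - g \<xi>)) \<longlongrightarrow> 2 * 0 + 2 * 0) at_top"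
    using 1 sqnorm_cut_tendsto_0[OF L(1)] unfolding is_L2_fourier_iff by (intro tendsto_add ennreal_tendsto_cmult) auto
  ultimately have "sqnorm (\<lambda>\<xi>. g' \<xi> - ?e \<xi> * g \<xi>) \<le> 0"
    using tendsto_lowerbound[where F="at_top :: real filter" and a="sqnorm (\<lambda>\<xi>. g' \<xi> - ?e \<xi> * g \<xi>)"] by force
  then have "AE \<xi> in lborel. g' \<xi> = ?e \<xi> * g \<xi>"
    by (simp add: sqnorm_eq_0)
  then show ?thesis by (intro is_L2_fourier_cong_AE[OF g']) auto
qed

lemma fourier_spec: "L2 f \<Longrightarrow> is_L2_fourier (-1) f (fourier f)"
  unfolding fourier_def by (rule someI_ex[of "is_L2_fourier (-1) f"]) (simp add: is_L2_fourier_exists)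

lemma inv_fourier_spec: "L2 f \<Longrightarrow> is_L2_fourier 1 f (inv_fourier f)"
  unfolding inv_fourier_def by (rule someI_ex[of "is_L2_fourier 1 f"]) (simp add: is_L2_fourier_exists)

section \<open>The kinetic energy on the Fourier side\<close>

lemma sobolev_L2: "u \<in> sobolev s \<Longrightarrow> L2 (cplx u)"
  by (simp add: sobolev_def)

lemma L2_cplx_iff:
  "L2 (cplx u) \<longleftrightarrow> u \<in> borel_measurable borel \<and> integrable lborel (\<lambda>x. (u x)\<^sup>2)"
proof -
  have "(\<lambda>x. complex_of_real (u x)) \<in> borel_measurable borel \<longleftrightarrow> u \<in> borel_measurable borel"
  proof
    assume [measurable]: "(\<lambda>x. complex_of_real (u x)) \<in> borel_measurable borel"
    have "(\<lambda>x. Re (complex_of_real (u x))) \<in> borel_measurable borel" by measurable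
    then show "u \<in> borel_measurable borel" by simp
  qed measurable
  then show ?thesis by (simp add: L2_def)
qed

lemma fourier_cplx:
  assumes "L2 (cplx u)"
  shows "is_L2_fourier (-1) (cplx u) (fourier (cplx u))" "L2 (fourier (cplx u))"
    and fourier_cplx_measurable: "fourier (cplx u) \<in> borel_measurable borel"
  using fourier_spec[OF assms] is_L2_fourierD(2)[OF fourier_spec[OF assms]]
  by (auto simp: L2_measurable)

lemma mass_eq: "mass u = (LINT x|lborel. (u x)\<^sup>2)"
  by (simp add: mass_def)

lemma mass_fourier:
  assumes "L2 (cplx u)"
  shows "mass u = (LINT \<xi>|lborel. (cmod (fourier (cplx u) \<xi>))\<^sup>2)"
proof -
  have "sqnorm (fourier (cplx u)) = sqnorm (cplx u)"
    by (rule plancherel[OF fourier_cplx(1)[OF assms]]) simp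
  then have "(LINT \<xi>|lborel. (cmod (fourier (cplx u) \<xi>))\<^sup>2) = (LINT x|lborel. (cmod (cplx u x))\<^sup>2)"
    using integral_eq_enn2real_sqnorm[OF fourier_cplx(3)[OF assms]] integral_eq_enn2real_sqnorm[OF L2_measurable[OF assms]]
    by simp
  then show ?thesis by (simp add: mass_def)
qed

text \<open>The transform of the fractional Laplacian of order s/2 applied to u; the kinetic energy
  is its squared norm.\<close>

definition symb :: "real \<Rightarrow> (real^2 \<Rightarrow> real) \<Rightarrow> real^2 \<Rightarrow> complex" where
  "symb s u \<xi> = complex_of_real (norm \<xi> powr s) * fourier (cplx u) \<xi>"

lemma symb_sq: "(cmod (symb s u \<xi>))\<^sup>2 = norm \<xi> powr (2 * s) * (cmod (fourier (cplx u) \<xi>))\<^sup>2"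
  by (simp add: symb_def norm_mult power_mult_distrib power2_eq_square[of "norm \<xi> powr s"] powr_add[symmetric])

lemma symb_measurable:
  assumes "L2 (cplx u)" shows "symb s u \<in> borel_measurable borel"
proof -
  note [measurable] = fourier_cplx_measurable[OF assms]
  show ?thesis unfolding symb_def[abs_def] by measurable
qed

lemma power2_powr: "x \<ge> 0 \<Longrightarrow> (x\<^sup>2) powr s = x powr (2 * s)" for x :: real
  by (cases "x = 0") (simp_all add: powr_powr flip: powr_numeral)

text \<open>For these s the weight (1 + |xi|^2)^s is comparable to 1 + |xi|^(2 s), so membership
  separates into square integrability of u and finiteness of its kinetic energy.\<close>

lemma sobolev_iff:
  assumes s: "0 < s" "s \<le> 1"
  shows "u \<in> sobolev s \<longleftrightarrow> L2 (cplx u) \<and> L2 (symb s u)"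
proof (cases "L2 (cplx u)")
  case True
  note [measurable] = fourier_cplx_measurable[OF True] symb_measurable[OF True]
  have i: "integrable lborel (\<lambda>\<xi>. (cmod (fourier (cplx u) \<xi>))\<^sup>2)"
    using fourier_cplx(2)[OF True] by (simp add: L2_def)
  have "integrable lborel (\<lambda>\<xi>. (1 + (norm \<xi>)\<^sup>2) powr s * (cmod (fourier (cplx u) \<xi>))\<^sup>2)
     \<longleftrightarrow> integrable lborel (\<lambda>\<xi>. norm \<xi> powr (2 * s) * (cmod (fourier (cplx u) \<xi>))\<^sup>2)" (is "?A \<longleftrightarrow> ?B")
  proof
    assume ?A
    then show ?B
    proof (rule Bochner_Integration.integrable_bound)
      have "norm \<xi> powr (2 * s) \<le> (1 + (norm \<xi>)\<^sup>2) powr s" for \<xi> :: "real^2"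
      proof -
        have "norm \<xi> powr (2 * s) = ((norm \<xi>)\<^sup>2) powr s"
          by (rule power2_powr[symmetric]) simp
        also have "\<dots> \<le> (1 + (norm \<xi>)\<^sup>2) powr s" using s by (intro powr_mono2) auto
        finally show ?thesis .
      qed
      then show "AE \<xi> in lborel. norm (norm \<xi> powr (2 * s) * (cmod (fourier (cplx u) \<xi>))\<^sup>2) \<le>
         norm ((1 + (norm \<xi>)\<^sup>2) powr s * (cmod (fourier (cplx u) \<xi>))\<^sup>2)"
        by (auto simp: abs_mult intro!: mult_right_mono)
    qed measurable
  next
    assume ?B
    then have "integrable lborel (\<lambda>\<xi>. 2 * (cmod (fourier (cplx u) \<xi>))\<^sup>2 + 2 * (norm \<xi> powr (2 * s) * (cmod (fourier (cplx u) \<xi>))\<^sup>2))"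
      using i by simp
    then show ?A
    proof (rule Bochner_Integration.integrable_bound)
      have "(1 + (norm \<xi>)\<^sup>2) powr s \<le> 2 + 2 * norm \<xi> powr (2 * s)" for \<xi> :: "real^2"
      proof -
        have "(1 + (norm \<xi>)\<^sup>2) powr s \<le> (2 * max 1 ((norm \<xi>)\<^sup>2)) powr s"
          using s by (intro powr_mono2) auto
        also have "\<dots> = 2 powr s * (max 1 ((norm \<xi>)\<^sup>2)) powr s" by (simp add: powr_mult)
        also have "\<dots> \<le> 2 powr 1 * (1 + norm \<xi> powr (2 * s))"
        proof (intro mult_mono powr_mono)
          have "((norm \<xi>)\<^sup>2) powr s = norm \<xi> powr (2 * s)"
            by (rule power2_powr) simp
          then show "(max 1 ((norm \<xi>)\<^sup>2)) powr s \<le> 1 + norm \<xi> powr (2 * s)"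
            by (auto simp: max_def)
        qed (use s in auto)
        finally show ?thesis by simp
      qed
      then have "(1 + (norm \<xi>)\<^sup>2) powr s * (cmod (fourier (cplx u) \<xi>))\<^sup>2 \<le> (2 + 2 * norm \<xi> powr (2 * s)) * (cmod (fourier (cplx u) \<xi>))\<^sup>2" for \<xi>
        by (intro mult_right_mono) auto
      then show "AE \<xi> in lborel. norm ((1 + (norm \<xi>)\<^sup>2) powr s * (cmod (fourier (cplx u) \<xi>))\<^sup>2) \<le>
         norm (2 * (cmod (fourier (cplx u) \<xi>))\<^sup>2 + 2 * (norm \<xi> powr (2 * s) * (cmod (fourier (cplx u) \<xi>))\<^sup>2))"
        by (auto simp: algebra_simps)
    qed measurable
  qed
  then show ?thesis using True symb_measurable[OF True] by (simp add: sobolev_def L2_def symb_sq)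
qed (simp add: sobolev_def)

lemma frac_laplacian_spec:
  assumes s: "0 < s" "s \<le> 1" and u: "u \<in> sobolev s"
  shows "is_L2_fourier 1 (symb s u) (frac_laplacian (s/2) u)"
proof -
  have "frac_laplacian (s/2) u = inv_fourier (symb s u)"
    by (simp add: frac_laplacian_def symb_def[abs_def])
  then show ?thesis using u inv_fourier_spec sobolev_iff[OF s] by simp
qed

lemma frac_laplacian_L2:
  assumes s: "0 < s" "s \<le> 1" and u: "u \<in> sobolev s"
  shows "L2 (frac_laplacian (s/2) u)" "L2 (symb s u)"
  using is_L2_fourierD[OF frac_laplacian_spec[OF assms]] by auto

lemma kinetic_sqnorm:
  assumes s: "0 < s" "s \<le> 1" and u: "u \<in> sobolev s"
  shows "kinetic s u = enn2real (sqnorm (symb s u))"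
  unfolding kinetic_def
  using frac_laplacian_L2[OF assms] plancherel[OF frac_laplacian_spec[OF assms]]
  by (simp add: integral_eq_enn2real_sqnorm L2_measurable)

lemma ennreal_kinetic:
  assumes s: "0 < s" "s \<le> 1" and u: "u \<in> sobolev s"
  shows "ennreal (kinetic s u) = sqnorm (symb s u)"
  using kinetic_sqnorm[OF assms] frac_laplacian_L2(2)[OF assms] by (simp add: L2_iff)

lemma kinetic_fourier:
  assumes s: "0 < s" "s \<le> 1" and u: "u \<in> sobolev s"
  shows "kinetic s u = (LINT \<xi>|lborel. norm \<xi> powr (2 * s) * (cmod (fourier (cplx u) \<xi>))\<^sup>2)"
    and "integrable lborel (\<lambda>\<xi>. norm \<xi> powr (2 * s) * (cmod (fourier (cplx u) \<xi>))\<^sup>2)"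
proof -
  have "L2 (symb s u)" using frac_laplacian_L2(2)[OF assms] .
  then show "integrable lborel (\<lambda>\<xi>. norm \<xi> powr (2 * s) * (cmod (fourier (cplx u) \<xi>))\<^sup>2)"
    by (simp add: L2_def symb_sq)
  show "kinetic s u = (LINT \<xi>|lborel. norm \<xi> powr (2 * s) * (cmod (fourier (cplx u) \<xi>))\<^sup>2)"
    using kinetic_sqnorm[OF assms] integral_eq_enn2real_sqnorm[OF L2_measurable[OF \<open>L2 (symb s u)\<close>]]
    by (simp add: symb_sq)
qed

lemma kinetic_nonneg: "0 \<le> kinetic s u"
  unfolding kinetic_def by simp

lemma mass_nonneg: "0 \<le> mass u"
  unfolding mass_def by simp

lemma quartic_nonneg: "0 \<le> quartic u"
  unfolding quartic_def by simp

section \<open>Differences, polarisation and dilations in H^s\<close>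

lemma sobolev_diff:
  assumes s: "0 < s" "s \<le> 1" and u: "u \<in> sobolev s" and v: "v \<in> sobolev s"
  defines "w \<equiv> \<lambda>x. u x - v x"
  shows "w \<in> sobolev s"
    and "AE x in lborel. frac_laplacian (s/2) w x = frac_laplacian (s/2) u x - frac_laplacian (s/2) v x"
proof -
  have Lu: "L2 (cplx u)" and Lv: "L2 (cplx v)" using u v by (auto simp: sobolev_L2)
  have Lw: "L2 (cplx w)" using L2_diff[OF Lu Lv] unfolding w_def by simp
  have "AE \<xi> in lborel. fourier (cplx w) \<xi> = fourier (cplx u) \<xi> - fourier (cplx v) \<xi>"
    by (rule is_L2_fourier_unique_AE[OF fourier_cplx(1)[OF Lw]
          is_L2_fourier_diff[OF fourier_cplx(1)[OF Lu] fourier_cplx(1)[OF Lv]]]) (simp_all add: w_def)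
  then have e: "AE \<xi> in lborel. symb s w \<xi> = symb s u \<xi> - symb s v \<xi>"
    by eventually_elim (simp add: symb_def right_diff_distrib)
  have "sqnorm (symb s w) = sqnorm (\<lambda>\<xi>. symb s u \<xi> - symb s v \<xi>)"
    by (rule sqnorm_cong_AE[OF e])
  moreover have "L2 (\<lambda>\<xi>. symb s u \<xi> - symb s v \<xi>)"
    using u v sobolev_iff[OF s] by (intro L2_diff) auto
  ultimately have "L2 (symb s w)" using symb_measurable[OF Lw] by (simp add: L2_iff)
  then show w: "w \<in> sobolev s" using Lw sobolev_iff[OF s] by blast
  show "AE x in lborel. frac_laplacian (s/2) w x = frac_laplacian (s/2) u x - frac_laplacian (s/2) v x"
    by (rule is_L2_fourier_unique_AE[OF frac_laplacian_spec[OF s w]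
          is_L2_fourier_diff[OF frac_laplacian_spec[OF s u] frac_laplacian_spec[OF s v]] _ e]) simp
qed

lemma L2_inner_polar:
  assumes "L2 f" "L2 g"
  shows "2 * Re (LINT x|lborel. f x * cnj (g x)) =
    (LINT x|lborel. (cmod (f x))\<^sup>2) + (LINT x|lborel. (cmod (g x))\<^sup>2) - (LINT x|lborel. (cmod (f x - g x))\<^sup>2)"
proof -
  have [measurable]: "f \<in> borel_measurable borel" "g \<in> borel_measurable borel"
    using assms by (simp_all add: L2_measurable)
  have i: "integrable lborel (\<lambda>x. (cmod (f x))\<^sup>2)" "integrable lborel (\<lambda>x. (cmod (g x))\<^sup>2)"
    "integrable lborel (\<lambda>x. (cmod (f x - g x))\<^sup>2)"
    using assms L2_diff[OF assms] by (auto simp: L2_def)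
  have p: "2 * Re (f x * cnj (g x)) = (cmod (f x))\<^sup>2 + (cmod (g x))\<^sup>2 - (cmod (f x - g x))\<^sup>2" for x
    unfolding cmod_power2 by (simp add: power2_eq_square algebra_simps)
  have "integrable lborel (\<lambda>x. f x * cnj (g x))"
  proof (rule Bochner_Integration.integrable_bound)
    show "integrable lborel (\<lambda>x. (cmod (f x))\<^sup>2 + (cmod (g x))\<^sup>2)" using i by simp
    have "cmod (f x) * cmod (g x) \<le> (cmod (f x))\<^sup>2 + (cmod (g x))\<^sup>2" for x
    proof -
      have "0 \<le> cmod (f x) * cmod (g x)" by simp
      then show ?thesis using sum_squares_bound[of "cmod (f x)" "cmod (g x)"] unfolding mult.assoc by linarith
    qed
    then show "AE x in lborel. norm (f x * cnj (g x)) \<le> norm ((cmod (f x))\<^sup>2 + (cmod (g x))\<^sup>2)"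
      by (simp add: norm_mult)
  qed measurable
  then have "2 * Re (LINT x|lborel. f x * cnj (g x)) = (LINT x|lborel. 2 * Re (f x * cnj (g x)))"
    by (simp only: integral_mult_right_zero integral_Re)
  also have "\<dots> = (LINT x|lborel. (cmod (f x))\<^sup>2 + (cmod (g x))\<^sup>2 - (cmod (f x - g x))\<^sup>2)"
    unfolding p ..
  also have "\<dots> = (LINT x|lborel. (cmod (f x))\<^sup>2) + (LINT x|lborel. (cmod (g x))\<^sup>2) - (LINT x|lborel. (cmod (f x - g x))\<^sup>2)"
    using i by simp
  finally show ?thesis .
qed

text \<open>Polarisation expresses the pairing of the weak formulation by kinetic energies alone,
  whose dilation behaviour is known.\<close>

lemma kinetic_polar:
  assumes s: "0 < s" "s \<le> 1" and u: "u \<in> sobolev s" and v: "v \<in> sobolev s"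
  shows "2 * Re (LINT x|lborel. frac_laplacian (s/2) u x * cnj (frac_laplacian (s/2) v x))
     = kinetic s u + kinetic s v - kinetic s (\<lambda>x. u x - v x)"
proof -
  note [measurable] = L2_measurable[OF frac_laplacian_L2(1)[OF s u]] L2_measurable[OF frac_laplacian_L2(1)[OF s v]]
    L2_measurable[OF frac_laplacian_L2(1)[OF s sobolev_diff(1)[OF s u v]]]
  have "kinetic s (\<lambda>x. u x - v x) = (LINT x|lborel. (cmod (frac_laplacian (s/2) u x - frac_laplacian (s/2) v x))\<^sup>2)"
    unfolding kinetic_def using sobolev_diff(2)[OF s u v]
    by (intro integral_cong_AE) (auto elim: eventually_mono)
  then show ?thesis
    using L2_inner_polar[OF frac_laplacian_L2(1)[OF s u] frac_laplacian_L2(1)[OF s v]]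
    by (simp add: kinetic_def)
qed

lemma mass_polar:
  assumes u: "L2 (cplx u)" and v: "L2 (cplx v)"
  shows "2 * (LINT x|lborel. u x * v x) = mass u + mass v - mass (\<lambda>x. u x - v x)"
  using L2_inner_polar[OF u v]
  by (simp add: mass_eq integral_complex_of_real flip: of_real_mult of_real_diff)

lemma mass_scale:
  assumes l: "l > 0" shows "mass (\<lambda>x. a * u (l *\<^sub>R x)) = a\<^sup>2 / l\<^sup>2 * mass u"
proof -
  have "mass u = l\<^sup>2 * (LINT x|lborel. (u (l *\<^sub>R x))\<^sup>2)"
    unfolding mass_eq using integral_affine[of l "\<lambda>x. (u x)\<^sup>2" 0] l by simp
  then show ?thesis unfolding mass_eq using l by (simp add: power_mult_distrib)
qed

lemma quartic_scale:
  assumes l: "l > 0" shows "quartic (\<lambda>x. a * u (l *\<^sub>R x)) = a^4 / l\<^sup>2 * quartic u"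
proof -
  have "quartic u = l\<^sup>2 * (LINT x|lborel. \<bar>u (l *\<^sub>R x)\<bar>^4)"
    unfolding quartic_def using integral_affine[of l "\<lambda>x. \<bar>u x\<bar>^4" 0] l by simp
  then show ?thesis unfolding quartic_def using l by (simp add: power_mult_distrib abs_mult)
qed

text \<open>The exponent 2 s - 2 collects 2 s from the symbol, -4 from the squared prefactor of the
  dilated transform and 2 from the change of variables. The free amplitude a allows both u(l x), for
  Pohozaev's identity, and l u(l x), which preserves the mass.\<close>

lemma sobolev_scale:
  fixes a l :: real
  assumes s: "0 < s" "s \<le> 1" and u: "u \<in> sobolev s" and l: "l > 0"
  defines "v \<equiv> \<lambda>x. a * u (l *\<^sub>R x)"
  shows "v \<in> sobolev s" and "kinetic s v = a\<^sup>2 * l powr (2 * s - 2) * kinetic s u"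
proof -
  have Lu: "L2 (cplx u)" using u by (rule sobolev_L2)
  note [measurable] = symb_measurable[OF Lu]
  define b where "b = a / l\<^sup>2"
  have 1: "is_L2_fourier (-1) (cplx v) (\<lambda>\<xi>. complex_of_real b * fourier (cplx u) ((1 / l) *\<^sub>R \<xi>))"
    using is_L2_fourier_cmult[OF is_L2_fourier_scale[OF fourier_cplx(1)[OF Lu] l], of "complex_of_real a"]
    unfolding v_def b_def by simp
  have Lv: "L2 (cplx v)" using is_L2_fourierD(1)[OF 1] .
  have "AE \<xi> in lborel. fourier (cplx v) \<xi> = complex_of_real b * fourier (cplx u) ((1 / l) *\<^sub>R \<xi>)"
    by (rule is_L2_fourier_unique_AE[OF fourier_cplx(1)[OF Lv] 1]) auto
  then have e: "AE \<xi> in lborel. symb s v \<xi> = complex_of_real (b * l powr s) * symb s u ((1 / l) *\<^sub>R \<xi>)"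
  proof eventually_elim
    case (elim \<xi>)
    have "norm ((1 / l) *\<^sub>R \<xi>) powr s = norm \<xi> powr s / l powr s"
      using l by (simp add: powr_divide)
    then show ?case using l elim unfolding symb_def by simp
  qed
  have n: "sqnorm (symb s v) = ennreal ((b * l powr s)\<^sup>2 * l\<^sup>2) * sqnorm (symb s u)"
  proof -
    have "sqnorm (symb s v) = sqnorm (\<lambda>\<xi>. complex_of_real (b * l powr s) * symb s u ((1 / l) *\<^sub>R \<xi>))"
      by (rule sqnorm_cong_AE[OF e])
    also have "\<dots> = ennreal ((b * l powr s)\<^sup>2) * sqnorm (\<lambda>\<xi>. symb s u ((1 / l) *\<^sub>R \<xi>))"
      by (subst sqnorm_cmult) (auto simp: norm_mult power_mult_distrib)
    also have "sqnorm (\<lambda>\<xi>. symb s u ((1 / l) *\<^sub>R \<xi>)) = ennreal (1 / (1/l)\<^sup>2) * sqnorm (symb s u)"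
      using l by (intro sqnorm_scale) auto
    finally show ?thesis using l by (simp add: mult.assoc[symmetric] ennreal_mult[symmetric] power_divide)
  qed
  have "L2 (symb s v)"
    using symb_measurable[OF Lv] n frac_laplacian_L2(2)[OF s u] by (simp add: L2_iff ennreal_mult_less_top)
  then show v: "v \<in> sobolev s" using Lv sobolev_iff[OF s] by blast
  have "kinetic s v = (b * l powr s)\<^sup>2 * l\<^sup>2 * kinetic s u"
    unfolding kinetic_sqnorm[OF s v] kinetic_sqnorm[OF s u] n by (simp add: enn2real_mult)
  also have "(b * l powr s)\<^sup>2 * l\<^sup>2 = a\<^sup>2 * l powr (2 * s - 2)"
  proof -
    have "(l powr s)\<^sup>2 = l powr (2 * s)" by (simp add: power2_eq_square powr_add[symmetric])
    moreover have "l powr (2 * s - 2) = l powr (2 * s) / l\<^sup>2"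
      using l by (simp add: powr_diff)
    ultimately show ?thesis unfolding b_def using l
      by (simp add: power_mult_distrib power_divide power2_eq_square)
  qed
  finally show "kinetic s v = a\<^sup>2 * l powr (2 * s - 2) * kinetic s u" .
qed

text \<open>Interpolates between the Lipschitz bound r, good for r \<le> 1, and the trivial bound 2,
  good for r > 1.\<close>

lemma cmod_exp_minus_1_sq:
  fixes t :: real assumes s: "0 < s" "s \<le> 1" and t: "\<bar>t\<bar> \<le> r"
  shows "(cmod (exp (- (\<i> * complex_of_real t)) - 1))\<^sup>2 \<le> 4 * r powr (2 * s)"
proof -
  have r0: "r \<ge> 0" using t by linarith
  have 2: "cmod (exp (- (\<i> * complex_of_real t)) - 1) \<le> 2"
    using norm_triangle_ineq4[of "exp (- (\<i> * complex_of_real t))" 1] by (simp add: exp_minus norm_inverse)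
  have "cmod (exp (\<i> * complex_of_real (- t)) - 1) \<le> \<bar>- t\<bar>"
    using iexp_approx1[of "- t" 0] by simp
  then have 1: "cmod (exp (- (\<i> * complex_of_real t)) - 1) \<le> r" using t by simp
  show ?thesis
  proof (cases "r \<le> 1")
    case True
    have "(cmod (exp (- (\<i> * complex_of_real t)) - 1))\<^sup>2 \<le> r\<^sup>2" using 1 by (intro power_mono) auto
    also have "r\<^sup>2 = r powr 2" using r0 by (cases "r = 0") auto
    also have "\<dots> \<le> r powr (2 * s)"
    proof (cases "r = 0")
      case False
      then show ?thesis using True s r0 by (intro powr_mono') auto
    qed simp
    also have "\<dots> \<le> 4 * r powr (2 * s)" by simp
    finally show ?thesis .
  next
    case False
    have "(cmod (exp (- (\<i> * complex_of_real t)) - 1))\<^sup>2 \<le> 2\<^sup>2" using 2 by (intro power_mono) auto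
    also have "\<dots> \<le> 4 * r powr (2 * s)" using False s by (simp add: ge_one_powr_ge_zero)
    finally show ?thesis .
  qed
qed

text \<open>In frequency, translation by h is multiplication by a phase, and the phase differs from
  1 by at most 2 (|h| |xi|)^s; the factor |xi|^s is the symbol of the kinetic energy.\<close>

lemma translation_difference:
  assumes s: "0 < s" "s \<le> 1" and u: "u \<in> sobolev s"
  shows "(\<integral>\<^sup>+x. ennreal ((u (h + x) - u x)\<^sup>2) \<partial>lborel) \<le> ennreal (4 * norm h powr (2 * s) * kinetic s u)"
proof -
  have Lu: "L2 (cplx u)" using u by (rule sobolev_L2)
  note [measurable] = symb_measurable[OF Lu]
  have 1: "is_L2_fourier (-1) (\<lambda>x. cplx u (h + x) - cplx u x)
     (\<lambda>\<xi>. exp (- (\<i> * complex_of_real (- 1 * (h \<bullet> \<xi>)))) * fourier (cplx u) \<xi> - fourier (cplx u) \<xi>)"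
    by (intro is_L2_fourier_diff is_L2_fourier_translate fourier_cplx(1)[OF Lu]) simp
  have "(\<integral>\<^sup>+x. ennreal ((u (h + x) - u x)\<^sup>2) \<partial>lborel) = sqnorm (\<lambda>x. cplx u (h + x) - cplx u x)"
    unfolding sqnorm_def by (simp flip: of_real_diff)
  also have "\<dots> = sqnorm (\<lambda>\<xi>. exp (- (\<i> * complex_of_real (- 1 * (h \<bullet> \<xi>)))) * fourier (cplx u) \<xi> - fourier (cplx u) \<xi>)"
    by (rule plancherel[OF 1, symmetric]) simp
  also have "\<dots> \<le> sqnorm (\<lambda>\<xi>. complex_of_real (2 * norm h powr s) * symb s u \<xi>)"
  proof (rule sqnorm_mono, rule power2_le_imp_le)
    fix \<xi> :: "real^2"
    let ?e = "exp (- (\<i> * complex_of_real (- 1 * (h \<bullet> \<xi>)))) - 1"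
    have "(cmod ?e)\<^sup>2 \<le> 4 * (norm h * norm \<xi>) powr (2 * s)"
      by (rule cmod_exp_minus_1_sq[OF s]) (simp add: Cauchy_Schwarz_ineq2)
    then have "(cmod ?e)\<^sup>2 * (cmod (fourier (cplx u) \<xi>))\<^sup>2 \<le> 4 * (norm h * norm \<xi>) powr (2 * s) * (cmod (fourier (cplx u) \<xi>))\<^sup>2"
      by (rule mult_right_mono) simp
    also have "\<dots> = (cmod (complex_of_real (2 * norm h powr s) * symb s u \<xi>))\<^sup>2"
    proof -
      have "(norm h powr s)\<^sup>2 = norm h powr (2 * s)" by (simp add: power2_eq_square powr_add[symmetric])
      then show ?thesis by (simp add: norm_mult power_mult_distrib symb_sq powr_mult)
    qed
    finally have "(cmod ?e)\<^sup>2 * (cmod (fourier (cplx u) \<xi>))\<^sup>2 \<le> (cmod (complex_of_real (2 * norm h powr s) * symb s u \<xi>))\<^sup>2" .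
    then show "(cmod (exp (- (\<i> * complex_of_real (- 1 * (h \<bullet> \<xi>)))) * fourier (cplx u) \<xi> - fourier (cplx u) \<xi>))\<^sup>2
       \<le> (cmod (complex_of_real (2 * norm h powr s) * symb s u \<xi>))\<^sup>2"
    proof -
      have "exp (- (\<i> * complex_of_real (- 1 * (h \<bullet> \<xi>)))) * fourier (cplx u) \<xi> - fourier (cplx u) \<xi> = ?e * fourier (cplx u) \<xi>"
        by (simp only: left_diff_distrib mult_1)
      then show ?thesis
        using \<open>(cmod ?e)\<^sup>2 * (cmod (fourier (cplx u) \<xi>))\<^sup>2 \<le> (cmod (complex_of_real (2 * norm h powr s) * symb s u \<xi>))\<^sup>2\<close>
        by (simp only: norm_mult power_mult_distrib)
    qed
  qed simp
  also have "\<dots> = ennreal ((2 * norm h powr s)\<^sup>2) * sqnorm (symb s u)"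
    by (subst sqnorm_cmult) (auto simp: norm_mult)
  also have "\<dots> = ennreal ((2 * norm h powr s)\<^sup>2) * ennreal (kinetic s u)"
    by (simp add: ennreal_kinetic[OF s u])
  also have "\<dots> = ennreal (4 * norm h powr (2 * s) * kinetic s u)"
  proof -
    have "(norm h powr s)\<^sup>2 = norm h powr (2 * s)" by (simp add: power2_eq_square powr_add[symmetric])
    then show ?thesis by (simp add: ennreal_mult[symmetric] kinetic_nonneg power_mult_distrib)
  qed
  finally show ?thesis .
qed

text \<open>Young's inequality for the symbol, |xi|^(2 r) being the product of (|xi|^(2 s))^(r/s)
  and 1. The weights add up to 1, so if the kinetic energy equals the mass at exponent s, lowering
  the exponent costs no constant; this precision is needed in
  \<open>weinstein_upper\<close>.\<close>

lemma sobolev_antimono: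
  assumes s: "0 < r" "r \<le> s" "s \<le> 1" and u: "u \<in> sobolev s"
  shows "u \<in> sobolev r" and "kinetic r u \<le> r / s * kinetic s u + (1 - r / s) * mass u"
proof -
  have Lu: "L2 (cplx u)" using u by (rule sobolev_L2)
  note [measurable] = symb_measurable[OF Lu] fourier_cplx_measurable[OF Lu]
  have s0: "0 < s" using s by simp
  have pw: "x powr (2 * r) \<le> r / s * x powr (2 * s) + (1 - r / s)" if x: "x \<ge> 0" for x :: real
  proof (cases "x = 0")
    case False
    have "(x powr (2 * s)) powr (r / s) * 1 powr (1 - r / s) \<le> r / s * x powr (2 * s) + (1 - r / s) * 1"
      using s s0 False x by (intro Youngs_inequality_0) auto
    then show ?thesis using s0 by (simp add: powr_powr)
  qed (use s in \<open>auto simp: field_simps\<close>)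
  have pt: "norm \<xi> powr (2 * r) * (cmod (fourier (cplx u) \<xi>))\<^sup>2 \<le>
      r / s * (norm \<xi> powr (2 * s) * (cmod (fourier (cplx u) \<xi>))\<^sup>2) + (1 - r / s) * (cmod (fourier (cplx u) \<xi>))\<^sup>2" for \<xi>
    using mult_right_mono[OF pw[of "norm \<xi>"], of "(cmod (fourier (cplx u) \<xi>))\<^sup>2"] by (simp add: algebra_simps)
  note ks = kinetic_fourier[OF s0 s(3) u]
  have im: "integrable lborel (\<lambda>\<xi>. (cmod (fourier (cplx u) \<xi>))\<^sup>2)"
    using fourier_cplx(2)[OF Lu] by (simp add: L2_def)
  have i2: "integrable lborel (\<lambda>\<xi>. r / s * (norm \<xi> powr (2 * s) * (cmod (fourier (cplx u) \<xi>))\<^sup>2) + (1 - r / s) * (cmod (fourier (cplx u) \<xi>))\<^sup>2)"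
    using ks(2) im by (intro Bochner_Integration.integrable_add integrable_mult_right) auto
  have i1: "integrable lborel (\<lambda>\<xi>. norm \<xi> powr (2 * r) * (cmod (fourier (cplx u) \<xi>))\<^sup>2)"
  proof (rule Bochner_Integration.integrable_bound[OF i2])
    show "AE \<xi> in lborel. norm (norm \<xi> powr (2 * r) * (cmod (fourier (cplx u) \<xi>))\<^sup>2) \<le>
      norm (r / s * (norm \<xi> powr (2 * s) * (cmod (fourier (cplx u) \<xi>))\<^sup>2) + (1 - r / s) * (cmod (fourier (cplx u) \<xi>))\<^sup>2)"
      using order_trans[OF pt abs_ge_self] by (intro AE_I2) (simp add: abs_mult)
  qed measurable
  then have "L2 (symb r u)" by (simp add: L2_def symb_sq)
  then show ur: "u \<in> sobolev r" using Lu sobolev_iff[of r u] s by simp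
  have "kinetic r u = (LINT \<xi>|lborel. norm \<xi> powr (2 * r) * (cmod (fourier (cplx u) \<xi>))\<^sup>2)"
    using kinetic_fourier(1)[OF _ _ ur] s by simp
  also have "\<dots> \<le> (LINT \<xi>|lborel. r / s * (norm \<xi> powr (2 * s) * (cmod (fourier (cplx u) \<xi>))\<^sup>2) + (1 - r / s) * (cmod (fourier (cplx u) \<xi>))\<^sup>2)"
    using i1 i2 pt by (rule integral_mono)
  also have "\<dots> = r / s * kinetic s u + (1 - r / s) * mass u"
    using ks im by (simp add: mass_fourier[OF Lu])
  finally show "kinetic r u \<le> r / s * kinetic s u + (1 - r / s) * mass u" .
qed

lemma kinetic_pos:
  assumes s: "0 < s" "s \<le> 1" and u: "u \<in> sobolev s" and m: "mass u > 0"
  shows "kinetic s u > 0"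
proof (rule ccontr)
  assume "\<not> kinetic s u > 0"
  then have "kinetic s u = 0" using kinetic_nonneg[of s u] by simp
  then have "sqnorm (symb s u) = 0" using ennreal_kinetic[OF s u] by simp
  then have "AE \<xi> in lborel. symb s u \<xi> = 0"
    using symb_measurable[OF sobolev_L2[OF u]] by (simp add: sqnorm_eq_0)
  \<comment> \<open>The symbol vanishes only at the origin, so the transform itself vanishes almost
    everywhere.\<close>
  moreover have "AE \<xi> in lborel. \<xi> \<noteq> (0::real^2)" by (rule AE_lborel_singleton)
  ultimately have "AE \<xi> in lborel. (cmod (fourier (cplx u) \<xi>))\<^sup>2 = 0"
    by eventually_elim (simp add: symb_def)
  then have "mass u = 0"
    unfolding mass_fourier[OF sobolev_L2[OF u]] by (intro integral_eq_zero_AE)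
  then show False using m by simp
qed

text \<open>Both \<open>u x\<close> and \<open>u (l x)\<close> are compared with the values of \<open>u\<close> on the ball around \<open>x\<close> of radius
  \<open>\<bar>l - 1\<bar> R\<close>; this reduces the estimate to translations.\<close>

lemma dilation_difference_ball:
  assumes s: "0 < s" "s \<le> 1" and u: "u \<in> sobolev s" and R: "R > 0" and l: "1/2 \<le> l" "l \<le> 2"
  shows "(LINT x|lborel. indicator (cball 0 R) x * (u x - u (l *\<^sub>R x))\<^sup>2) \<le> 520 * (\<bar>l - 1\<bar> * R) powr (2 * s) * kinetic s u"
proof (cases "l = 1")
  case True then show ?thesis using kinetic_nonneg[of s u] by simp
next
  case False
  have [measurable]: "u \<in> borel_measurable borel" using sobolev_L2[OF u] by (simp add: L2_cplx_iff)
  define d where "d = \<bar>l - 1\<bar> * R"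
  have d: "d > 0" using False R by (simp add: d_def)
  define K where "K = kinetic s u"
  have K: "K \<ge> 0" by (simp add: K_def kinetic_nonneg)
  define B where "B r = emeasure lborel (cball (0::real^2) r)" for r
  have B2: "B (2 * d) = 4 * B d"
    unfolding B_def using d by (simp add: emeasure_cball ennreal_mult[symmetric] power_mult_distrib mult_ac flip: ennreal_numeral)
  have B0: "B d \<noteq> 0" "B d \<noteq> top"
    unfolding B_def using d by (simp_all add: emeasure_cball unit_ball_vol_2)
  define I where "I = (\<integral>\<^sup>+x. ennreal (indicator (cball 0 R) x * (u x - u (l *\<^sub>R x))\<^sup>2) \<partial>lborel)"
  define T where "T h x = ennreal (2 * (u (h + x) - u x)\<^sup>2)" for h x
  have [measurable]: "case_prod T \<in> borel_measurable (borel \<Otimes>\<^sub>M borel)"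
    unfolding T_def by measurable
  have Tx[measurable]: "(\<lambda>x. T h x) \<in> borel_measurable borel" for h unfolding T_def by measurable
  have iT: "(\<integral>\<^sup>+x. T h x \<partial>lborel) \<le> ennreal (8 * r powr (2 * s) * K)" if "norm h \<le> r" for h r
  proof -
    have "(\<integral>\<^sup>+x. T h x \<partial>lborel) = 2 * (\<integral>\<^sup>+x. ennreal ((u (h + x) - u x)\<^sup>2) \<partial>lborel)"
      unfolding T_def by (simp add: ennreal_mult nn_integral_cmult)
    also have "\<dots> \<le> 2 * ennreal (4 * norm h powr (2 * s) * K)"
      unfolding K_def by (intro mult_left_mono translation_difference[OF s u]) simp
    also have "\<dots> \<le> 2 * ennreal (4 * r powr (2 * s) * K)"
      using that s K by (intro mult_left_mono ennreal_leI mult_right_mono powr_mono2) auto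
    also have "\<dots> = ennreal (8 * r powr (2 * s) * K)"
      using K by (simp add: ennreal_mult[symmetric] flip: ennreal_numeral)
    finally show ?thesis .
  qed
  define J where "J r = (\<integral>\<^sup>+h. indicator (cball (0::real^2) r) h * ennreal (8 * r powr (2 * s) * K) \<partial>lborel)" for r :: real
  have J: "J r = B r * ennreal (8 * r powr (2 * s) * K)" for r
    unfolding J_def B_def by (subst nn_integral_multc) auto
  have pt: "B d * ennreal (indicator (cball 0 R) x * (u x - u (l *\<^sub>R x))\<^sup>2) \<le>
      (\<integral>\<^sup>+h. indicator (cball 0 d) h * T h x \<partial>lborel) + (\<integral>\<^sup>+k. indicator (cball 0 (2 * d)) k * T k (l *\<^sub>R x) \<partial>lborel)" for x
  proof (cases "x \<in> cball 0 R")
    case True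
    have "norm ((l - 1) *\<^sub>R x) \<le> d" using True by (simp add: d_def mult_left_mono)
    have "B d * ennreal (indicator (cball 0 R) x * (u x - u (l *\<^sub>R x))\<^sup>2)
        = (\<integral>\<^sup>+h. indicator (cball (0::real^2) d) h * ennreal ((u x - u (l *\<^sub>R x))\<^sup>2) \<partial>lborel)"
      using True unfolding B_def by (subst nn_integral_multc) auto
    also have "\<dots> \<le> (\<integral>\<^sup>+h. indicator (cball 0 d) h * T h x + indicator (cball 0 d) h * ennreal (2 * (u (h + x) - u (l *\<^sub>R x))\<^sup>2) \<partial>lborel)"
    proof (rule nn_integral_mono)
      fix h
      have "(u x - u (l *\<^sub>R x))\<^sup>2 \<le> 2 * (u (h + x) - u x)\<^sup>2 + 2 * (u (h + x) - u (l *\<^sub>R x))\<^sup>2"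
        using zero_le_power2[of "(u (h + x) - u x) + (u (h + x) - u (l *\<^sub>R x))"]
        by (simp add: power2_eq_square algebra_simps)
      then show "indicator (cball 0 d) h * ennreal ((u x - u (l *\<^sub>R x))\<^sup>2) \<le>
          indicator (cball 0 d) h * T h x + indicator (cball 0 d) h * ennreal (2 * (u (h + x) - u (l *\<^sub>R x))\<^sup>2)"
        by (auto simp: indicator_def T_def ennreal_plus[symmetric] simp del: ennreal_plus intro!: ennreal_leI)
    qed
    also have "\<dots> = (\<integral>\<^sup>+h. indicator (cball 0 d) h * T h x \<partial>lborel) + (\<integral>\<^sup>+h. indicator (cball 0 d) h * ennreal (2 * (u (h + x) - u (l *\<^sub>R x))\<^sup>2) \<partial>lborel)"
      unfolding T_def by (rule nn_integral_add) measurable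
    \<comment> \<open>Substituting h = (l - 1) x + k gives h + x = k + l x, a translate of the
      dilated point. As |(l - 1) x| \<le> d on the ball of radius R, the new variable k ranges
      within radius 2 d.\<close>
    also have "(\<integral>\<^sup>+h. indicator (cball 0 d) h * ennreal (2 * (u (h + x) - u (l *\<^sub>R x))\<^sup>2) \<partial>lborel)
        = (\<integral>\<^sup>+k. indicator (cball 0 d) ((l - 1) *\<^sub>R x + k) * ennreal (2 * (u ((l - 1) *\<^sub>R x + k + x) - u (l *\<^sub>R x))\<^sup>2) \<partial>lborel)"
      by (rule nn_integral_translate[symmetric]) measurable
    also have "\<dots> \<le> (\<integral>\<^sup>+k. indicator (cball 0 (2 * d)) k * T k (l *\<^sub>R x) \<partial>lborel)"
    proof (rule nn_integral_mono)
      fix k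
      have e: "(l - 1) *\<^sub>R x + k + x = k + l *\<^sub>R x" by (simp add: algebra_simps)
      have "norm k \<le> 2 * d" if "norm ((l - 1) *\<^sub>R x + k) \<le> d"
        using norm_triangle_ineq4[of "(l - 1) *\<^sub>R x + k" "(l - 1) *\<^sub>R x"] that \<open>norm ((l - 1) *\<^sub>R x) \<le> d\<close> by simp
      then show "indicator (cball 0 d) ((l - 1) *\<^sub>R x + k) * ennreal (2 * (u ((l - 1) *\<^sub>R x + k + x) - u (l *\<^sub>R x))\<^sup>2)
         \<le> indicator (cball 0 (2 * d)) k * T k (l *\<^sub>R x)"
        unfolding e T_def by (auto simp: indicator_def)
    qed
    finally show ?thesis by (simp add: add_left_mono)
  qed simp
  have sw: "(\<integral>\<^sup>+x. \<integral>\<^sup>+h. indicator (cball 0 r) h * T h x \<partial>lborel \<partial>lborel) \<le> J r" for r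
  proof -
    have "(\<integral>\<^sup>+x. \<integral>\<^sup>+h. indicator (cball 0 r) h * T h x \<partial>lborel \<partial>lborel) = (\<integral>\<^sup>+h. \<integral>\<^sup>+x. indicator (cball 0 r) h * T h x \<partial>lborel \<partial>lborel)"
      by (rule lborel_pair.Fubini') (unfold T_def, measurable)
    also have "\<dots> = (\<integral>\<^sup>+h. indicator (cball 0 r) h * (\<integral>\<^sup>+x. T h x \<partial>lborel) \<partial>lborel)"
      by (simp add: nn_integral_cmult)
    also have "\<dots> \<le> J r" unfolding J_def
      by (intro nn_integral_mono) (auto simp: indicator_def intro: iT)
    finally show ?thesis .
  qed
  have m2: "(\<lambda>x. \<integral>\<^sup>+k. indicator (cball 0 r) k * T k x \<partial>lborel) \<in> borel_measurable borel" for r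
    unfolding T_def by measurable
  \<comment> \<open>The factor 4 bounds 1 / l^2 for l \<ge> 1/2.\<close>
  have sc: "(\<integral>\<^sup>+x. F (l *\<^sub>R x) \<partial>lborel) \<le> 4 * (\<integral>\<^sup>+x. F x \<partial>lborel)" if F: "F \<in> borel_measurable borel" for F :: "real^2 \<Rightarrow> ennreal"
  proof -
    have "4 * (\<integral>\<^sup>+x. F x \<partial>lborel) = ennreal (4 * l\<^sup>2) * (\<integral>\<^sup>+x. F (l *\<^sub>R x) \<partial>lborel)"
      using l by (subst nn_integral_affine[OF F, of l 0]) (auto simp: ennreal_mult mult.assoc)
    moreover have "1 \<le> ennreal (4 * l\<^sup>2)"
      using power_mono[OF l(1), of 2] by (simp add: power2_eq_square)
    ultimately show ?thesis
      using mult_right_mono[of 1 "ennreal (4 * l\<^sup>2)" "\<integral>\<^sup>+x. F (l *\<^sub>R x) \<partial>lborel"] by simp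
  qed
  have "B d * I = (\<integral>\<^sup>+x. B d * ennreal (indicator (cball 0 R) x * (u x - u (l *\<^sub>R x))\<^sup>2) \<partial>lborel)"
    unfolding I_def by (rule nn_integral_cmult[symmetric]) measurable
  also have "\<dots> \<le> (\<integral>\<^sup>+x. (\<integral>\<^sup>+h. indicator (cball 0 d) h * T h x \<partial>lborel) + (\<integral>\<^sup>+k. indicator (cball 0 (2 * d)) k * T k (l *\<^sub>R x) \<partial>lborel) \<partial>lborel)"
    by (rule nn_integral_mono) (rule pt)
  also have "\<dots> = (\<integral>\<^sup>+x. \<integral>\<^sup>+h. indicator (cball 0 d) h * T h x \<partial>lborel \<partial>lborel) + (\<integral>\<^sup>+x. \<integral>\<^sup>+k. indicator (cball 0 (2 * d)) k * T k (l *\<^sub>R x) \<partial>lborel \<partial>lborel)"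
    using m2[of d] measurable_compose[OF _ m2[of "2 * d"], of "\<lambda>x. l *\<^sub>R x" borel] by (intro nn_integral_add) auto
  also have "\<dots> \<le> J d + 4 * J (2 * d)"
    using sw[of d] order_trans[OF sc[OF m2[of "2 * d"]] mult_left_mono[OF sw[of "2 * d"], of 4]] by (intro add_mono) auto
  \<comment> \<open>The first term contributes 8. In the second, 4 comes from the dilation, 4 from
    the area of the doubled ball, 8 from the translation estimate and 4 from (2 d)^(2 s), that is
    512; together 520.\<close>
  also have "\<dots> \<le> B d * ennreal (520 * d powr (2 * s) * K)"
  proof -
    have "(2 * d) powr (2 * s) = 2 powr (2 * s) * d powr (2 * s)" using d by (simp add: powr_mult)
    also have "\<dots> \<le> 2 powr 2 * d powr (2 * s)"
      using s by (intro mult_right_mono powr_mono) auto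
    finally have p: "(2 * d) powr (2 * s) \<le> 4 * d powr (2 * s)" by simp
    have "J d + 4 * J (2 * d) = B d * (ennreal (8 * d powr (2 * s) * K) + 16 * ennreal (8 * (2 * d) powr (2 * s) * K))"
      unfolding J B2 by (simp add: distrib_left mult_ac)
    also have "ennreal (8 * d powr (2 * s) * K) + 16 * ennreal (8 * (2 * d) powr (2 * s) * K) = ennreal (8 * d powr (2 * s) * K + 16 * (8 * (2 * d) powr (2 * s) * K))"
    proof -
      have "16 * ennreal a = ennreal (16 * a)" if "a \<ge> 0" for a using that by (simp add: ennreal_mult)
      then have "16 * ennreal (8 * (2 * d) powr (2 * s) * K) = ennreal (16 * (8 * (2 * d) powr (2 * s) * K))" using K by simp
      then show ?thesis using K by (simp only: ennreal_plus[symmetric]) (subst ennreal_plus[symmetric], simp_all)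
    qed
    also have "\<dots> \<le> ennreal (520 * d powr (2 * s) * K)"
      using mult_right_mono[OF p K] by (intro ennreal_leI) (simp add: mult_ac)
    finally show ?thesis by (simp add: mult_left_mono)
  qed
  finally have "I \<le> ennreal (520 * d powr (2 * s) * K)"
    using B0 by (simp add: ennreal_mult_le_mult_iff)
  moreover have "(LINT x|lborel. indicator (cball 0 R) x * (u x - u (l *\<^sub>R x))\<^sup>2) = enn2real I"
    unfolding I_def by (rule integral_eq_nn_integral) auto
  ultimately show ?thesis
    using K unfolding d_def[symmetric] K_def[symmetric] by (simp add: enn2real_leI)
qed

text \<open>Subtracting C |x - a|^p, which has derivative 0 at a because p > 1, leaves a function
  with a local maximum at a. A bound from above on both sides of a is therefore enough.\<close>

lemma derivative_zero_of_upper_bound: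
  fixes G :: "real \<Rightarrow> real"
  assumes G: "(G has_real_derivative c) (at a)" and 0: "G a = 0" and e: "e > 0" and p: "p > 1"
    and le: "\<And>x. \<bar>x - a\<bar> < e \<Longrightarrow> G x \<le> C * \<bar>x - a\<bar> powr p"
  shows "c = 0"
proof -
  have "((\<lambda>x. \<bar>x - a\<bar> powr p) has_real_derivative 0) (at a)"
  proof -
    have "((\<lambda>h. \<bar>h\<bar> powr (p - 1)) \<longlongrightarrow> 0) (at 0)"
    proof -
      have "((\<lambda>h::real. \<bar>h\<bar> powr (p - 1)) \<longlongrightarrow> \<bar>0\<bar> powr (p - 1)) (at 0)"
        using p by (intro tendsto_powr' tendsto_rabs tendsto_ident_at tendsto_const) auto
      then show ?thesis using p by simp
    qed
    then have "((\<lambda>h. \<bar>h\<bar> powr p / h) \<longlongrightarrow> 0) (at 0)"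
    proof (rule Lim_null_comparison[rotated])
      show "\<forall>\<^sub>F h in at 0. norm (\<bar>h\<bar> powr p / h) \<le> \<bar>h\<bar> powr (p - 1)"
        by (auto simp: eventually_at_filter powr_diff)
    qed
    then show ?thesis unfolding DERIV_def by simp
  qed
  then have "((\<lambda>x. C * \<bar>x - a\<bar> powr p) has_real_derivative C * 0) (at a)" by (rule DERIV_cmult)
  then have D: "((\<lambda>x. G x - C * \<bar>x - a\<bar> powr p) has_real_derivative c - C * 0) (at a)"
    by (rule DERIV_diff[OF G])
  have "c - C * 0 = 0"
    by (rule DERIV_local_max[OF D e]) (use le 0 p in \<open>auto simp: abs_minus_commute\<close>)
  then show ?thesis by simp
qed

section \<open>Pohozaev's identity\<close>

lemma integrable_of_quartic:
  fixes f g h :: "real^2 \<Rightarrow> real"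
  assumes [measurable]: "h \<in> borel_measurable borel"
    and "integrable lborel (\<lambda>x. \<bar>f x\<bar>^4)" "integrable lborel (\<lambda>x. \<bar>g x\<bar>^4)"
    and "\<And>x. \<bar>h x\<bar> \<le> c * (\<bar>f x\<bar>^4 + \<bar>g x\<bar>^4)"
  shows "integrable lborel h"
proof (rule Bochner_Integration.integrable_bound)
  show "integrable lborel (\<lambda>x. c * (\<bar>f x\<bar>^4 + \<bar>g x\<bar>^4))" using assms by simp
  show "AE x in lborel. norm (h x) \<le> norm (c * (\<bar>f x\<bar>^4 + \<bar>g x\<bar>^4))"
    using assms(4) by (intro AE_I2) (smt (verit) real_norm_def)
qed simp

text \<open>The real part of the weak formulation with both pairings polarised, so that testing
  needs only the kinetic energies and masses of u, v and u - v.\<close>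

lemma solution_test:
  assumes s: "0 < s" "s \<le> 1" and u: "solution s u" and v: "v \<in> sobolev s"
  shows "(kinetic s u + kinetic s v - kinetic s (\<lambda>x. u x - v x)) + (mass u + mass v - mass (\<lambda>x. u x - v x))
     = 2 * (LINT x|lborel. u x ^ 3 * v x)"
proof -
  have us: "u \<in> sobolev s" using u by (simp add: solution_def)
  have "(LINT x|lborel. frac_laplacian (s/2) u x * cnj (frac_laplacian (s/2) v x))
          + complex_of_real (LINT x|lborel. u x * v x)
        = complex_of_real (LINT x|lborel. \<bar>u x\<bar>\<^sup>2 * u x * v x)"
    using u v unfolding solution_def by blast
  from arg_cong[OF this, of Re]
  have "Re (LINT x|lborel. frac_laplacian (s/2) u x * cnj (frac_laplacian (s/2) v x))
          + (LINT x|lborel. u x * v x) = (LINT x|lborel. \<bar>u x\<bar>\<^sup>2 * u x * v x)"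
    by (simp only: plus_complex.sel Re_complex_of_real)
  moreover have "(LINT x|lborel. \<bar>u x\<bar>\<^sup>2 * u x * v x) = (LINT x|lborel. u x ^ 3 * v x)"
    by (simp add: power3_eq_cube power2_eq_square)
  ultimately show ?thesis
    using kinetic_polar[OF s us v] mass_polar[OF sobolev_L2[OF us] sobolev_L2[OF v]] by linarith
qed

lemma solution_Nehari:
  assumes s: "0 < s" "s \<le> 1" and u: "solution s u"
  shows "quartic u = kinetic s u + mass u"
proof -
  have us: "u \<in> sobolev s" using u by (simp add: solution_def)
  \<comment> \<open>The zero function is the dilation with amplitude 0.\<close>
  have "kinetic s (\<lambda>x. u x - u x) = 0"
    using sobolev_scale(2)[OF s us, of 1 0] by simp
  moreover have "mass (\<lambda>x. u x - u x) = 0" by (simp add: mass_def)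
  moreover have "(LINT x|lborel. u x ^ 3 * u x) = quartic u"
  proof -
    have "\<bar>a\<bar>^4 = a ^ 3 * a" for a :: real
      using power_Suc2[of a 3] by simp
    then show ?thesis by (simp only: quartic_def)
  qed
  ultimately show ?thesis using solution_test[OF s u us] by linarith
qed

text \<open>On \<open>D\<close> the coefficient f is bounded and only the local L^2 norm of w
  enters. Off \<open>D\<close>, Young's inequality with parameter t trades the fourth power of f,
  small there for a large \<open>D\<close>, against that of w.\<close>

lemma absorption_estimate:
  fixes f w :: "real^2 \<Rightarrow> real"
  assumes [measurable]: "f \<in> borel_measurable borel" "w \<in> borel_measurable borel" "D \<in> sets borel"
    and f4: "integrable lborel (\<lambda>x. \<bar>f x\<bar>^4)" and w4: "integrable lborel (\<lambda>x. \<bar>w x\<bar>^4)"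
    and w2: "integrable lborel (\<lambda>x. (w x)\<^sup>2)"
    and D: "\<And>x. x \<in> D \<Longrightarrow> x \<in> cball 0 R \<and> \<bar>f x\<bar> \<le> n" and t: "t > 0"
  shows "(LINT x|lborel. (f x)\<^sup>2 * (w x)\<^sup>2) \<le> n\<^sup>2 * (LINT x|lborel. indicator (cball 0 R) x * (w x)\<^sup>2)
     + (t * (LINT x|lborel. indicator (- D) x * \<bar>f x\<bar>^4) + (LINT x|lborel. \<bar>w x\<bar>^4) / t) / 2"
proof -
  have i1: "integrable lborel (\<lambda>x. indicator (cball 0 R) x * (w x)\<^sup>2)"
    by (rule Bochner_Integration.integrable_bound[OF w2]) (auto simp: indicator_def)
  have i2: "integrable lborel (\<lambda>x. indicator (- D) x * \<bar>f x\<bar>^4)"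
    by (rule Bochner_Integration.integrable_bound[OF f4]) (auto simp: indicator_def)
  have pt: "(f x)\<^sup>2 * (w x)\<^sup>2 \<le> n\<^sup>2 * (indicator (cball 0 R) x * (w x)\<^sup>2) + (t * (indicator (- D) x * \<bar>f x\<bar>^4) + \<bar>w x\<bar>^4 / t) / 2" for x
  proof (cases "x \<in> D")
    case True
    then have "(f x)\<^sup>2 \<le> n\<^sup>2" using D[of x] by (intro abs_le_square_iff[THEN iffD1]) auto
    then have "(f x)\<^sup>2 * (w x)\<^sup>2 \<le> n\<^sup>2 * (w x)\<^sup>2" by (rule mult_right_mono) simp
    moreover have "\<bar>w x\<bar>^4 / t / 2 \<ge> 0" using t by simp
    ultimately show ?thesis using True D[of x] by simp
  next
    case False
    have "0 \<le> (t * (f x)\<^sup>2 - (w x)\<^sup>2)\<^sup>2 / t" using t by simp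
    also have "\<dots> = t * (f x)^4 + (w x)^4 / t - 2 * ((f x)\<^sup>2 * (w x)\<^sup>2)"
      using t by (simp add: field_simps power2_eq_square power4_eq_xxxx)
    finally have "(f x)\<^sup>2 * (w x)\<^sup>2 \<le> (t * \<bar>f x\<bar>^4 + \<bar>w x\<bar>^4 / t) / 2" by simp
    also have "\<dots> \<le> n\<^sup>2 * (indicator (cball 0 R) x * (w x)\<^sup>2) + (t * \<bar>f x\<bar>^4 + \<bar>w x\<bar>^4 / t) / 2"
      by (simp only: le_add_same_cancel2) simp
    finally show ?thesis using False by simp
  qed
  then have "(LINT x|lborel. (f x)\<^sup>2 * (w x)\<^sup>2) \<le>
     (LINT x|lborel. n\<^sup>2 * (indicator (cball 0 R) x * (w x)\<^sup>2) + (t * (indicator (- D) x * \<bar>f x\<bar>^4) + \<bar>w x\<bar>^4 / t) / 2)"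
  proof (intro integral_mono' Bochner_Integration.integrable_add integrable_mult_right integrable_divide i1 i2 w4)
    show "0 \<le> n\<^sup>2 * (indicator (cball 0 R) x * (w x)\<^sup>2) + (t * (indicator (- D) x * \<bar>f x\<bar>^4) + \<bar>w x\<bar>^4 / t) / 2" for x
      by (rule order_trans[OF _ pt]) simp
  qed
  also have "\<dots> = n\<^sup>2 * (LINT x|lborel. indicator (cball 0 R) x * (w x)\<^sup>2)
     + (t * (LINT x|lborel. indicator (- D) x * \<bar>f x\<bar>^4) + (LINT x|lborel. \<bar>w x\<bar>^4) / t) / 2"
    using i1 i2 w4 by simp
  finally show ?thesis .
qed

lemma Pohozaev_identity:
  assumes s: "1/2 < s" "s \<le> 1" and u: "solution s u"
    and GN: "C \<ge> 0" "\<And>v. v \<in> sobolev s \<Longrightarrow> integrable lborel (\<lambda>x. \<bar>v x\<bar>^4)"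
       "\<And>v. v \<in> sobolev s \<Longrightarrow> quartic v \<le> C * (kinetic s v + mass v)\<^sup>2"
  shows "(2 * s - 1) * kinetic s u = mass u"
proof -
  have s0: "0 < s" using s by simp
  have us: "u \<in> sobolev s" using u by (simp add: solution_def)
  have [measurable]: "u \<in> borel_measurable borel" using sobolev_L2[OF us] by (simp add: L2_cplx_iff)
  define K M P where "K = kinetic s u" and "M = mass u" and "P = quartic u"
  have K0: "K \<ge> 0" by (simp add: K_def kinetic_nonneg)
  have PKM: "P = K + M" unfolding P_def K_def M_def by (rule solution_Nehari[OF s0 s(2) u])
  have u4: "integrable lborel (\<lambda>x. \<bar>u x\<bar>^4)" by (rule GN(2)[OF us])
  \<comment> \<open>With the action S(v) = (kinetic s v + mass v) / 2 - quartic v / 4,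
    \<open>G l\<close> is S(u) minus S of the dilation u(l x), written out by the scaling
    laws.\<close>
  define G where "G l = K / 2 * (1 - l powr (2 * s - 2)) + (M / 2 - P / 4) * (1 - 1 / l\<^sup>2)" for l :: real
  define D where "D n = {x. norm x \<le> real n \<and> \<bar>u x\<bar> \<le> real n}" for n :: nat
  have [measurable]: "D n \<in> sets borel" for n unfolding D_def by measurable
  define eta where "eta n = (LINT x|lborel. indicator (- D n) x * \<bar>u x\<bar>^4)" for n
  have "(\<lambda>n. eta n) \<longlonglongrightarrow> (LINT x|lborel. 0 * \<bar>u x\<bar>^4)"
    unfolding eta_def
  proof (rule integral_dominated_convergence[where w="\<lambda>x. \<bar>u x\<bar>^4"])
    show "AE x in lborel. (\<lambda>n. indicator (- D n) x * \<bar>u x\<bar>^4) \<longlonglongrightarrow> 0 * \<bar>u x\<bar>^4"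
    proof (intro AE_I2 tendsto_eventually)
      fix x :: "real^2"
      obtain n0 where "max (norm x) \<bar>u x\<bar> \<le> real n0" using real_arch_simple by blast
      then have "\<forall>n\<ge>n0. x \<in> D n" by (auto simp: D_def)
      then show "\<forall>\<^sub>F n in sequentially. indicator (- D n) x * \<bar>u x\<bar>^4 = 0 * \<bar>u x\<bar>^4"
        by (auto simp: eventually_sequentially intro!: exI[of _ n0])
    qed
  qed (use u4 in \<open>auto simp: indicator_def\<close>)
  then have eta0: "eta \<longlonglongrightarrow> 0" by simp
  \<comment> \<open>Chosen so that C / p \<le> 1/3. With \<open>eta n\<close> below 1 / (6 p), the
    error terms below sum to exactly 2 Y, the amount that the quadratic part -2 X can pay
    for.\<close>
  define p where "p = 3 * C + 1"
  have p: "p > 0" using GN(1) by (simp add: p_def)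
  obtain n where n: "eta n < 1 / (6 * p)"
    using order_tendstoD(2)[OF eta0, of "1 / (6 * p)"] p by (auto simp: eventually_sequentially)
  \<comment> \<open>If l > 1/2 and |l x| \<le> n, then |x| \<le> 2 n, so one ball serves both u and
    its dilations; the added 1 keeps the radius positive.\<close>
  define R where "R = 2 * real n + 1"
  have R: "R > 0" by (simp add: R_def)
  define C' where "C' = 3 / 2 * (real n)\<^sup>2 * (520 * R powr (2 * s) * K) + 1/2"
  have main: "G l \<le> C' * \<bar>l - 1\<bar> powr (2 * s)" if l: "1/2 < l" "l < 2" "l \<noteq> 1" for l
  proof -
    have l0: "l > 0" using l by simp
    define v where "v = (\<lambda>x. u (l *\<^sub>R x))"
    define w where "w = (\<lambda>x. u x - v x)"
    have vs: "v \<in> sobolev s" and Kv: "kinetic s v = l powr (2 * s - 2) * K"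
      using sobolev_scale[OF s0 s(2) us l0, of 1] by (simp_all add: v_def K_def)
    have Mv: "mass v = M / l\<^sup>2" and Pv: "quartic v = P / l\<^sup>2"
      using mass_scale[OF l0, of 1 u] quartic_scale[OF l0, of 1 u] by (simp_all add: v_def M_def P_def)
    have ws: "w \<in> sobolev s" unfolding w_def by (rule sobolev_diff(1)[OF s0 s(2) us vs])
    have [measurable]: "v \<in> borel_measurable borel" "w \<in> borel_measurable borel"
      using sobolev_L2[OF vs] sobolev_L2[OF ws] by (simp_all add: L2_cplx_iff)
    have v4: "integrable lborel (\<lambda>x. \<bar>v x\<bar>^4)" and w4: "integrable lborel (\<lambda>x. \<bar>w x\<bar>^4)"
      using GN(2) vs ws by auto
    have w2: "integrable lborel (\<lambda>x. (w x)\<^sup>2)" using sobolev_L2[OF ws] by (simp add: L2_cplx_iff)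
    define X where "X = kinetic s w + mass w"
    have X0: "X \<ge> 0" by (simp add: X_def kinetic_nonneg mass_nonneg)
    define h where "h = (LINT x|lborel. u x ^ 3 * v x)"
    have h: "K + l powr (2 * s - 2) * K + M + M / l\<^sup>2 - X = 2 * h"
      using solution_test[OF s0 s(2) u vs] Kv Mv by (simp add: h_def X_def w_def K_def M_def)
    \<comment> \<open>The Taylor remainder v^4 - u^4 - 4 u^3 (v - u), which equals w^2 (v^2 + 2 u v
      + 3 u^2). The bound 4 u^2 w^2 + 2 v^2 w^2 used below exceeds it by w^4.\<close>
    define r where "r x = v x ^ 4 + 3 * u x ^ 4 - 4 * (u x ^ 3 * v x)" for x
    have y4: "\<bar>a ^ 3 * b\<bar> \<le> 1 * (\<bar>a\<bar>^4 + \<bar>b\<bar>^4)" for a b :: real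
    proof -
      have "\<bar>a\<bar>^3 * \<bar>b\<bar> \<le> max \<bar>a\<bar> \<bar>b\<bar> ^ 3 * max \<bar>a\<bar> \<bar>b\<bar>"
        by (intro mult_mono power_mono) auto
      also have "\<dots> = max \<bar>a\<bar> \<bar>b\<bar> ^ 4" by (simp add: power3_eq_cube power4_eq_xxxx)
      also have "\<dots> \<le> \<bar>a\<bar>^4 + \<bar>b\<bar>^4" by (simp add: max_def)
      finally show ?thesis by (simp add: abs_mult power_abs)
    qed
    have y2: "\<bar>a\<^sup>2 * b\<^sup>2\<bar> \<le> 1 * (\<bar>a\<bar>^4 + \<bar>b\<bar>^4)" for a b :: real
    proof -
      have "2 * a\<^sup>2 * b\<^sup>2 \<le> (a\<^sup>2)\<^sup>2 + (b\<^sup>2)\<^sup>2" by (rule sum_squares_bound)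
      moreover have "0 \<le> a\<^sup>2 * b\<^sup>2" by simp
      ultimately have "a\<^sup>2 * b\<^sup>2 \<le> (a\<^sup>2)\<^sup>2 + (b\<^sup>2)\<^sup>2" by linarith
      then show ?thesis by simp
    qed
    have i3: "integrable lborel (\<lambda>x. u x ^ 3 * v x)"
      by (rule integrable_of_quartic[OF _ u4 v4 y4]) measurable
    have iuw: "integrable lborel (\<lambda>x. (u x)\<^sup>2 * (w x)\<^sup>2)"
      by (rule integrable_of_quartic[OF _ u4 w4 y2]) measurable
    have ivw: "integrable lborel (\<lambda>x. (v x)\<^sup>2 * (w x)\<^sup>2)"
      by (rule integrable_of_quartic[OF _ v4 w4 y2]) measurable
    have r: "(LINT x|lborel. r x) = P / l\<^sup>2 + 3 * P - 4 * h"
    proof -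
      have "(LINT x|lborel. v x ^ 4) = P / l\<^sup>2" "(LINT x|lborel. u x ^ 4) = P"
        using Pv by (simp_all add: quartic_def P_def)
      then show ?thesis using u4 v4 i3 unfolding r_def h_def by simp
    qed
    have ir: "integrable lborel r" using u4 v4 i3 unfolding r_def by simp
    have "(LINT x|lborel. r x) \<le> (LINT x|lborel. 4 * ((u x)\<^sup>2 * (w x)\<^sup>2) + 2 * ((v x)\<^sup>2 * (w x)\<^sup>2))"
    proof (rule integral_mono[OF ir])
      fix x
      have "4 * ((u x)\<^sup>2 * (w x)\<^sup>2) + 2 * ((v x)\<^sup>2 * (w x)\<^sup>2) - r x = (w x)\<^sup>2 * (u x - v x)\<^sup>2"
        unfolding r_def w_def by (simp add: power2_eq_square power3_eq_cube power4_eq_xxxx algebra_simps)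
      moreover have "0 \<le> (w x)\<^sup>2 * (u x - v x)\<^sup>2" by simp
      ultimately show "r x \<le> 4 * ((u x)\<^sup>2 * (w x)\<^sup>2) + 2 * ((v x)\<^sup>2 * (w x)\<^sup>2)" by linarith
    qed (use iuw ivw in simp)
    also have "\<dots> = 4 * (LINT x|lborel. (u x)\<^sup>2 * (w x)\<^sup>2) + 2 * (LINT x|lborel. (v x)\<^sup>2 * (w x)\<^sup>2)"
      using iuw ivw by simp
    finally have rle: "(LINT x|lborel. r x) \<le> 4 * (LINT x|lborel. (u x)\<^sup>2 * (w x)\<^sup>2) + 2 * (LINT x|lborel. (v x)\<^sup>2 * (w x)\<^sup>2)" .
    define d where "d = \<bar>l - 1\<bar> powr (2 * s)"
    have d: "d > 0" using l by (simp add: d_def)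
    \<comment> \<open>\<open>X\<close> may vanish, but the absorption needs a positive scale.\<close>
    define Y where "Y = X + d"
    have Y: "Y > 0" using X0 d by (simp add: Y_def)
    define J where "J = (LINT x|lborel. indicator (cball 0 R) x * (w x)\<^sup>2)"
    have J: "J \<le> 520 * R powr (2 * s) * K * d"
    proof -
      have "J \<le> 520 * (\<bar>l - 1\<bar> * R) powr (2 * s) * K"
        unfolding J_def w_def v_def K_def by (rule dilation_difference_ball[OF s0 s(2) us R]) (use l in auto)
      then show ?thesis using R by (simp add: powr_mult d_def mult_ac)
    qed
    have wY: "(LINT x|lborel. \<bar>w x\<bar>^4) / (p * Y) \<le> C / p * Y"
    proof -
      have "(LINT x|lborel. \<bar>w x\<bar>^4) \<le> C * X\<^sup>2" using GN(3)[OF ws] by (simp add: quartic_def X_def)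
      also have "\<dots> \<le> C * Y\<^sup>2" using GN(1) X0 d by (intro mult_left_mono power_mono) (auto simp: Y_def)
      finally show ?thesis using p Y by (simp add: field_simps power2_eq_square)
    qed
    have bu: "(LINT x|lborel. (u x)\<^sup>2 * (w x)\<^sup>2) \<le> (real n)\<^sup>2 * J + (p * Y * eta n + (LINT x|lborel. \<bar>w x\<bar>^4) / (p * Y)) / 2"
      unfolding J_def eta_def
      by (rule absorption_estimate[OF _ _ _ u4 w4 w2]) (use p Y in \<open>auto simp: D_def R_def\<close>)
    have bv: "(LINT x|lborel. (v x)\<^sup>2 * (w x)\<^sup>2) \<le> (real n)\<^sup>2 * J + (p * Y * (eta n / l\<^sup>2) + (LINT x|lborel. \<bar>w x\<bar>^4) / (p * Y)) / 2"
    proof -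
      \<comment> \<open>For the dilated function the good set is the preimage of \<open>D n\<close>;
        the quartic integral off it is \<open>eta n\<close> divided by l^2.\<close>
      define E where "E = {x. l *\<^sub>R x \<in> D n}"
      have [measurable]: "E \<in> sets borel" unfolding E_def by measurable
      have "eta n = l\<^sup>2 * (LINT x|lborel. indicator (- D n) (l *\<^sub>R x) * \<bar>u (l *\<^sub>R x)\<bar>^4)"
        unfolding eta_def using integral_affine[of l "\<lambda>x. indicator (- D n) x * \<bar>u x\<bar>^4" 0] l0 by simp
      moreover have "(\<lambda>x. indicator (- D n) (l *\<^sub>R x) * \<bar>u (l *\<^sub>R x)\<bar>^4) = (\<lambda>x. indicator (- E) x * \<bar>v x\<bar>^4)"
        by (auto simp: E_def v_def indicator_def)
      ultimately have e: "eta n / l\<^sup>2 = (LINT x|lborel. indicator (- E) x * \<bar>v x\<bar>^4)" using l0 by simp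
      have E: "x \<in> cball 0 R \<and> \<bar>v x\<bar> \<le> real n" if "x \<in> E" for x
      proof -
        have "l * norm x \<le> real n" "\<bar>v x\<bar> \<le> real n" using that l0 by (auto simp: E_def D_def v_def)
        moreover have "1/2 * norm x \<le> l * norm x" using l by (intro mult_right_mono) auto
        ultimately show ?thesis by (simp add: R_def)
      qed
      show ?thesis unfolding J_def e
        by (rule absorption_estimate[OF _ _ _ v4 w4 w2 E]) (use p Y in auto)
    qed
    have eta_nn: "eta n \<ge> 0" unfolding eta_def by simp
    have el: "eta n / l\<^sup>2 \<le> 4 * eta n"
    proof -
      have "(1/2)\<^sup>2 \<le> l\<^sup>2" using l by (intro power_mono) auto
      then have "1 \<le> 4 * l\<^sup>2" by (simp add: power2_eq_square)
      then have "eta n * 1 \<le> eta n * (4 * l\<^sup>2)" using eta_nn by (intro mult_left_mono)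
      then show ?thesis using l0 by (simp add: field_simps)
    qed
    have pe: "p * Y * eta n \<le> Y / 6"
    proof -
      have "p * eta n \<le> 1 / 6" using n p by (simp add: field_simps)
      then have "Y * (p * eta n) \<le> Y * (1/6)" using Y by (intro mult_left_mono) auto
      then show ?thesis by (simp add: mult_ac)
    qed
    have Cp: "C / p * Y \<le> Y / 3"
    proof -
      have "C / p \<le> 1 / 3" using p GN(1) by (simp add: p_def field_simps)
      then have "C / p * Y \<le> 1 / 3 * Y" using Y by (intro mult_right_mono) auto
      then show ?thesis by simp
    qed
    have pe4: "p * Y * (eta n / l\<^sup>2) \<le> 4 * (p * Y * eta n)"
      using mult_left_mono[OF el, of "p * Y"] p Y by (simp add: mult_ac)
    \<comment> \<open>The equation tested with v and Nehari's identity remove all terms linear in w: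
      the change of the action is the quartic remainder minus the quadratic energy of w.\<close>
    have "4 * G l = (LINT x|lborel. r x) - 2 * X"
    proof -
      define i where "i = 1 / l\<^sup>2"
      define k where "k = l powr (2 * s - 2)"
      have "K + k * K + M + M * i - X = 2 * h" using h by (simp add: i_def k_def)
      moreover have "(LINT x|lborel. r x) = (K + M) * i + 3 * (K + M) - 4 * h" unfolding r PKM by (simp add: i_def)
      moreover have "G l = K / 2 * (1 - k) + (M / 2 - (K + M) / 4) * (1 - i)" unfolding G_def PKM by (simp add: i_def k_def)
      ultimately show ?thesis by (simp add: field_simps)
    qed
    also have "\<dots> \<le> 6 * (real n)\<^sup>2 * J + 2 * Y - 2 * X"
    proof -
      define j a b W c where "j = (real n)\<^sup>2 * J" and "a = p * Y * eta n" and "b = p * Y * (eta n / l\<^sup>2)"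
        and "W = (LINT x|lborel. \<bar>w x\<bar>^4) / (p * Y)" and "c = C / p * Y"
      have "(LINT x|lborel. (u x)\<^sup>2 * (w x)\<^sup>2) \<le> j + (a + W) / 2" "(LINT x|lborel. (v x)\<^sup>2 * (w x)\<^sup>2) \<le> j + (b + W) / 2"
        using bu bv by (simp_all only: j_def a_def b_def W_def)
      \<comment> \<open>The right-hand side is 6 j + 2 a + b + 3 W, at most 6 j + 6 a + 3 W; the
        bounds Y/6 for a and Y/3 for W make the last two terms at most 2 Y. Since Y = X + d,
        subtracting 2 X leaves only 2 d.\<close>
      then have "(LINT x|lborel. r x) \<le> 4 * (j + (a + W) / 2) + 2 * (j + (b + W) / 2)"
        by (intro order_trans[OF rle add_mono[OF mult_left_mono mult_left_mono]]) auto
      moreover have "a \<le> Y / 6" "b \<le> 4 * a" "W \<le> c" "c \<le> Y / 3"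
        using pe pe4 wY Cp unfolding a_def b_def W_def c_def by auto
      ultimately have "(LINT x|lborel. r x) \<le> 6 * j + 2 * Y" by argo
      then show ?thesis by (simp add: j_def mult.assoc)
    qed
    also have "\<dots> \<le> 6 * (real n)\<^sup>2 * (520 * R powr (2 * s) * K * d) + 2 * d"
      using mult_left_mono[OF J, of "6 * (real n)\<^sup>2"] by (simp add: Y_def)
    also have "\<dots> = 4 * (C' * d)" by (simp add: C'_def algebra_simps)
    finally show ?thesis by (simp add: d_def)
  qed
  have "(G has_real_derivative (K / 2 * (0 - (2 * s - 2)) + (M / 2 - P / 4) * 2)) (at 1)"
    unfolding G_def by (auto intro!: derivative_eq_intros simp: power2_eq_square)
  then have "K / 2 * (0 - (2 * s - 2)) + (M / 2 - P / 4) * 2 = 0"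
  proof (rule derivative_zero_of_upper_bound[where e="1/2" and p="2 * s" and C=C'])
    show "G 1 = 0" by (simp add: G_def)
    fix x :: real assume "\<bar>x - 1\<bar> < 1/2"
    then show "G x \<le> C' * \<bar>x - 1\<bar> powr (2 * s)"
      using main[of x] by (cases "x = 1") (auto simp: G_def abs_if split: if_splits)
  qed (use s in auto)
  then show ?thesis unfolding PKM K_def M_def by (simp add: field_simps)
qed

section \<open>Nonexistence of local minimizers\<close>

lemma mass_pos_of_nonzero:
  assumes "L2 (cplx u)" "\<not> (AE x in lborel. u x = 0)"
  shows "mass u > 0"
proof (rule ccontr)
  assume "\<not> mass u > 0"
  then have "mass u = 0" using mass_nonneg[of u] by linarith
  then have "(LINT x|lborel. (u x)\<^sup>2) = 0" by (simp add: mass_eq)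
  then have "AE x in lborel. (u x)\<^sup>2 = 0"
    using assms(1) by (subst (asm) integral_nonneg_eq_0_iff_AE) (auto simp: L2_cplx_iff)
  then show False using assms(2) by simp
qed

lemma ae_positive_nonzero:
  assumes "ae_positive u" shows "\<not> (AE x in lborel. u x = 0)"
proof
  assume "AE x in lborel. u x = 0"
  with assms have "AE x in (lborel :: (real^2) measure). False"
    unfolding ae_positive_def by eventually_elim simp
  then show False by (simp add: AE_iff_null null_sets_def)
qed

lemma quartic_pos_weinstein:
  assumes "weinstein s v > 0" shows "quartic v > 0"
  using assms quartic_nonneg[of v] unfolding weinstein_def by (cases "quartic v = 0") auto

lemma Gagliardo_Nirenberg:
  assumes r2: "1/2 \<le> r" and r': "r \<le> s" "s \<le> 1" and q: "positive_ground_state r q"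
  shows "\<exists>C\<ge>0. \<forall>v\<in>sobolev s. integrable lborel (\<lambda>x. \<bar>v x\<bar>^4) \<and> quartic v \<le> C * (kinetic s v + mass v)\<^sup>2"
proof -
  have r: "0 < r" "r \<le> s" "s \<le> 1" and r1: "r \<le> 1" using r2 r' by auto
  have sol: "solution r q" and qpos: "ae_positive q"
    and min: "\<And>v. v \<in> sobolev r \<Longrightarrow> \<not> (AE x in lborel. v x = 0) \<Longrightarrow> weinstein r q \<le> weinstein r v"
    using q by (auto simp: positive_ground_state_def)
  have qs: "q \<in> sobolev r" using sol by (simp add: solution_def)
  have M: "mass q > 0" by (rule mass_pos_of_nonzero[OF sobolev_L2[OF qs] ae_positive_nonzero[OF qpos]])
  have K: "kinetic r q > 0" by (rule kinetic_pos[OF r(1) r1 qs M])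
  have P: "quartic q > 0" using solution_Nehari[OF r(1) r1 sol] K M by simp
  define W where "W = weinstein r q"
  have W: "W > 0" unfolding W_def weinstein_def using K M P by simp
  show ?thesis
  proof (intro exI[of _ "1 / W"] conjI ballI)
    show "0 \<le> 1 / W" using W by simp
    fix v assume v: "v \<in> sobolev s"
    have vr: "v \<in> sobolev r" by (rule sobolev_antimono(1)[OF r v])
    have [measurable]: "v \<in> borel_measurable borel" using sobolev_L2[OF v] by (simp add: L2_cplx_iff)
    have "integrable lborel (\<lambda>x. \<bar>v x\<bar>^4) \<and> quartic v \<le> 1 / W * (kinetic s v + mass v)\<^sup>2"
    proof (cases "AE x in lborel. v x = 0")
      case True
      then have e: "AE x in lborel. \<bar>v x\<bar>^4 = 0" by eventually_elim simp
      have "integrable lborel (\<lambda>x. \<bar>v x\<bar>^4)"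
        using e by (subst integrable_cong_AE[where g="\<lambda>_. 0"]) auto
      moreover have "quartic v = 0" unfolding quartic_def using e by (rule integral_eq_zero_AE)
      ultimately show ?thesis using W by simp
    next
      case False
      have Wv: "W \<le> weinstein r v" unfolding W_def by (rule min[OF vr False])
      then have Pv: "quartic v > 0" using W by (intro quartic_pos_weinstein[of r]) simp
      then have i: "integrable lborel (\<lambda>x. \<bar>v x\<bar>^4)"
        unfolding quartic_def using not_integrable_integral_eq by fastforce
      define X where "X = kinetic s v + mass v"
      have Mv: "mass v > 0" by (rule mass_pos_of_nonzero[OF sobolev_L2[OF v] False])
      have X: "X > 0" using Mv kinetic_nonneg[of s v] by (simp add: X_def)
      have rs: "0 \<le> r / s" "r / s \<le> 1" using r by auto
      have Kr: "kinetic r v \<le> X"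
      proof -
        have "kinetic r v \<le> r / s * kinetic s v + (1 - r / s) * mass v" by (rule sobolev_antimono(2)[OF r v])
        also have "\<dots> \<le> 1 * kinetic s v + 1 * mass v"
          using rs kinetic_nonneg[of s v] mass_nonneg[of v] by (intro add_mono mult_right_mono) auto
        finally show ?thesis by (simp add: X_def)
      qed
      have MX: "mass v \<le> X" by (simp add: X_def kinetic_nonneg)
      have pos2: "kinetic r v powr (1 / r) * mass v powr (2 - 1 / r) \<le> X\<^sup>2"
      proof -
        have "kinetic r v powr (1 / r) * mass v powr (2 - 1 / r) \<le> X powr (1 / r) * X powr (2 - 1 / r)"
          using Kr MX r r2 kinetic_nonneg[of r v] mass_nonneg[of v]
          by (intro mult_mono powr_mono2) (auto simp: field_simps)
        also have "\<dots> = X powr 2" by (simp add: powr_add[symmetric])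
        finally show ?thesis using X by simp
      qed
      have "W * quartic v \<le> kinetic r v powr (1 / r) * mass v powr (2 - 1 / r)"
        using Wv Pv unfolding weinstein_def by (simp add: field_simps)
      also note pos2
      finally have "quartic v \<le> 1 / W * X\<^sup>2" using W by (simp add: field_simps)
      then show ?thesis using i by (simp add: X_def)
    qed
    then show "integrable lborel (\<lambda>x. \<bar>v x\<bar>^4)" "quartic v \<le> 1 / W * (kinetic s v + mass v)\<^sup>2" by auto
  qed
qed

lemma energy_eq:
  assumes s: "0 < s" "s \<le> 1" and u: "u \<in> H_space s"
  shows "energy s u = 1/2 * (kinetic s u + (LINT x|lborel. (norm x)\<^sup>2 * \<bar>u x\<bar>\<^sup>2)) - 1/4 * quartic u"
proof -
  have us: "u \<in> sobolev s" and V: "integrable lborel (\<lambda>x. (norm x)\<^sup>2 * \<bar>u x\<bar>\<^sup>2)"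
    using u by (auto simp: H_space_def)
  have "integrable lborel (\<lambda>x. (cmod (frac_laplacian (s/2) u x))\<^sup>2)"
    using frac_laplacian_L2(1)[OF s us] by (simp add: L2_def)
  then show ?thesis
    using V unfolding energy_def kinetic_def quartic_def by (subst Bochner_Integration.integral_add) auto
qed

lemma uncertainty:
  assumes s: "0 < s" "s \<le> 1" and u: "u \<in> H_space s"
  shows "mass u \<le> 2 * (2 * (LINT x|lborel. (norm x)\<^sup>2 * \<bar>u x\<bar>\<^sup>2) + kinetic s u)"
proof (cases "mass u = 0")
  case True then show ?thesis by (simp add: kinetic_nonneg)
next
  case False
  define N where "N = mass u"
  have N: "N > 0" using False mass_nonneg[of u] by (simp add: N_def)
  have us: "u \<in> sobolev s" and iV: "integrable lborel (\<lambda>x. (norm x)\<^sup>2 * \<bar>u x\<bar>\<^sup>2)"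
    using u by (auto simp: H_space_def)
  define V where "V = (LINT x|lborel. (norm x)\<^sup>2 * \<bar>u x\<bar>\<^sup>2)"
  have L: "L2 (cplx u)" using us by (rule sobolev_L2)
  have [measurable]: "u \<in> borel_measurable borel" and iu: "integrable lborel (\<lambda>x. (u x)\<^sup>2)" using L by (auto simp: L2_cplx_iff)
  note [measurable] = fourier_cplx_measurable[OF L]
  define f where "f = cut 1 (cplx u)"
  have f: "integrable lborel f" "L2 f" unfolding f_def by (rule integrable_cut[OF L], rule L2_cut[OF L])
  have [measurable]: "f \<in> borel_measurable borel" using f by auto
  define F where "F = fourier_L1 (-1) f"
  have [measurable]: "F \<in> borel_measurable borel" unfolding F_def by measurable
  have d: "is_L2_fourier (-1) (\<lambda>x. cplx u x - f x) (\<lambda>\<xi>. fourier (cplx u) \<xi> - F \<xi>)"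
    unfolding F_def by (intro is_L2_fourier_diff fourier_cplx(1)[OF L] is_L2_fourier_L1 f) simp
  have FB: "(cmod (F \<xi>))\<^sup>2 \<le> N / (4 * pi)" for \<xi>
  proof -
    define t where "t = sqrt (pi / N)"
    have t: "t > 0" using N by (simp add: t_def)
    have "(LINT x|lborel. cmod (f x)) \<le> (LINT x|lborel. (t * (u x)\<^sup>2 + indicator (cball 0 1) x / t) / 2)"
    proof (rule integral_mono)
      show "integrable lborel (\<lambda>x. cmod (f x))" using f by simp
      show "integrable lborel (\<lambda>x. (t * (u x)\<^sup>2 + indicator (cball 0 1) x / t) / 2)"
        using iu integrable_indicator_cball by simp
      fix x :: "real^2"
      have "0 \<le> (t * \<bar>u x\<bar> - 1)\<^sup>2 / t" using t by simp
      also have "\<dots> = t * (u x)\<^sup>2 + 1 / t - 2 * \<bar>u x\<bar>"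
        using t by (simp add: field_simps power2_eq_square)
      finally show "cmod (f x) \<le> (t * (u x)\<^sup>2 + indicator (cball 0 1) x / t) / 2"
        using t by (auto simp: f_def indicator_def)
    qed
    also have "\<dots> = (t * N + measure lborel (cball (0::real^2) 1) / t) / 2"
      using iu integrable_indicator_cball[of 0 1] by (simp add: N_def mass_eq)
    also have "measure lborel (cball (0::real^2) 1) = pi"
      by (simp add: measure_def emeasure_cball unit_ball_vol_2)
    also have "(t * N + pi / t) / 2 = sqrt (pi * N)"
    proof -
      have "t * N = sqrt (pi * N)" unfolding t_def using N
        by (simp add: real_sqrt_divide real_sqrt_mult field_simps)
      moreover have "pi / t = sqrt (pi * N)" unfolding t_def using N
        by (simp add: real_sqrt_divide real_sqrt_mult field_simps)
      ultimately show ?thesis by simp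
    qed
    finally have "cmod (F \<xi>) \<le> sqrt (pi * N) / (2 * pi)"
      unfolding F_def by (intro order_trans[OF fourier_L1_bound[OF f(1)]] divide_right_mono) auto
    then have "(cmod (F \<xi>))\<^sup>2 \<le> (sqrt (pi * N) / (2 * pi))\<^sup>2" by (intro power_mono) auto
    also have "\<dots> = N / (4 * pi)" using N by (simp add: power_divide power_mult_distrib power2_eq_square[of pi])
    finally show ?thesis .
  qed
  have id: "integrable lborel (\<lambda>\<xi>. (cmod (fourier (cplx u) \<xi> - F \<xi>))\<^sup>2)"
    using is_L2_fourierD(2)[OF d] by (simp add: L2_def)
  have dV: "(LINT \<xi>|lborel. (cmod (fourier (cplx u) \<xi> - F \<xi>))\<^sup>2) \<le> V"
  proof -
    have "(LINT \<xi>|lborel. (cmod (fourier (cplx u) \<xi> - F \<xi>))\<^sup>2) = (LINT x|lborel. (cmod (cplx u x - f x))\<^sup>2)"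
      using plancherel[OF d] by (simp add: integral_eq_enn2real_sqnorm)
    also have "\<dots> \<le> V" unfolding V_def
    proof (rule integral_mono[OF _ iV])
      show "integrable lborel (\<lambda>x. (cmod (cplx u x - f x))\<^sup>2)"
        using is_L2_fourierD(1)[OF d] by (simp add: L2_def)
      fix x :: "real^2"
      show "(cmod (cplx u x - f x))\<^sup>2 \<le> (norm x)\<^sup>2 * \<bar>u x\<bar>\<^sup>2"
      proof (cases "norm x \<le> 1")
        case False
        then have "1 * \<bar>u x\<bar>\<^sup>2 \<le> (norm x)\<^sup>2 * \<bar>u x\<bar>\<^sup>2" by (intro mult_right_mono) auto
        then show ?thesis using False by (simp add: f_def)
      qed (simp add: f_def)
    qed
    finally show ?thesis .
  qed
  have iK: "integrable lborel (\<lambda>\<xi>. norm \<xi> powr (2 * s) * (cmod (fourier (cplx u) \<xi>))\<^sup>2)" by (rule kinetic_fourier(2)[OF s us])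
  have "N = (LINT \<xi>|lborel. (cmod (fourier (cplx u) \<xi>))\<^sup>2)" unfolding N_def by (rule mass_fourier[OF L])
  also have "\<dots> \<le> (LINT \<xi>|lborel. indicator (cball 0 1) \<xi> * (2 * (N / (4 * pi))) + 2 * (cmod (fourier (cplx u) \<xi> - F \<xi>))\<^sup>2
      + norm \<xi> powr (2 * s) * (cmod (fourier (cplx u) \<xi>))\<^sup>2)"
  proof (rule integral_mono)
    show "integrable lborel (\<lambda>\<xi>. (cmod (fourier (cplx u) \<xi>))\<^sup>2)" using fourier_cplx(2)[OF L] by (simp add: L2_def)
    show "integrable lborel (\<lambda>\<xi>. indicator (cball 0 1) \<xi> * (2 * (N / (4 * pi))) + 2 * (cmod (fourier (cplx u) \<xi> - F \<xi>))\<^sup>2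
      + norm \<xi> powr (2 * s) * (cmod (fourier (cplx u) \<xi>))\<^sup>2)"
      using id iK integrable_indicator_cball[of 0 1] by (intro Bochner_Integration.integrable_add integrable_mult_left integrable_mult_right) auto
    fix \<xi> :: "real^2"
    show "(cmod (fourier (cplx u) \<xi>))\<^sup>2 \<le> indicator (cball 0 1) \<xi> * (2 * (N / (4 * pi))) + 2 * (cmod (fourier (cplx u) \<xi> - F \<xi>))\<^sup>2
      + norm \<xi> powr (2 * s) * (cmod (fourier (cplx u) \<xi>))\<^sup>2"
    proof (cases "norm \<xi> \<le> 1")
      case True
      have "(cmod (fourier (cplx u) \<xi>))\<^sup>2 \<le> (cmod (F \<xi>) + cmod (fourier (cplx u) \<xi> - F \<xi>))\<^sup>2"
        using norm_triangle_ineq[of "F \<xi>" "fourier (cplx u) \<xi> - F \<xi>"] by (intro power_mono) auto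
      also have "\<dots> \<le> 2 * (cmod (F \<xi>))\<^sup>2 + 2 * (cmod (fourier (cplx u) \<xi> - F \<xi>))\<^sup>2"
        using sum_squares_bound[of "cmod (F \<xi>)" "cmod (fourier (cplx u) \<xi> - F \<xi>)"] by (simp add: power2_sum)
      also have "\<dots> \<le> 2 * (N / (4 * pi)) + 2 * (cmod (fourier (cplx u) \<xi> - F \<xi>))\<^sup>2"
        using FB[of \<xi>] by simp
      also have "\<dots> \<le> \<dots> + norm \<xi> powr (2 * s) * (cmod (fourier (cplx u) \<xi>))\<^sup>2" by simp
      finally show ?thesis using True by simp
    next
      case False
      then have "1 \<le> norm \<xi> powr (2 * s)" using s by (intro ge_one_powr_ge_zero) auto
      then have "1 * (cmod (fourier (cplx u) \<xi>))\<^sup>2 \<le> norm \<xi> powr (2 * s) * (cmod (fourier (cplx u) \<xi>))\<^sup>2"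
        by (rule mult_right_mono) simp
      also have "\<dots> \<le> 2 * (cmod (fourier (cplx u) \<xi> - F \<xi>))\<^sup>2 + \<dots>" by simp
      finally show ?thesis using False by simp
    qed
  qed
  also have "\<dots> = measure lborel (cball (0::real^2) 1) * (2 * (N / (4 * pi))) + 2 * (LINT \<xi>|lborel. (cmod (fourier (cplx u) \<xi> - F \<xi>))\<^sup>2) + kinetic s u"
    using id iK integrable_indicator_cball[of 0 1] by (simp add: kinetic_fourier(1)[OF s us])
  also have "measure lborel (cball (0::real^2) 1) = pi"
    by (simp add: measure_def emeasure_cball unit_ball_vol_2)
  finally have "N \<le> N / 2 + 2 * V + kinetic s u" using dV by (simp add: field_simps)
  then show ?thesis by (simp add: N_def V_def)
qed

lemma no_local_minimizer:
  assumes s: "0 < s" "s < 1" and t: "t \<le> N / 6"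
  shows "\<not> local_positive_minimizer s N t u"
proof
  assume m: "local_positive_minimizer s N t u"
  have s1: "s \<le> 1" using s by simp
  have uS: "u \<in> S_set s N" and Kt: "kinetic s u < t"
    and inf: "ereal (energy s u) = (INF w\<in>A_set s N t. ereal (energy s w))"
    using m by (auto simp: local_positive_minimizer_def)
  have uH: "u \<in> H_space s" and MN: "mass u = N" using uS by (auto simp: S_set_def)
  have us: "u \<in> sobolev s" and iV: "integrable lborel (\<lambda>x. (norm x)\<^sup>2 * \<bar>u x\<bar>\<^sup>2)"
    using uH by (auto simp: H_space_def)
  define K V P where "K = kinetic s u" and "V = (LINT x|lborel. (norm x)\<^sup>2 * \<bar>u x\<bar>\<^sup>2)" and "P = quartic u"
  define \<phi> where "\<phi> l = 1/2 * (l powr (2 * s) * K + V / l\<^sup>2) - 1/4 * (l\<^sup>2 * P)" for l :: real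
  have sc: "(\<lambda>x. l * u (l *\<^sub>R x)) \<in> S_set s N" "kinetic s (\<lambda>x. l * u (l *\<^sub>R x)) = l powr (2 * s) * K"
    "energy s (\<lambda>x. l * u (l *\<^sub>R x)) = \<phi> l" if l: "l > 0" for l
  proof -
    have "integrable lborel (\<lambda>x. (norm (0 + l *\<^sub>R x))\<^sup>2 * \<bar>u (0 + l *\<^sub>R x)\<bar>\<^sup>2)"
      by (rule integrable_affine[OF iV]) (use l in simp)
    moreover have e: "(\<lambda>x. (norm (0 + l *\<^sub>R x))\<^sup>2 * \<bar>u (0 + l *\<^sub>R x)\<bar>\<^sup>2) = (\<lambda>x. (norm x)\<^sup>2 * \<bar>l * u (l *\<^sub>R x)\<bar>\<^sup>2)"
      using l by (intro ext) (simp add: power_mult_distrib abs_mult)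
    ultimately have i: "integrable lborel (\<lambda>x. (norm x)\<^sup>2 * \<bar>l * u (l *\<^sub>R x)\<bar>\<^sup>2)" by simp
    have V: "(LINT x|lborel. (norm x)\<^sup>2 * \<bar>l * u (l *\<^sub>R x)\<bar>\<^sup>2) = V / l\<^sup>2"
      unfolding V_def e[symmetric] using l by (subst (2) integral_affine[of l _ 0]) auto
    have H: "(\<lambda>x. l * u (l *\<^sub>R x)) \<in> H_space s"
      using sobolev_scale(1)[OF s(1) s1 us l, of l] i by (simp add: H_space_def)
    then show "(\<lambda>x. l * u (l *\<^sub>R x)) \<in> S_set s N"
      using mass_scale[OF l, of l u] l MN by (simp add: S_set_def)
    show k: "kinetic s (\<lambda>x. l * u (l *\<^sub>R x)) = l powr (2 * s) * K"
      using sobolev_scale(2)[OF s(1) s1 us l, of l] l by (simp add: K_def powr_diff)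
    show "energy s (\<lambda>x. l * u (l *\<^sub>R x)) = \<phi> l"
      unfolding energy_eq[OF s(1) s1 H] k V quartic_scale[OF l] \<phi>_def P_def
      using l by (simp add: power4_eq_xxxx power2_eq_square)
  qed
  have "((\<lambda>l. l powr (2 * s) * K) \<longlongrightarrow> 1 powr (2 * s) * K) (nhds 1)"
    by (intro tendsto_intros filterlim_ident) auto
  then have "\<forall>\<^sub>F l in nhds 1. l powr (2 * s) * K < t"
    by (rule order_tendstoD) (use Kt in \<open>simp add: K_def\<close>)
  moreover have "\<forall>\<^sub>F l in nhds (1::real). l > 0" using eventually_nhds_in_open[of "{0<..}" "1::real"] by simp
  ultimately have "\<forall>\<^sub>F l in nhds 1. l > 0 \<and> l powr (2 * s) * K < t" by eventually_elim simp
  then obtain e where e: "e > 0" "\<And>l. \<bar>l - 1\<bar> < e \<Longrightarrow> l > 0 \<and> l powr (2 * s) * K < t"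
    by (auto simp: eventually_nhds_metric dist_real_def)
  have e1: "energy s u = \<phi> 1" using sc(3)[of 1] by simp
  have min: "\<phi> 1 \<le> \<phi> l" if "\<bar>1 - l\<bar> < e" for l
  proof -
    have l: "l > 0" "l powr (2 * s) * K < t" using e(2)[of l] that by (auto simp: abs_minus_commute)
    have "(\<lambda>x. l * u (l *\<^sub>R x)) \<in> A_set s N t" using sc(1,2)[OF l(1)] l(2) by (simp add: A_set_def)
    then have "ereal (energy s u) \<le> ereal (energy s (\<lambda>x. l * u (l *\<^sub>R x)))"
      unfolding inf by (rule INF_lower)
    then show ?thesis using sc(3)[OF l(1)] e1 by simp
  qed
  have "(\<phi> has_real_derivative (1/2 * (2 * s * K - 2 * V) - 1/4 * (2 * P))) (at 1)"
    unfolding \<phi>_def by (auto intro!: derivative_eq_intros simp: power2_eq_square)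
  from DERIV_local_min[OF this e(1)] min have "s * K = V + P / 2" by auto
  moreover have "P \<ge> 0" by (simp add: P_def quartic_nonneg)
  moreover have "s * K \<le> 1 * K" using s1 by (intro mult_right_mono) (simp_all add: K_def kinetic_nonneg)
  ultimately have "V \<le> K" by simp
  then have "N \<le> 6 * K" using uncertainty[OF s(1) s1 uH] by (simp add: MN K_def V_def)
  then show False using Kt t by (simp add: K_def)
qed

lemma t_bound_tendsto_0:
  fixes q :: real
  assumes q: "0 < q" "q < 1"
  shows "((\<lambda>s. N / (2 * s - 1) * q powr (s / (1 - s))) \<longlongrightarrow> 0) (at_left 1)"
  using q by real_asymp

lemma weinstein_lower:
  assumes s: "1/2 < s" "s \<le> 1" and K: "(2 * s - 1) * kinetic s u = mass u" and P: "quartic u = kinetic s u + mass u"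
    and M: "mass u > 0"
  shows "mass u / 2 \<le> weinstein s u"
proof -
  define b where "b = 2 * s - 1"
  have b: "0 < b" "b \<le> 1" using s by (auto simp: b_def)
  have s0: "0 < s" using s by simp
  have k: "kinetic s u = mass u / b" using K b by (simp add: b_def field_simps)
  have q: "quartic u = mass u * (2 * s) / b" using P b unfolding k by (simp add: b_def field_simps)
  have "weinstein s u = (mass u powr (1/s) * mass u powr (2 - 1/s)) / b powr (1/s) / (mass u * (2 * s) / b)"
    unfolding weinstein_def k q using M b by (simp add: powr_divide)
  also have "mass u powr (1/s) * mass u powr (2 - 1/s) = (mass u)\<^sup>2"
    using M by (simp add: powr_add[symmetric])
  also have "(mass u)\<^sup>2 / b powr (1/s) / (mass u * (2 * s) / b) = mass u / (2 * s) * (b / b powr (1/s))"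
    using M b s0 by (simp add: power2_eq_square)
  finally have W: "weinstein s u = mass u / (2 * s) * (b / b powr (1/s))" .
  have "b powr (1/s) \<le> b powr 1" using b s by (intro powr_mono') auto
  then have "1 \<le> b / b powr (1/s)" using b by simp
  moreover have "mass u / 2 \<le> mass u / (2 * s)" using M s by (intro divide_left_mono) auto
  ultimately have "mass u / 2 * 1 \<le> mass u / (2 * s) * (b / b powr (1/s))"
    using M s0 by (intro mult_mono) auto
  then show ?thesis by (simp add: W)
qed

lemma weinstein_upper:
  assumes s: "1/2 < s" "s \<le> 1" and u: "u \<in> sobolev 1" and K: "kinetic 1 u = mass u" and P: "quartic u = 2 * mass u"
    and M: "mass u > 0"
  shows "weinstein s u \<le> mass u / 2"
proof -
  have "kinetic s u \<le> mass u"
    using sobolev_antimono(2)[of s 1 u] s u K by (simp add: algebra_simps)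
  then have "kinetic s u powr (1/s) * mass u powr (2 - 1/s) \<le> mass u powr (1/s) * mass u powr (2 - 1/s)"
    using s kinetic_nonneg[of s u] by (intro mult_right_mono powr_mono2) auto
  also have "\<dots> = (mass u)\<^sup>2" using M by (simp add: powr_add[symmetric])
  finally have "weinstein s u \<le> (mass u)\<^sup>2 / (2 * mass u)"
    unfolding weinstein_def P using M by (intro divide_right_mono) auto
  then show ?thesis using M by (simp add: power2_eq_square)
qed

theorem theorem1p3:
  fixes Q :: "real^2 \<Rightarrow> real" and Qs :: "real \<Rightarrow> real^2 \<Rightarrow> real" and N :: real
  assumes Q: "solution 1 Q" "ae_positive Q"
    and Qs: "\<And>s. 1/2 < s \<Longrightarrow> s < 1 \<Longrightarrow> positive_ground_state s (Qs s)"
    and N: "N > mass Q"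
  shows "\<exists>\<epsilon>>0. \<forall>s. 1 - \<epsilon> < s \<and> s < 1 \<longrightarrow>
           \<not> (\<exists>u. local_positive_minimizer s N (t_bound s N (mass (Qs s))) u)"
proof -
  have GN: "\<exists>C\<ge>0. \<forall>v\<in>sobolev s. integrable lborel (\<lambda>x. \<bar>v x\<bar>^4) \<and> quartic v \<le> C * (kinetic s v + mass v)\<^sup>2"
    if "3/4 \<le> s" "s \<le> 1" for s
    by (rule Gagliardo_Nirenberg[of "3/4" s "Qs (3/4)"]) (use that Qs[of "3/4"] in auto)
  have Poh: "(2 * s - 1) * kinetic s u = mass u" if s: "3/4 \<le> s" "s \<le> 1" and u: "solution s u" for s u
  proof -
    obtain C where "C \<ge> 0" "\<forall>v\<in>sobolev s. integrable lborel (\<lambda>x. \<bar>v x\<bar>^4) \<and> quartic v \<le> C * (kinetic s v + mass v)\<^sup>2"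
      using GN[OF s] by blast
    then show ?thesis using Pohozaev_identity[of s u C] s u by auto
  qed
  have Q1: "Q \<in> sobolev 1" using Q by (simp add: solution_def)
  have MQ: "mass Q > 0" by (rule mass_pos_of_nonzero[OF sobolev_L2[OF Q1] ae_positive_nonzero[OF Q(2)]])
  have KQ: "kinetic 1 Q = mass Q" using Poh[of 1 Q] Q by simp
  have PQ: "quartic Q = 2 * mass Q" using solution_Nehari[of 1 Q] Q KQ by simp
  have M: "mass (Qs s) \<le> mass Q \<and> 0 < mass (Qs s)" if s: "3/4 \<le> s" "s < 1" for s
  proof -
    have gs: "positive_ground_state s (Qs s)" using Qs s by simp
    have sol: "solution s (Qs s)" using gs by (simp add: positive_ground_state_def)
    then have qs: "Qs s \<in> sobolev s" by (simp add: solution_def)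
    have Mp: "mass (Qs s) > 0"
      using gs by (intro mass_pos_of_nonzero[OF sobolev_L2[OF qs]] ae_positive_nonzero) (simp add: positive_ground_state_def)
    have "mass (Qs s) / 2 \<le> weinstein s (Qs s)"
      using s Poh[OF _ _ sol] solution_Nehari[OF _ _ sol] Mp by (intro weinstein_lower) auto
    also have "\<dots> \<le> weinstein s Q"
      using gs sobolev_antimono(1)[of s 1 Q] s Q1 ae_positive_nonzero[OF Q(2)] by (auto simp: positive_ground_state_def)
    also have "\<dots> \<le> mass Q / 2" using s by (intro weinstein_upper Q1 KQ PQ MQ) auto
    finally show ?thesis using Mp by simp
  qed
  have N0: "N > 0" using MQ N by simp
  define q where "q = mass Q / N"
  have q: "0 < q" "q < 1" using MQ N N0 by (auto simp: q_def)
  have "\<forall>\<^sub>F s in at_left 1. N / (2 * s - 1) * q powr (s / (1 - s)) < N / 6"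
    using t_bound_tendsto_0[OF q, of N] by (rule order_tendstoD) (use N0 in simp)
  then obtain b where b: "b < 1" "\<And>s. b < s \<Longrightarrow> s < 1 \<Longrightarrow> N / (2 * s - 1) * q powr (s / (1 - s)) < N / 6"
    by (auto simp: eventually_at_left_field)
  define \<epsilon> where "\<epsilon> = min (1 - b) (1/4)"
  show ?thesis
  proof (intro exI[of _ \<epsilon>] conjI allI impI notI)
    show "\<epsilon> > 0" using b by (simp add: \<epsilon>_def)
    fix s assume s: "1 - \<epsilon> < s \<and> s < 1"
    then have s': "b < s" "3/4 \<le> s" "s < 1" by (auto simp: \<epsilon>_def)
    have "(mass (Qs s) / N) powr (s / (1 - s)) \<le> q powr (s / (1 - s))"
      unfolding q_def using M[OF s'(2,3)] N0 s' by (intro powr_mono2 divide_right_mono) auto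
    then have "t_bound s N (mass (Qs s)) \<le> N / (2 * s - 1) * q powr (s / (1 - s))"
      unfolding t_bound_def using N0 s' by (intro mult_left_mono) auto
    also have "\<dots> \<le> N / 6" using b(2)[OF s'(1,3)] by simp
    finally have "\<not> local_positive_minimizer s N (t_bound s N (mass (Qs s))) u" for u
      using s' by (intro no_local_minimizer) auto
    moreover assume "\<exists>u. local_positive_minimizer s N (t_bound s N (mass (Qs s))) u"
    ultimately show False by blast
  qed
qed

end
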